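(* Let $\mathcal{C}$ be a category and let $F$ be a $\mathcal{C}$-shaped diagram of groupoid correspondences $(\mathcal{G}_x,\mathcal{X}_g,\mu_{g,h})$ in which all groupoids are locally compact and all correspondences are proper and locally compact. Let $\mathcal{G}^0=\bigsqcup_{x\in\mathcal{C}^0}\mathcal{G}_x^0$. Let $Y$ be a topological space with an $F$-action, with anchor map $r\colon Y\to\mathcal{G}^0$. Then there is a unique $F$-action on the relative Stone--Čech compactification $\beta_{\mathcal{G}^0}Y$ of $(Y,r)$ such that the canonical map $i_Y\colon Y\to\beta_{\mathcal{G}^0}Y$ is $F$-equivariant.
   Context: Groupoids are étale topological groupoids; $\mathcal{G}$ is locally compact if $\mathcal{G}^0$ is Hausdorff and locally compact. A groupoid correspondence $\mathcal{X}\colon\mathcal{H}\leftarrow\mathcal{G}$: a space with commuting continuous left $\mathcal{H}$-action (anchor $r$) and right $\mathcal{G}$-action (anchor $s$), $s$ a local homeomorphism, right action basic (the map $(\xi,\eta)\mapsto(\xi,\xi\eta)$, $\mathcal{X}\times_{s,\mathcal{G}^0,r}\mathcal{G}\to\mathcal{X}\times_{\mathcal{X}/\mathcal{G}}\mathcal{X}$ is a homeomorphism); proper if $r_*\colon\mathcal{X}/\mathcal{G}\to\mathcal{H}^0$ is proper; locally compact if $\mathcal{H},\mathcal{G}$ are locally compact and $\mathcal{X}/\mathcal{G}$ is Hausdorff. Composition $\mathcal{X}\circ_{\mathcal{G}}\mathcal{Y}=(\mathcal{X}\times_{s,r}\mathcal{Y})/\mathcal{G}$. A diagram: groupoids $\mathcal{G}_x$,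 correspondences $\mathcal{X}_g\colon\mathcal{G}_{x'}\leftarrow\mathcal{G}_x$ for arrows $g\colon x'\leftarrow x$, unital associative equivariant homeomorphisms $\mu_{g,h}\colon\mathcal{X}_g\circ\mathcal{X}_h\to\mathcal{X}_{gh}$; $\gamma_1\cdot\gamma_2:=\mu_{g_1,g_2}([\gamma_1,\gamma_2])$. An $F$-action on $Y$: clopen partition $Y=\bigsqcup_xY_x$, continuous $r\colon Y_x\to\mathcal{G}^0_x$, open continuous surjections $\mathcal{X}_g\times_{s,r}Y_x\to Y_{x'}$, $(\gamma,y)\mapsto\gamma y$, with $r(\gamma_2y)=r(\gamma_2)$, $\gamma_1(\gamma_2 y)=(\gamma_1\cdot\gamma_2)y$, and $\gamma y=\gamma'y'$ implying $\gamma'=\gamma\eta$, $y=\eta y'$ for some $\eta\in\mathcal{G}_x$. An $F$-equivariant map is a continuous map preserving partitions, anchor maps and actions. Relative Stone--Čech compactification: for a locally compact Hausdorff space $B$ and a space $X$ with continuous $r\colon X\to B$, let $H_X\subseteq \mathrm{C_b}(X)$ be the closed linear span of products $f\cdot (h\circ r)$, $f\in\mathrm{C_b}(X)$, $h\in\mathrm C_0(B)$ (a commutative C*-subalgebra). $\beta_BX$ is the spectrum (space of nonzero characters) of $H_X$, so $H_X\cong\mathrm C_0(\beta_BX)$, and $i\colon X\to\beta_BX$ sends $x$ to the character $\varphi\mapsto\varphi(x)$. *)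

theory Defs
  imports "HOL-Analysis.Analysis"
begin

definition quot_top :: "'a topology \<Rightarrow> 'a set set \<Rightarrow> 'a set topology" where
  "quot_top X P = topology_generated_by {U. U \<subseteq> P \<and> openin X (\<Union>U)}"

definition local_homeo :: "'a topology \<Rightarrow> 'b topology \<Rightarrow> ('a \<Rightarrow> 'b) \<Rightarrow> bool" where
  "local_homeo X Y f \<longleftrightarrow> f \<in> topspace X \<rightarrow> topspace Y \<and>
     (\<forall>x\<in>topspace X. \<exists>U. openin X U \<and> x \<in> U \<and> openin Y (f ` U) \<and>
        homeomorphic_map (subtopology X U) (subtopology Y (f ` U)) f)"

record 'a groupoid =
  gtop :: "'a topology"
  gunits :: "'a set"
  grng :: "'a \<Rightarrow> 'a"
  gsrc :: "'a \<Rightarrow> 'a"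
  gmul :: "'a \<Rightarrow> 'a \<Rightarrow> 'a"
  ginv :: "'a \<Rightarrow> 'a"

abbreviation garr :: "'a groupoid \<Rightarrow> 'a set" where
  "garr G \<equiv> topspace (gtop G)"

abbreviation unit_top :: "'a groupoid \<Rightarrow> 'a topology" where
  "unit_top G \<equiv> subtopology (gtop G) (gunits G)"

definition gcomp :: "'a groupoid \<Rightarrow> ('a \<times> 'a) set" where
  "gcomp G = {(g, h). g \<in> garr G \<and> h \<in> garr G \<and> gsrc G g = grng G h}"

definition etale_groupoid :: "'a groupoid \<Rightarrow> bool" where
  "etale_groupoid G \<longleftrightarrow>
     gunits G \<subseteq> garr G \<and>
     (\<forall>g\<in>garr G. grng G g \<in> gunits G \<and> gsrc G g \<in> gunits G) \<and>
     (\<forall>u\<in>gunits G. grng G u = u \<and> gsrc G u = u) \<and>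
     (\<forall>(g, h)\<in>gcomp G. gmul G g h \<in> garr G \<and> grng G (gmul G g h) = grng G g \<and>
                         gsrc G (gmul G g h) = gsrc G h) \<and>
     (\<forall>g h k. (g, h) \<in> gcomp G \<longrightarrow> (h, k) \<in> gcomp G \<longrightarrow>
                gmul G (gmul G g h) k = gmul G g (gmul G h k)) \<and>
     (\<forall>g\<in>garr G. gmul G (grng G g) g = g \<and> gmul G g (gsrc G g) = g) \<and>
     (\<forall>g\<in>garr G. ginv G g \<in> garr G \<and> grng G (ginv G g) = gsrc G g \<and>
                  gsrc G (ginv G g) = grng G g \<and>
                  gmul G g (ginv G g) = grng G g \<and> gmul G (ginv G g) g = gsrc G g) \<and>
     continuous_map (subtopology (prod_topology (gtop G) (gtop G)) (gcomp G)) (gtop G)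
        (\<lambda>(g, h). gmul G g h) \<and>
     continuous_map (gtop G) (gtop G) (ginv G) \<and>
     local_homeo (gtop G) (unit_top G) (grng G) \<and>
     local_homeo (gtop G) (unit_top G) (gsrc G)"

definition lc_groupoid :: "'a groupoid \<Rightarrow> bool" where
  "lc_groupoid G \<longleftrightarrow> Hausdorff_space (unit_top G) \<and> locally_compact_space (unit_top G)"

text \<open>A space with a left action (anchor crng, action lact) and a right action
  (anchor csrc, action ract).\<close>
record 'a corr =
  ctop :: "'a topology"
  crng :: "'a \<Rightarrow> 'a"
  csrc :: "'a \<Rightarrow> 'a"
  lact :: "'a \<Rightarrow> 'a \<Rightarrow> 'a"
  ract :: "'a \<Rightarrow> 'a \<Rightarrow> 'a"

definition rdom :: "'a corr \<Rightarrow> 'a groupoid \<Rightarrow> ('a \<times> 'a) set" where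
  "rdom X G = {(\<xi>, g). \<xi> \<in> topspace (ctop X) \<and> g \<in> garr G \<and> csrc X \<xi> = grng G g}"

definition ldom :: "'a groupoid \<Rightarrow> 'a corr \<Rightarrow> ('a \<times> 'a) set" where
  "ldom H X = {(h, \<xi>). h \<in> garr H \<and> \<xi> \<in> topspace (ctop X) \<and> gsrc H h = crng X \<xi>}"

definition right_action :: "'a corr \<Rightarrow> 'a groupoid \<Rightarrow> bool" where
  "right_action X G \<longleftrightarrow>
     continuous_map (ctop X) (unit_top G) (csrc X) \<and>
     continuous_map (subtopology (prod_topology (ctop X) (gtop G)) (rdom X G)) (ctop X)
        (\<lambda>(\<xi>, g). ract X \<xi> g) \<and>
     (\<forall>(\<xi>, g)\<in>rdom X G. csrc X (ract X \<xi> g) = gsrc G g) \<and>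
     (\<forall>\<xi> g g'. (\<xi>, g) \<in> rdom X G \<longrightarrow> (g, g') \<in> gcomp G \<longrightarrow>
                  ract X (ract X \<xi> g) g' = ract X \<xi> (gmul G g g')) \<and>
     (\<forall>\<xi>\<in>topspace (ctop X). ract X \<xi> (csrc X \<xi>) = \<xi>)"

definition left_action :: "'a groupoid \<Rightarrow> 'a corr \<Rightarrow> bool" where
  "left_action H X \<longleftrightarrow>
     continuous_map (ctop X) (unit_top H) (crng X) \<and>
     continuous_map (subtopology (prod_topology (gtop H) (ctop X)) (ldom H X)) (ctop X)
        (\<lambda>(h, \<xi>). lact X h \<xi>) \<and>
     (\<forall>(h, \<xi>)\<in>ldom H X. crng X (lact X h \<xi>) = grng H h) \<and>
     (\<forall>h h' \<xi>. (h, h') \<in> gcomp H \<longrightarrow> (h', \<xi>) \<in> ldom H X \<longrightarrow>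
                  lact X h (lact X h' \<xi>) = lact X (gmul H h h') \<xi>) \<and>
     (\<forall>\<xi>\<in>topspace (ctop X). lact X (crng X \<xi>) \<xi> = \<xi>)"

definition orbit :: "'a corr \<Rightarrow> 'a groupoid \<Rightarrow> 'a \<Rightarrow> 'a set" where
  "orbit X G \<xi> = {ract X \<xi> g | g. (\<xi>, g) \<in> rdom X G}"

definition orbits :: "'a corr \<Rightarrow> 'a groupoid \<Rightarrow> 'a set set" where
  "orbits X G = orbit X G ` topspace (ctop X)"

definition orbit_top :: "'a corr \<Rightarrow> 'a groupoid \<Rightarrow> 'a set topology" where
  "orbit_top X G = quot_top (ctop X) (orbits X G)"

definition basic_action :: "'a corr \<Rightarrow> 'a groupoid \<Rightarrow> bool" where
  "basic_action X G \<longleftrightarrow>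
     homeomorphic_map
       (subtopology (prod_topology (ctop X) (gtop G)) (rdom X G))
       (subtopology (prod_topology (ctop X) (ctop X))
          {(\<xi>, \<xi>'). \<xi> \<in> topspace (ctop X) \<and> \<xi>' \<in> topspace (ctop X) \<and>
                     orbit X G \<xi> = orbit X G \<xi>'})
       (\<lambda>(\<xi>, g). (\<xi>, ract X \<xi> g))"

definition is_corr :: "'a groupoid \<Rightarrow> 'a groupoid \<Rightarrow> 'a corr \<Rightarrow> bool" where
  "is_corr H G X \<longleftrightarrow>
     left_action H X \<and> right_action X G \<and>
     (\<forall>(h, \<xi>)\<in>ldom H X. csrc X (lact X h \<xi>) = csrc X \<xi>) \<and>
     (\<forall>(\<xi>, g)\<in>rdom X G. crng X (ract X \<xi> g) = crng X \<xi>) \<and>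
     (\<forall>h \<xi> g. (h, \<xi>) \<in> ldom H X \<longrightarrow> (\<xi>, g) \<in> rdom X G \<longrightarrow>
                ract X (lact X h \<xi>) g = lact X h (ract X \<xi> g)) \<and>
     local_homeo (ctop X) (unit_top G) (csrc X) \<and>
     basic_action X G"

text \<open>Proper: the induced map r_* : X/G -> H^0 is proper (preimages of compact sets are compact).\<close>
definition proper_corr :: "'a groupoid \<Rightarrow> 'a groupoid \<Rightarrow> 'a corr \<Rightarrow> bool" where
  "proper_corr H G X \<longleftrightarrow>
     (\<forall>K. compactin (unit_top H) K \<longrightarrow>
        compactin (orbit_top X G) {orbit X G \<xi> | \<xi>. \<xi> \<in> topspace (ctop X) \<and> crng X \<xi> \<in> K})"

definition lc_corr :: "'a groupoid \<Rightarrow> 'a groupoid \<Rightarrow> 'a corr \<Rightarrow> bool" where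
  "lc_corr H G X \<longleftrightarrow> lc_groupoid H \<and> lc_groupoid G \<and> Hausdorff_space (orbit_top X G)"

text \<open>Composition X o_G Y = (X \<times>_{s,r} Y)/G.\<close>
definition cfib :: "'a corr \<Rightarrow> 'a corr \<Rightarrow> ('a \<times> 'a) set" where
  "cfib X Y = {(\<xi>, \<eta>). \<xi> \<in> topspace (ctop X) \<and> \<eta> \<in> topspace (ctop Y) \<and> csrc X \<xi> = crng Y \<eta>}"

definition cclass :: "'a corr \<Rightarrow> 'a groupoid \<Rightarrow> 'a corr \<Rightarrow> 'a \<Rightarrow> 'a \<Rightarrow> ('a \<times> 'a) set" where
  "cclass X G Y \<xi> \<eta> = {(ract X \<xi> g, lact Y (ginv G g) \<eta>) | g. g \<in> garr G \<and> grng G g = csrc X \<xi>}"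

definition comp_top :: "'a corr \<Rightarrow> 'a groupoid \<Rightarrow> 'a corr \<Rightarrow> ('a \<times> 'a) set topology" where
  "comp_top X G Y = quot_top (subtopology (prod_topology (ctop X) (ctop Y)) (cfib X Y))
                             ((\<lambda>(\<xi>, \<eta>). cclass X G Y \<xi> \<eta>) ` cfib X Y)"

definition id_corr :: "'a groupoid \<Rightarrow> 'a corr" where
  "id_corr G = \<lparr>ctop = gtop G, crng = grng G, csrc = gsrc G, lact = gmul G, ract = gmul G\<rparr>"

record ('o, 'm) category =
  cobj :: "'o set"
  carr :: "'m set"
  cdom :: "'m \<Rightarrow> 'o"
  ccod :: "'m \<Rightarrow> 'o"
  cmp :: "'m \<Rightarrow> 'm \<Rightarrow> 'm"
  cid :: "'o \<Rightarrow> 'm"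

definition is_category :: "('o, 'm) category \<Rightarrow> bool" where
  "is_category C \<longleftrightarrow>
     (\<forall>f\<in>carr C. cdom C f \<in> cobj C \<and> ccod C f \<in> cobj C) \<and>
     (\<forall>x\<in>cobj C. cid C x \<in> carr C \<and> cdom C (cid C x) = x \<and> ccod C (cid C x) = x) \<and>
     (\<forall>f\<in>carr C. \<forall>g\<in>carr C. cdom C f = ccod C g \<longrightarrow>
        cmp C f g \<in> carr C \<and> cdom C (cmp C f g) = cdom C g \<and> ccod C (cmp C f g) = ccod C f) \<and>
     (\<forall>f\<in>carr C. \<forall>g\<in>carr C. \<forall>h\<in>carr C. cdom C f = ccod C g \<longrightarrow> cdom C g = ccod C h \<longrightarrow>
        cmp C (cmp C f g) h = cmp C f (cmp C g h)) \<and>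
     (\<forall>f\<in>carr C. cmp C (cid C (ccod C f)) f = f \<and> cmp C f (cid C (cdom C f)) = f)"

text \<open>For an arrow g : x' <- x we have cdom C g = x and ccod C g = x'.
  The product gamma1 . gamma2 = mu g h ([gamma1, gamma2]).\<close>
definition dotp :: "('o, 'm) category \<Rightarrow> ('o \<Rightarrow> 'a groupoid) \<Rightarrow> ('m \<Rightarrow> 'a corr)
     \<Rightarrow> ('m \<Rightarrow> 'm \<Rightarrow> ('a \<times> 'a) set \<Rightarrow> 'a) \<Rightarrow> 'm \<Rightarrow> 'm \<Rightarrow> 'a \<Rightarrow> 'a \<Rightarrow> 'a" where
  "dotp C Gs Xs mu g h \<gamma>1 \<gamma>2 = mu g h (cclass (Xs g) (Gs (cdom C g)) (Xs h) \<gamma>1 \<gamma>2)"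

definition is_diagram :: "('o, 'm) category \<Rightarrow> ('o \<Rightarrow> 'a groupoid) \<Rightarrow> ('m \<Rightarrow> 'a corr)
     \<Rightarrow> ('m \<Rightarrow> 'm \<Rightarrow> ('a \<times> 'a) set \<Rightarrow> 'a) \<Rightarrow> bool" where
  "is_diagram C Gs Xs mu \<longleftrightarrow>
     is_category C \<and>
     (\<forall>x\<in>cobj C. etale_groupoid (Gs x)) \<and>
     (\<forall>g\<in>carr C. is_corr (Gs (ccod C g)) (Gs (cdom C g)) (Xs g)) \<and>
     (\<forall>x\<in>cobj C. Xs (cid C x) = id_corr (Gs x)) \<and>
     (\<forall>g\<in>carr C. \<forall>h\<in>carr C. cdom C g = ccod C h \<longrightarrow>
        homeomorphic_map (comp_top (Xs g) (Gs (cdom C g)) (Xs h)) (ctop (Xs (cmp C g h))) (mu g h) \<and>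
        (\<forall>(\<xi>, \<eta>)\<in>cfib (Xs g) (Xs h).
           crng (Xs (cmp C g h)) (dotp C Gs Xs mu g h \<xi> \<eta>) = crng (Xs g) \<xi> \<and>
           csrc (Xs (cmp C g h)) (dotp C Gs Xs mu g h \<xi> \<eta>) = csrc (Xs h) \<eta> \<and>
           (\<forall>k. (k, \<xi>) \<in> ldom (Gs (ccod C g)) (Xs g) \<longrightarrow>
                dotp C Gs Xs mu g h (lact (Xs g) k \<xi>) \<eta> =
                lact (Xs (cmp C g h)) k (dotp C Gs Xs mu g h \<xi> \<eta>)) \<and>
           (\<forall>k. (\<eta>, k) \<in> rdom (Xs h) (Gs (cdom C h)) \<longrightarrow>
                dotp C Gs Xs mu g h \<xi> (ract (Xs h) \<eta> k) =
                ract (Xs (cmp C g h)) (dotp C Gs Xs mu g h \<xi> \<eta>) k))) \<and>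
     (\<forall>g\<in>carr C. \<forall>(\<gamma>, \<xi>)\<in>cfib (Xs (cid C (ccod C g))) (Xs g).
        dotp C Gs Xs mu (cid C (ccod C g)) g \<gamma> \<xi> = lact (Xs g) \<gamma> \<xi>) \<and>
     (\<forall>g\<in>carr C. \<forall>(\<xi>, \<gamma>)\<in>cfib (Xs g) (Xs (cid C (cdom C g))).
        dotp C Gs Xs mu g (cid C (cdom C g)) \<xi> \<gamma> = ract (Xs g) \<xi> \<gamma>) \<and>
     (\<forall>g1\<in>carr C. \<forall>g2\<in>carr C. \<forall>g3\<in>carr C. \<forall>\<xi>1 \<xi>2 \<xi>3.
        cdom C g1 = ccod C g2 \<longrightarrow> cdom C g2 = ccod C g3 \<longrightarrow>
        (\<xi>1, \<xi>2) \<in> cfib (Xs g1) (Xs g2) \<longrightarrow> (\<xi>2, \<xi>3) \<in> cfib (Xs g2) (Xs g3) \<longrightarrow>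
        dotp C Gs Xs mu (cmp C g1 g2) g3 (dotp C Gs Xs mu g1 g2 \<xi>1 \<xi>2) \<xi>3 =
        dotp C Gs Xs mu g1 (cmp C g2 g3) \<xi>1 (dotp C Gs Xs mu g2 g3 \<xi>2 \<xi>3))"

definition adom :: "('o, 'm) category \<Rightarrow> ('m \<Rightarrow> 'a corr) \<Rightarrow> ('o \<Rightarrow> 'y set) \<Rightarrow> ('y \<Rightarrow> 'a)
     \<Rightarrow> 'm \<Rightarrow> ('a \<times> 'y) set" where
  "adom C Xs P ra g = {(\<gamma>, y). \<gamma> \<in> topspace (ctop (Xs g)) \<and> y \<in> P (cdom C g) \<and> csrc (Xs g) \<gamma> = ra y}"

definition F_action :: "('o, 'm) category \<Rightarrow> ('o \<Rightarrow> 'a groupoid) \<Rightarrow> ('m \<Rightarrow> 'a corr)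
     \<Rightarrow> ('m \<Rightarrow> 'm \<Rightarrow> ('a \<times> 'a) set \<Rightarrow> 'a) \<Rightarrow> 'y topology
     \<Rightarrow> ('o \<Rightarrow> 'y set) \<Rightarrow> ('y \<Rightarrow> 'a) \<Rightarrow> ('m \<Rightarrow> 'a \<Rightarrow> 'y \<Rightarrow> 'y) \<Rightarrow> bool" where
  "F_action C Gs Xs mu T P ra act \<longleftrightarrow>
     (\<forall>x\<in>cobj C. openin T (P x) \<and> closedin T (P x)) \<and>
     (\<forall>x\<in>cobj C. \<forall>x'\<in>cobj C. x \<noteq> x' \<longrightarrow> P x \<inter> P x' = {}) \<and>
     (\<Union>x\<in>cobj C. P x) = topspace T \<and>
     (\<forall>x\<in>cobj C. continuous_map (subtopology T (P x)) (unit_top (Gs x)) ra) \<and>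
     (\<forall>g\<in>carr C.
        continuous_map (subtopology (prod_topology (ctop (Xs g)) T) (adom C Xs P ra g))
          (subtopology T (P (ccod C g))) (\<lambda>(\<gamma>, y). act g \<gamma> y) \<and>
        open_map (subtopology (prod_topology (ctop (Xs g)) T) (adom C Xs P ra g))
          (subtopology T (P (ccod C g))) (\<lambda>(\<gamma>, y). act g \<gamma> y) \<and>
        (\<lambda>(\<gamma>, y). act g \<gamma> y) ` adom C Xs P ra g = P (ccod C g) \<and>
        (\<forall>(\<gamma>, y)\<in>adom C Xs P ra g. ra (act g \<gamma> y) = crng (Xs g) \<gamma>)) \<and>
     (\<forall>g1\<in>carr C. \<forall>g2\<in>carr C. \<forall>\<gamma>1 \<gamma>2 y.
        cdom C g1 = ccod C g2 \<longrightarrow> (\<gamma>1, \<gamma>2) \<in> cfib (Xs g1) (Xs g2) \<longrightarrow>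
        (\<gamma>2, y) \<in> adom C Xs P ra g2 \<longrightarrow>
        act g1 \<gamma>1 (act g2 \<gamma>2 y) = act (cmp C g1 g2) (dotp C Gs Xs mu g1 g2 \<gamma>1 \<gamma>2) y) \<and>
     (\<forall>g\<in>carr C. \<forall>\<gamma> y \<gamma>' y'.
        (\<gamma>, y) \<in> adom C Xs P ra g \<longrightarrow> (\<gamma>', y') \<in> adom C Xs P ra g \<longrightarrow>
        act g \<gamma> y = act g \<gamma>' y' \<longrightarrow>
        (\<exists>\<eta>\<in>garr (Gs (cdom C g)).
           grng (Gs (cdom C g)) \<eta> = csrc (Xs g) \<gamma> \<and> gsrc (Gs (cdom C g)) \<eta> = ra y' \<and>
           \<gamma>' = ract (Xs g) \<gamma> \<eta> \<and> y = act (cid C (cdom C g)) \<eta> y'))"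

definition F_equivariant :: "('o, 'm) category \<Rightarrow> ('m \<Rightarrow> 'a corr)
     \<Rightarrow> 'y topology \<Rightarrow> ('o \<Rightarrow> 'y set) \<Rightarrow> ('y \<Rightarrow> 'a) \<Rightarrow> ('m \<Rightarrow> 'a \<Rightarrow> 'y \<Rightarrow> 'y)
     \<Rightarrow> 'z topology \<Rightarrow> ('o \<Rightarrow> 'z set) \<Rightarrow> ('z \<Rightarrow> 'a) \<Rightarrow> ('m \<Rightarrow> 'a \<Rightarrow> 'z \<Rightarrow> 'z)
     \<Rightarrow> ('y \<Rightarrow> 'z) \<Rightarrow> bool" where
  "F_equivariant C Xs T P ra act T' P' ra' act' \<phi> \<longleftrightarrow>
     continuous_map T T' \<phi> \<and>
     (\<forall>x\<in>cobj C. \<phi> ` P x \<subseteq> P' x) \<and>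
     (\<forall>y\<in>topspace T. ra' (\<phi> y) = ra y) \<and>
     (\<forall>g\<in>carr C. \<forall>(\<gamma>, y)\<in>adom C Xs P ra g. \<phi> (act g \<gamma> y) = act' g \<gamma> (\<phi> y))"

definition same_F_action :: "('o, 'm) category \<Rightarrow> ('m \<Rightarrow> 'a corr) \<Rightarrow> 'z topology
     \<Rightarrow> ('o \<Rightarrow> 'z set) \<Rightarrow> ('z \<Rightarrow> 'a) \<Rightarrow> ('m \<Rightarrow> 'a \<Rightarrow> 'z \<Rightarrow> 'z)
     \<Rightarrow> ('o \<Rightarrow> 'z set) \<Rightarrow> ('z \<Rightarrow> 'a) \<Rightarrow> ('m \<Rightarrow> 'a \<Rightarrow> 'z \<Rightarrow> 'z) \<Rightarrow> bool" where
  "same_F_action C Xs T P1 ra1 act1 P2 ra2 act2 \<longleftrightarrow>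
     (\<forall>x\<in>cobj C. P1 x = P2 x) \<and>
     (\<forall>b\<in>topspace T. ra1 b = ra2 b) \<and>
     (\<forall>g\<in>carr C. \<forall>(\<gamma>, b)\<in>adom C Xs P1 ra1 g. act1 g \<gamma> b = act2 g \<gamma> b)"

definition Cb :: "'y topology \<Rightarrow> ('y \<Rightarrow> complex) set" where
  "Cb T = {f. continuous_map T euclidean f \<and> (\<exists>M. \<forall>y\<in>topspace T. norm (f y) \<le> M) \<and>
              (\<forall>y. y \<notin> topspace T \<longrightarrow> f y = 0)}"

definition C0 :: "'b topology \<Rightarrow> ('b \<Rightarrow> complex) set" where
  "C0 B = {h. continuous_map B euclidean h \<and>
              (\<forall>\<epsilon>>0. compactin B {b \<in> topspace B. norm (h b) \<ge> \<epsilon>})}"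

definition HX :: "'y topology \<Rightarrow> 'b topology \<Rightarrow> ('y \<Rightarrow> 'b) \<Rightarrow> ('y \<Rightarrow> complex) set" where
  "HX T B r = {f \<in> Cb T. \<forall>\<epsilon>>0. \<exists>(n::nat) fs hs. (\<forall>i<n. fs i \<in> Cb T \<and> hs i \<in> C0 B) \<and>
       (\<forall>y\<in>topspace T. norm (f y - (\<Sum>i<n. fs i y * hs i (r y))) \<le> \<epsilon>)}"

definition chars :: "'y topology \<Rightarrow> 'b topology \<Rightarrow> ('y \<Rightarrow> 'b) \<Rightarrow> (('y \<Rightarrow> complex) \<Rightarrow> complex) set" where
  "chars T B r = {\<phi> \<in> extensional (HX T B r).
      (\<exists>f\<in>HX T B r. \<phi> f \<noteq> 0) \<and>
      (\<forall>f\<in>HX T B r. \<forall>g\<in>HX T B r. \<phi> (\<lambda>y. f y + g y) = \<phi> f + \<phi> g \<and>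
                                      \<phi> (\<lambda>y. f y * g y) = \<phi> f * \<phi> g) \<and>
      (\<forall>c. \<forall>f\<in>HX T B r. \<phi> (\<lambda>y. c * f y) = c * \<phi> f)}"

text \<open>beta_B Y: the spectrum of H_X with the weak-* topology.\<close>
definition beta_top :: "'y topology \<Rightarrow> 'b topology \<Rightarrow> ('y \<Rightarrow> 'b) \<Rightarrow> (('y \<Rightarrow> complex) \<Rightarrow> complex) topology" where
  "beta_top T B r = subtopology (product_topology (\<lambda>_. euclidean) (HX T B r)) (chars T B r)"

definition beta_i :: "'y topology \<Rightarrow> 'b topology \<Rightarrow> ('y \<Rightarrow> 'b) \<Rightarrow> 'y \<Rightarrow> (('y \<Rightarrow> complex) \<Rightarrow> complex)" where
  "beta_i T B r y = restrict (\<lambda>f. f y) (HX T B r)"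

definition unit_sum :: "('o, 'm) category \<Rightarrow> ('o \<Rightarrow> 'a groupoid) \<Rightarrow> ('o \<times> 'a) topology" where
  "unit_sum C Gs = sum_topology (\<lambda>x. unit_top (Gs x)) (cobj C)"

definition anchor_sum :: "('o, 'm) category \<Rightarrow> ('o \<Rightarrow> 'y set) \<Rightarrow> ('y \<Rightarrow> 'a) \<Rightarrow> 'y \<Rightarrow> 'o \<times> 'a" where
  "anchor_sum C P ra y = (THE x. x \<in> cobj C \<and> y \<in> P x, ra y)"

end

theory Submission
  imports Defs
begin

text \<open>
  Every bounded continuous function on \<open>Y\<close> extends to \<open>\<beta>Y\<close>, the evaluations are dense, and a map
  into \<open>Y\<close> composed with \<open>i\<^sub>Y\<close> extends along a dense map as soon as the functions in \<open>H\<^sub>Y\<close> and the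
  anchor map do: the extended values are characters by density. Since \<open>s\<close> is a local
  homeomorphism, this applies to the action \<open>X \<times> Y\<^sub>x \<rightarrow> Y\<^bsub>x'\<^esub>\<close> and gives a map \<open>X \<times> \<beta>Y\<^sub>x \<rightarrow> \<beta>Y\<^bsub>x'\<^esub>\<close>.
  For surjectivity, openness and the cancellation axiom, the map \<open>\<gamma>y \<mapsto> [\<gamma>]\<close> from \<open>Y\<^bsub>x'\<^esub>\<close> to
  \<open>X/G\<close> extends to \<open>\<beta>Y\<^bsub>x'\<^esub>\<close>; this is where properness enters. Over the open image of a slice
  \<open>U \<subseteq> X\<close> in \<open>X/G\<close> the action on \<open>Y\<close> has a continuous inverse, which extends by the same principle
  and inverts the extended action. Identities and uniqueness hold on a dense subset and hence
  everywhere.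
\<close>

section \<open>Extension of maps along dense maps\<close>

text \<open>The space \<open>Y\<close> is arbitrary, so \<open>\<iota>\<close> need not be
  injective. Extending \<open>f\<close> therefore means finding \<open>g\<close> with
  \<open>g (j d) = f d\<close> for a map \<open>j\<close> with dense image, and all extension
  results are phrased for such a \<open>j\<close>. The fibre product of \<open>X\<close> with
  \<open>\<beta>Y\<close> is not known to be a relative compactification of the fibre product of
  \<open>X\<close> with \<open>Y\<close>, so no universal property applies to the action. Its
  extension is built locally, where a section of \<open>s\<close> turns functions on the fibre
  product into bounded functions on an open part of \<open>Y\<close>; a cut-off on
  \<open>\<beta>Y\<close> compensates for their being defined only there. Some conditions are not
  closed and do not pass to limits by density: a limit of characters may be zero, and a limit of
  orbits may leave \<open>X/G\<close>. The first is excluded by requiring that the anchor extends as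
  well, the second by properness. Surjectivity, openness and cancellation of the action are not
  closed conditions either, which is why explicit local inverses are needed for them, while density
  suffices for equations.\<close>

definition dense_map :: "'d topology \<Rightarrow> 'e topology \<Rightarrow> ('d \<Rightarrow> 'e) \<Rightarrow> bool" where
  "dense_map D E j \<longleftrightarrow> continuous_map D E j \<and>
     (\<forall>W. openin E W \<longrightarrow> W \<noteq> {} \<longrightarrow> (\<exists>d\<in>topspace D. j d \<in> W))"

definition extends_along ::
    "'d topology \<Rightarrow> 'e topology \<Rightarrow> ('d \<Rightarrow> 'e) \<Rightarrow> 'q topology \<Rightarrow> ('d \<Rightarrow> 'q) \<Rightarrow> bool" where
  "extends_along D E j Q f \<longleftrightarrow>
     (\<exists>g. continuous_map E Q g \<and> (\<forall>d\<in>topspace D. g (j d) = f d))"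

lemma extends_alongI:
  "continuous_map E Q g \<Longrightarrow> (\<And>d. d \<in> topspace D \<Longrightarrow> g (j d) = f d) \<Longrightarrow> extends_along D E j Q f"
  unfolding extends_along_def by blast

lemma dense_map_imp_continuous: "dense_map D E j \<Longrightarrow> continuous_map D E j"
  by (simp add: dense_map_def)

lemma dense_map_meets:
  "dense_map D E j \<Longrightarrow> openin E W \<Longrightarrow> e \<in> W \<Longrightarrow> \<exists>d\<in>topspace D. j d \<in> W"
  unfolding dense_map_def by blast

lemma dense_map_agree:
  assumes j: "dense_map D E j" and Q: "Hausdorff_space Q"
    and g: "continuous_map E Q g" and g': "continuous_map E Q g'"
    and eq: "\<And>d. d \<in> topspace D \<Longrightarrow> g (j d) = g' (j d)" and e: "e \<in> topspace E"
  shows "g e = g' e"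
proof -
  have "e \<in> E closure_of (j ` topspace D)"
    using j e unfolding in_closure_of dense_map_def by fastforce
  then show ?thesis
    using forall_in_closure_of_eq[OF _ Q g g'] eq by auto
qed

lemma dense_map_open_restrict:
  assumes "dense_map D E j" "openin E N"
  shows "dense_map (subtopology D {d \<in> topspace D. j d \<in> N}) (subtopology E N) j"
  unfolding dense_map_def
proof (intro conjI allI impI)
  show "continuous_map (subtopology D {d \<in> topspace D. j d \<in> N}) (subtopology E N) j"
    using dense_map_imp_continuous[OF assms(1)]
    by (auto simp: continuous_map_in_subtopology continuous_map_from_subtopology)
  fix W assume "openin (subtopology E N) W" "W \<noteq> {}"
  then have "openin E W" "W \<subseteq> N"
    using assms(2) by (auto simp: openin_open_subtopology)
  then show "\<exists>d\<in>topspace (subtopology D {d \<in> topspace D. j d \<in> N}). j d \<in> W"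
    using dense_map_meets[OF assms(1)] \<open>W \<noteq> {}\<close> by fastforce
qed

text \<open>The restriction of a dense map to an open part of the target is again dense, so local
  extensions agree on overlaps because \<open>Q\<close> is Hausdorff. They can then be
  glued.\<close>

lemma extends_along_local:
  assumes j: "dense_map D E j" and Q: "Hausdorff_space Q"
    and loc: "\<And>e. e \<in> topspace E \<Longrightarrow> \<exists>N. openin E N \<and> e \<in> N \<and>
       extends_along (subtopology D {d \<in> topspace D. j d \<in> N}) (subtopology E N) j Q f"
  shows "extends_along D E j Q f"
proof -
  obtain N where N: "\<And>e. e \<in> topspace E \<Longrightarrow> openin E (N e) \<and> e \<in> N e \<and>
       extends_along (subtopology D {d \<in> topspace D. j d \<in> N e}) (subtopology E (N e)) j Q f"
    using loc by metis
  then obtain g where g: "\<And>e. e \<in> topspace E \<Longrightarrow> continuous_map (subtopology E (N e)) Q (g e)"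
    "\<And>e d. e \<in> topspace E \<Longrightarrow> d \<in> topspace D \<Longrightarrow> j d \<in> N e \<Longrightarrow> g e (j d) = f d"
  proof -
    have "\<forall>e\<in>topspace E. \<exists>g. continuous_map (subtopology E (N e)) Q g \<and>
        (\<forall>d\<in>topspace D. j d \<in> N e \<longrightarrow> g (j d) = f d)"
    proof
      fix e assume "e \<in> topspace E"
      from N[OF this] show "\<exists>g. continuous_map (subtopology E (N e)) Q g \<and>
        (\<forall>d\<in>topspace D. j d \<in> N e \<longrightarrow> g (j d) = f d)"
        unfolding extends_along_def by (elim conjE exE, intro exI conjI) auto
    qed
    then show ?thesis using that unfolding bchoice_iff by blast
  qed
  have agree: "g e x = g e' x" if e: "e \<in> topspace E" "e' \<in> topspace E"
    and x: "x \<in> topspace E \<inter> N e \<inter> N e'" for e e' x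
  proof (rule dense_map_agree[where g = "g e" and g' = "g e'"])
    show "dense_map (subtopology D {d \<in> topspace D. j d \<in> N e \<inter> N e'})
            (subtopology E (N e \<inter> N e')) j"
      using dense_map_open_restrict[OF j, of "N e \<inter> N e'"] N e by auto
    show "continuous_map (subtopology E (N e \<inter> N e')) Q (g e)"
      "continuous_map (subtopology E (N e \<inter> N e')) Q (g e')"
      using g(1) e by (meson continuous_map_from_subtopology_mono inf_le1 inf_le2)+
    show "g e (j d) = g e' (j d)"
      if "d \<in> topspace (subtopology D {d \<in> topspace D. j d \<in> N e \<inter> N e'})" for d
      using that g(2) e by auto
    show "x \<in> topspace (subtopology E (N e \<inter> N e'))" using x by auto
  qed (rule Q)
  \<comment> \<open>At each point \<open>x\<close> the glued map uses the local extension chosen for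
    \<open>x\<close> itself; \<open>agree\<close> identifies it near \<open>e\<close> with the
    single map \<open>g e\<close>.\<close>
  have h: "continuous_map E Q (\<lambda>x. g x x)"
  proof (rule pasting_lemma[of "topspace E" E N Q g])
    show "\<exists>e. e \<in> topspace E \<and> x \<in> N e \<and> g x x = g e x" if "x \<in> topspace E" for x
      using N that by blast
  qed (use N g(1) agree in blast)+
  show ?thesis
  proof (rule extends_alongI[OF h])
    fix d assume d: "d \<in> topspace D"
    then have "j d \<in> topspace E"
      using dense_map_imp_continuous[OF j] by (auto simp: continuous_map_def)
    then show "g (j d) (j d) = f d"
      using g(2)[of "j d" d] N d by auto
  qed
qed

lemma continuous_map_real_nbhd:
  fixes k :: "'e \<Rightarrow> real"
  assumes "continuous_map E euclideanreal k"
  shows "openin E {x \<in> topspace E. \<bar>k x - c\<bar> < \<delta>}" "openin E {x \<in> topspace E. k x < \<delta>}"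
    "openin E {x \<in> topspace E. \<delta> < k x}"
proof -
  have "openin E {x \<in> topspace E. k x \<in> ball c \<delta>}" "openin E {x \<in> topspace E. k x \<in> {..<\<delta>}}"
    "openin E {x \<in> topspace E. k x \<in> {\<delta><..}}"
    by (rule openin_continuous_map_preimage[OF assms]; simp)+
  then show "openin E {x \<in> topspace E. \<bar>k x - c\<bar> < \<delta>}" "openin E {x \<in> topspace E. k x < \<delta>}"
    "openin E {x \<in> topspace E. \<delta> < k x}"
    by (simp_all add: dist_real_def abs_minus_commute)
qed

text \<open>A point of \<open>Q\<close> is determined by its values under functions to the unit
  interval. The extended values at \<open>e\<close> all come from one point of \<open>K\<close>:
  otherwise finitely many functions separate them from all of \<open>K\<close>, which fails for a
  \<open>d\<close> with \<open>j d\<close> close to \<open>e\<close>, since \<open>f d\<close> lies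
  in \<open>K\<close>. The compact sets prevent \<open>f d\<close> from leaving \<open>Q\<close> as
  \<open>j d\<close> approaches \<open>e\<close>.\<close>

lemma extends_along_completely_regular:
  assumes j: "dense_map D E j" and f: "continuous_map D Q f"
    and cr: "completely_regular_space Q" and Q: "Hausdorff_space Q"
    and ext: "\<And>k. continuous_map Q (top_of_set {0..1::real}) k \<Longrightarrow>
                extends_along D E j euclideanreal (\<lambda>d. k (f d))"
    and cpt: "\<And>e. e \<in> topspace E \<Longrightarrow> \<exists>N K. openin E N \<and> e \<in> N \<and> compactin Q K \<and>
                (\<forall>d\<in>topspace D. j d \<in> N \<longrightarrow> f d \<in> K)"
  shows "extends_along D E j Q f"
proof -
  define \<K> where "\<K> = {k. continuous_map Q (top_of_set {0..1::real}) k}"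
  have kc: "continuous_map Q euclideanreal k" if "k \<in> \<K>" for k
    using that by (auto simp: \<K>_def continuous_map_in_subtopology)
  obtain X where X: "\<And>k. k \<in> \<K> \<Longrightarrow> continuous_map E euclideanreal (X k)"
    "\<And>k d. k \<in> \<K> \<Longrightarrow> d \<in> topspace D \<Longrightarrow> X k (j d) = k (f d)"
    using ext unfolding extends_along_def \<K>_def mem_Collect_eq by metis
  have ex: "\<exists>t\<in>topspace Q. \<forall>k\<in>\<K>. k t = X k e" if e: "e \<in> topspace E" for e
  proof -
    obtain N K where NK: "openin E N" "e \<in> N" "compactin Q K"
      "\<And>d. d\<in>topspace D \<Longrightarrow> j d \<in> N \<Longrightarrow> f d \<in> K"
      using cpt[OF e] by auto
    have "\<exists>t\<in>K. \<forall>k\<in>\<K>. k t = X k e"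
    proof (rule ccontr)
      assume "\<not> ?thesis"
      then obtain k where k: "\<And>t. t \<in> K \<Longrightarrow> k t \<in> \<K> \<and> k t t \<noteq> X (k t) e"
        by metis
      \<comment> \<open>Half of the gap: no number is within \<open>\<delta> t\<close> of both
        \<open>k t t\<close> and \<open>X (k t) e\<close>.\<close>
      define \<delta> where "\<delta> t = \<bar>k t t - X (k t) e\<bar> / 2" for t
      have \<delta>: "\<delta> t > 0" if "t \<in> K" for t using k[OF that] by (auto simp: \<delta>_def)
      define W where "W t = {x \<in> topspace Q. \<bar>k t x - k t t\<bar> < \<delta> t}" for t
      define M where "M t = {x \<in> topspace E. \<bar>X (k t) x - X (k t) e\<bar> < \<delta> t}" for t
      have W: "openin Q (W t)" "t \<in> W t" "openin E (M t)" "e \<in> M t" if "t \<in> K" for t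
        unfolding W_def M_def
        using that k[OF that] kc X(1) \<delta>[OF that] compactin_subset_topspace[OF NK(3)] e
        by (auto intro: continuous_map_real_nbhd(1))
      obtain F where F: "finite F" "F \<subseteq> K" "K \<subseteq> \<Union>(W ` F)"
      proof -
        have "\<exists>\<F>. finite \<F> \<and> \<F> \<subseteq> W ` K \<and> K \<subseteq> \<Union>\<F>"
        proof (rule compactinD[OF NK(3)])
          show "K \<subseteq> \<Union>(W ` K)" using W(2) by blast
        qed (use W(1) in blast)
        then obtain \<F> where \<F>: "finite \<F>" "\<F> \<subseteq> W ` K" "K \<subseteq> \<Union>\<F>" by blast
        then show ?thesis using that finite_subset_image[OF \<F>(1,2)] by metis
      qed
      \<comment> \<open>Inserting \<open>topspace E\<close> keeps the intersected family nonempty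
        when \<open>F\<close> is empty.\<close>
      have "openin E (N \<inter> \<Inter>(insert (topspace E) (M ` F)))"
        using F W NK by (intro openin_Int openin_Inter) auto
      moreover have "e \<in> N \<inter> \<Inter>(insert (topspace E) (M ` F))"
        using e NK F W by auto
      ultimately have "\<exists>d\<in>topspace D. j d \<in> N \<inter> \<Inter>(insert (topspace E) (M ` F))"
        by (rule dense_map_meets[OF j])
      then obtain d where d: "d \<in> topspace D" "j d \<in> N" "\<And>t. t \<in> F \<Longrightarrow> j d \<in> M t"
        by auto
      then obtain t where t: "t \<in> F" "f d \<in> W t"
        using NK(4)[OF d(1,2)] F(3) by auto
      then have "\<bar>k t (f d) - k t t\<bar> < \<delta> t" "\<bar>k t (f d) - X (k t) e\<bar> < \<delta> t"
        using d(3)[OF t(1)] X(2)[of "k t" d] d(1) k F(2) by (auto simp: W_def M_def)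
      moreover have "\<bar>k t t - X (k t) e\<bar> \<le> \<bar>k t (f d) - k t t\<bar> + \<bar>k t (f d) - X (k t) e\<bar>"
        by linarith
      moreover have "\<delta> t + \<delta> t = \<bar>k t t - X (k t) e\<bar>"
        by (simp add: \<delta>_def)
      ultimately show False by linarith
    qed
    then show ?thesis using compactin_subset_topspace[OF NK(3)] by blast
  qed
  then obtain g where g: "\<And>e. e \<in> topspace E \<Longrightarrow> g e \<in> topspace Q"
    "\<And>e k. e \<in> topspace E \<Longrightarrow> k \<in> \<K> \<Longrightarrow> k (g e) = X k e"
    by metis
  show ?thesis
  proof (rule extends_alongI)
    show "continuous_map E Q g"
      unfolding continuous_map_def
    proof (intro conjI allI impI)
      fix W assume W: "openin Q W"
      show "openin E {x \<in> topspace E. g x \<in> W}"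
      proof (subst openin_subopen, intro ballI)
        fix e assume "e \<in> {x \<in> topspace E. g x \<in> W}"
        then have e: "e \<in> topspace E" "g e \<in> W" by auto
        obtain k where k: "continuous_map Q (top_of_set {0..1::real}) k" "k (g e) = 0"
          "k ` (topspace Q - W) \<subseteq> {1}"
          using cr W e g(1)[OF e(1)] unfolding completely_regular_space_def
          by (metis DiffD2 DiffI closedin_diff closedin_topspace)
        have kK: "k \<in> \<K>" using k by (simp add: \<K>_def)
        \<comment> \<open>Since \<open>k\<close> is 1 off \<open>W\<close> and
          \<open>k (g x) = X k x\<close>, the continuous function \<open>X k\<close> detects
          membership of \<open>g x\<close> in \<open>W\<close>.\<close>
        have "{x \<in> topspace E. X k x < 1} \<subseteq> {x \<in> topspace E. g x \<in> W}"
          using g k(3) kK by force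
        moreover have "e \<in> {x \<in> topspace E. X k x < 1}"
          using e g(2)[OF e(1) kK] k(2) by simp
        ultimately show "\<exists>T. openin E T \<and> e \<in> T \<and> T \<subseteq> {x \<in> topspace E. g x \<in> W}"
          using continuous_map_real_nbhd(2)[OF X(1)[OF kK]] by blast
      qed
    qed (use g in auto)
    fix d assume d: "d \<in> topspace D"
    then have jd: "j d \<in> topspace E" and fd: "f d \<in> topspace Q"
      using dense_map_imp_continuous[OF j] f by (auto simp: continuous_map_def)
    show "g (j d) = f d"
    proof (rule ccontr)
      assume ne: "g (j d) \<noteq> f d"
      have "closedin Q {f d}"
        using Q fd by (simp add: closedin_Hausdorff_sing_eq)
      then obtain k where k: "continuous_map Q (top_of_set {0..1::real}) k" "k (g (j d)) = 0"
          "k ` {f d} \<subseteq> {1}"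
        using cr g(1)[OF jd] ne unfolding completely_regular_space_def
        by (metis Diff_iff singletonD)
      then have "k \<in> \<K>" by (simp add: \<K>_def)
      then show False using g(2)[OF jd, of k] X(2)[of k d] d k by auto
    qed
  qed
qed

section \<open>Fibre products over a base and density in them\<close>

text \<open>The set \<open>S\<close> allows the second factor to be a single piece of a partition.
  The comprehension is written exactly like \<open>adom\<close>, so that domains of actions are
  instances of it by mere unfolding.\<close>

definition fprod :: "'a topology \<Rightarrow> ('a \<Rightarrow> 'b) \<Rightarrow> 'd topology \<Rightarrow> 'd set \<Rightarrow> ('d \<Rightarrow> 'b) \<Rightarrow> ('a \<times> 'd) topology" where
  "fprod A s D S r = subtopology (prod_topology A D) {(a, d). a \<in> topspace A \<and> d \<in> S \<and> s a = r d}"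

lemma topspace_fprod:
  "topspace (fprod A s D S r) = {(a, d). a \<in> topspace A \<and> d \<in> topspace D \<inter> S \<and> s a = r d}"
  by (auto simp: fprod_def)

lemma continuous_map_fprod_fst: "continuous_map (fprod A s D S r) A fst"
  and continuous_map_fprod_snd: "continuous_map (fprod A s D S r) (subtopology D S) snd"
  unfolding fprod_def
  by (auto simp: continuous_map_in_subtopology
      intro: continuous_map_from_subtopology continuous_map_fst continuous_map_snd)

lemma continuous_map_into_fprod:
  assumes "continuous_map Z A a" "continuous_map Z D d"
    "\<And>z. z \<in> topspace Z \<Longrightarrow> d z \<in> S \<and> s (a z) = r (d z)"
  shows "continuous_map Z (fprod A s D S r) (\<lambda>z. (a z, d z))"
proof -
  have "continuous_map Z (prod_topology A D) (\<lambda>z. (a z, d z))"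
    using assms by (simp add: continuous_map_paired)
  moreover have "a z \<in> topspace A" if "z \<in> topspace Z" for z
    using that assms(1) by (auto simp: continuous_map_def)
  ultimately show ?thesis
    unfolding fprod_def continuous_map_in_subtopology using assms(3) by auto
qed

lemma openin_fprod_basis:
  assumes "openin (fprod A s D S r) W" "(a, d) \<in> W"
  obtains U V where "openin A U" "openin D V" "a \<in> U" "d \<in> V"
    "\<And>a' d'. a' \<in> U \<Longrightarrow> d' \<in> V \<Longrightarrow> d' \<in> S \<Longrightarrow> s a' = r d' \<Longrightarrow> (a', d') \<in> W"
proof -
  obtain W' where W': "openin (prod_topology A D) W'" 
      "W = W' \<inter> {(a, d). a \<in> topspace A \<and> d \<in> S \<and> s a = r d}"
    using assms(1) unfolding fprod_def openin_subtopology by blast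
  have "(a, d) \<in> W'" using assms(2) W'(2) by simp
  then obtain U V where UV: "openin A U" "openin D V" "a \<in> U" "d \<in> V" "U \<times> V \<subseteq> W'"
    using W'(1) unfolding openin_prod_topology_alt by meson
  have "(a', d') \<in> W" if "a' \<in> U" "d' \<in> V" "d' \<in> S" "s a' = r d'" for a' d'
  proof -
    have "a' \<in> topspace A" "(a', d') \<in> W'"
      using that UV(5) openin_subset[OF UV(1)] by auto
    then show ?thesis using that W'(2) by simp
  qed
  then show ?thesis using that[of U V] UV by simp
qed

text \<open>Openness of \<open>s\<close> does the work. For a basic neighbourhood of
  \<open>(a, e)\<close> with factors \<open>U\<close> and \<open>V\<close>, the points of
  \<open>V\<close> whose anchor lies in the image of \<open>U\<close> form an open neighbourhood of
  \<open>e\<close>. It contains some \<open>j d\<close>, and the anchor of \<open>d\<close> is then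
  lifted to a point of \<open>U\<close>.\<close>

lemma dense_map_fprod:
  assumes j: "dense_map D E j" and s: "open_map A B s" and S': "openin E S'"
    and S: "S = {d \<in> topspace D. j d \<in> S'}"
    and \<rho>: "continuous_map (subtopology E S') B \<rho>" and r: "\<And>d. d \<in> S \<Longrightarrow> r d = \<rho> (j d)"
  shows "dense_map (fprod A s D S r) (fprod A s E S' \<rho>) (\<lambda>(a, d). (a, j d))"
  unfolding dense_map_def
proof (intro conjI allI impI)
  have "continuous_map (fprod A s D S r) E (\<lambda>z. j (snd z))"
    using continuous_map_compose[OF continuous_map_fprod_snd
        continuous_map_from_subtopology[OF dense_map_imp_continuous[OF j]]]
    by (simp add: o_def)
  then show "continuous_map (fprod A s D S r) (fprod A s E S' \<rho>) (\<lambda>(a, d). (a, j d))"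
    unfolding split_beta'
    by (intro continuous_map_into_fprod continuous_map_fprod_fst) (auto simp: topspace_fprod S r)
next
  fix W assume W: "openin (fprod A s E S' \<rho>) W" and "W \<noteq> {}"
  then obtain a e where ae: "(a, e) \<in> W" by auto
  then have ae': "a \<in> topspace A" "e \<in> S'" "s a = \<rho> e"
    using openin_subset[OF W] by (auto simp: topspace_fprod)
  obtain U V where UV: "openin A U" "openin E V" "a \<in> U" "e \<in> V"
    "\<And>a' d'. a' \<in> U \<Longrightarrow> d' \<in> V \<Longrightarrow> d' \<in> S' \<Longrightarrow> s a' = \<rho> d' \<Longrightarrow> (a', d') \<in> W"
    using openin_fprod_basis[OF W ae] by metis
  have "openin (subtopology E S') {x \<in> topspace (subtopology E S'). \<rho> x \<in> s ` U}"
    using s UV(1) by (intro openin_continuous_map_preimage[OF \<rho>]) (simp add: open_map_def)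
  then have "openin E {x \<in> topspace (subtopology E S'). \<rho> x \<in> s ` U}"
    using S' by (simp add: openin_open_subtopology)
  then have "openin E (V \<inter> {x \<in> topspace (subtopology E S'). \<rho> x \<in> s ` U})"
    using UV by blast
  moreover have "e \<in> V \<inter> {x \<in> topspace (subtopology E S'). \<rho> x \<in> s ` U}"
    using UV(3,4) ae'(2) openin_subset[OF S'] by (auto simp flip: ae'(3))
  ultimately obtain d where d: "d \<in> topspace D" "j d \<in> V" "j d \<in> S'" "\<rho> (j d) \<in> s ` U"
    using dense_map_meets[OF j] by fastforce
  then obtain a' where a': "a' \<in> U" "s a' = \<rho> (j d)" by auto
  then have "(a', d) \<in> topspace (fprod A s D S r)"
    using d openin_subset[OF UV(1)] by (auto simp: topspace_fprod S r)
  moreover have "(a', j d) \<in> W" using UV(5) a' d by auto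
  ultimately show "\<exists>d\<in>topspace (fprod A s D S r). (case d of (a, d) \<Rightarrow> (a, j d)) \<in> W"
    by force
qed

section \<open>The algebra of bounded functions vanishing at infinity over the base\<close>

lemma continuous_map_mult:
  fixes f g :: "'x \<Rightarrow> 'c::real_normed_algebra"
  shows "continuous_map X euclidean f \<Longrightarrow> continuous_map X euclidean g \<Longrightarrow>
    continuous_map X euclidean (\<lambda>x. f x * g x)"
  by (simp add: continuous_map_atin tendsto_mult)

lemma continuous_map_divide:
  fixes f g :: "'x \<Rightarrow> 'c::real_normed_field"
  shows "continuous_map X euclidean f \<Longrightarrow> continuous_map X euclidean g \<Longrightarrow>
    (\<And>x. x \<in> topspace X \<Longrightarrow> g x \<noteq> 0) \<Longrightarrow> continuous_map X euclidean (\<lambda>x. f x / g x)"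
  by (simp add: continuous_map_atin tendsto_divide)

lemma continuous_map_cnj:
  "continuous_map X euclidean f \<Longrightarrow> continuous_map X euclidean (\<lambda>x. cnj (f x))"
  by (simp add: continuous_map_atin tendsto_cnj)

lemma continuous_map_Re:
  "continuous_map X euclidean f \<Longrightarrow> continuous_map X euclideanreal (\<lambda>x. Re (f x))"
  by (simp add: continuous_map_atin tendsto_Re)

lemma continuous_map_complex_of_real:
  "continuous_map X euclideanreal f \<Longrightarrow> continuous_map X euclidean (\<lambda>x. complex_of_real (f x))"
  by (simp add: continuous_map_atin tendsto_of_real)

lemma continuous_map_locally:
  assumes "\<And>x. x \<in> topspace X \<Longrightarrow> \<exists>N. openin X N \<and> x \<in> N \<and> continuous_map (subtopology X N) Y f"
  shows "continuous_map X Y f"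
proof -
  obtain N where N: "\<And>x. x \<in> topspace X \<Longrightarrow>
      openin X (N x) \<and> x \<in> N x \<and> continuous_map (subtopology X (N x)) Y f"
    using assms by metis
  show ?thesis
  proof (rule pasting_lemma[where I = "topspace X" and T = N and f = "\<lambda>_. f"])
    show "\<exists>j. j \<in> topspace X \<and> x \<in> N j \<and> f x = f x" if "x \<in> topspace X" for x
      using N that by blast
  qed (use N in blast)+
qed

lemma Cb_bound:
  assumes "f \<in> Cb T" obtains M where "M > 0" "\<And>y. norm (f y) \<le> M"
proof -
  obtain M where M: "\<And>y. y \<in> topspace T \<Longrightarrow> norm (f y) \<le> M" "\<And>y. y \<notin> topspace T \<Longrightarrow> f y = 0"
    using assms unfolding Cb_def by blast
  have "norm (f y) \<le> max M 1" for y
    using M[of y] by (cases "y \<in> topspace T") auto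
  then show ?thesis using that[of "max M 1"] by simp
qed

lemma Cb_outside: "f \<in> Cb T \<Longrightarrow> y \<notin> topspace T \<Longrightarrow> f y = 0"
  by (simp add: Cb_def)

lemma Cb_continuous: "f \<in> Cb T \<Longrightarrow> continuous_map T euclidean f"
  by (simp add: Cb_def)

lemma CbI:
  assumes "continuous_map T euclidean f" "\<And>y. y \<in> topspace T \<Longrightarrow> norm (f y) \<le> M"
    "\<And>y. y \<notin> topspace T \<Longrightarrow> f y = 0"
  shows "f \<in> Cb T"
  using assms unfolding Cb_def by blast

lemma Cb_restrict:
  assumes "continuous_map T euclidean f" "\<And>y. y \<in> topspace T \<Longrightarrow> norm (f y) \<le> M"
  shows "(\<lambda>y. if y \<in> topspace T then f y else 0) \<in> Cb T"
  by (rule CbI[where M = M]) (use assms in \<open>auto intro: continuous_map_eq[of T euclidean f]\<close>)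

lemma Cb_add:
  assumes "f \<in> Cb T" "g \<in> Cb T" shows "(\<lambda>y. f y + g y) \<in> Cb T"
proof -
  obtain M N where "\<And>y. norm (f y) \<le> M" "\<And>y. norm (g y) \<le> N"
    using Cb_bound[OF assms(1)] Cb_bound[OF assms(2)] by metis
  then show ?thesis
    using assms by (intro CbI[where M = "M + N"])
      (auto intro: continuous_map_add Cb_continuous norm_triangle_mono simp: Cb_outside)
qed

lemma Cb_mult:
  assumes "f \<in> Cb T" "g \<in> Cb T" shows "(\<lambda>y. f y * g y) \<in> Cb T"
proof -
  obtain M N where MN: "\<And>y. norm (f y) \<le> M" "\<And>y. norm (g y) \<le> N" "M > 0"
    using Cb_bound[OF assms(1)] Cb_bound[OF assms(2)] by metis
  have "norm (f y * g y) \<le> M * N" for y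
    unfolding norm_mult by (rule mult_mono) (use MN in auto)
  then show ?thesis
    using assms by (intro CbI[where M = "M * N"])
      (auto intro: continuous_map_mult Cb_continuous simp: Cb_outside)
qed

lemma Cb_cnj: "f \<in> Cb T \<Longrightarrow> (\<lambda>y. cnj (f y)) \<in> Cb T"
  unfolding Cb_def by (auto intro: continuous_map_cnj)

text \<open>Members of \<open>Cb T\<close> vanish off the carrier, so constants have to be cut off
  there. With \<open>c = 1\<close> this is the unit of the algebra.\<close>

lemma Cb_const: "(\<lambda>y. if y \<in> topspace T then c else 0) \<in> Cb T"
  by (rule Cb_restrict[where M = "norm c"]) auto

lemma HX_subset_Cb: "f \<in> HX T B r \<Longrightarrow> f \<in> Cb T"
  by (simp add: HX_def)

text \<open>The ideal property that lets characters of \<open>H\<close> act on all bounded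
  functions. An approximation of \<open>u\<close> up to \<open>\<epsilon> / M\<close> is multiplied
  by \<open>F\<close>, which is absorbed into the bounded factors.\<close>

lemma HX_Cb_mult:
  assumes F: "F \<in> Cb T" and u: "u \<in> HX T B r"
  shows "(\<lambda>y. F y * u y) \<in> HX T B r"
  unfolding HX_def
proof (intro CollectI conjI allI impI)
  show "(\<lambda>y. F y * u y) \<in> Cb T"
    using Cb_mult[OF F HX_subset_Cb[OF u]] .
  obtain M where M: "M > 0" "\<And>y. norm (F y) \<le> M" using Cb_bound[OF F] by metis
  fix \<epsilon> :: real assume "\<epsilon> > 0"
  then have "\<epsilon> / M > 0" using M by simp
  then obtain n :: nat and fs hs where h: "\<And>i. i < n \<Longrightarrow> fs i \<in> Cb T \<and> hs i \<in> C0 B"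
    "\<And>y. y \<in> topspace T \<Longrightarrow> norm (u y - (\<Sum>i<n. fs i y * hs i (r y))) \<le> \<epsilon> / M"
    using u unfolding HX_def by blast
  show "\<exists>(n::nat) fs hs. (\<forall>i<n. fs i \<in> Cb T \<and> hs i \<in> C0 B) \<and>
       (\<forall>y\<in>topspace T. norm (F y * u y - (\<Sum>i<n. fs i y * hs i (r y))) \<le> \<epsilon>)"
  proof (intro exI conjI allI impI ballI)
    show "(\<lambda>y. F y * fs i y) \<in> Cb T" "hs i \<in> C0 B" if "i < n" for i
      using h(1)[OF that] F by (auto intro: Cb_mult)
    fix y assume y: "y \<in> topspace T"
    have "F y * u y - (\<Sum>i<n. F y * fs i y * hs i (r y)) = F y * (u y - (\<Sum>i<n. fs i y * hs i (r y)))"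
      by (simp add: right_diff_distrib sum_distrib_left mult.assoc)
    then have "norm (F y * u y - (\<Sum>i<n. F y * fs i y * hs i (r y))) \<le> M * (\<epsilon> / M)"
      using mult_mono[OF M(2)[of y] h(2)[OF y]] M(1) by (simp add: norm_mult)
    then show "norm (F y * u y - (\<Sum>i<n. F y * fs i y * hs i (r y))) \<le> \<epsilon>"
      using M(1) by simp
  qed
qed

lemma HX_scale:
  assumes "u \<in> HX T B r" shows "(\<lambda>y. c * u y) \<in> HX T B r"
proof -
  have "(\<lambda>y. c * u y) = (\<lambda>y. (if y \<in> topspace T then c else 0) * u y)"
    using Cb_outside[OF HX_subset_Cb[OF assms]] by auto
  then show ?thesis using HX_Cb_mult[OF Cb_const assms] by metis
qed

lemma sum_lessThan_add:
  fixes g :: "nat \<Rightarrow> 'c::comm_monoid_add"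
  shows "(\<Sum>i<m + n. g i) = (\<Sum>i<m. g i) + (\<Sum>i<n. g (m + i))"
  by (induction n) (auto simp: add.assoc)

lemma HX_add:
  assumes u: "u \<in> HX T B r" and v: "v \<in> HX T B r"
  shows "(\<lambda>y. u y + v y) \<in> HX T B r"
  unfolding HX_def
proof (intro CollectI conjI allI impI)
  show "(\<lambda>y. u y + v y) \<in> Cb T"
    using u v by (intro Cb_add HX_subset_Cb)
  fix \<epsilon> :: real assume "\<epsilon> > 0"
  then have \<epsilon>: "\<epsilon> / 2 > 0" by simp
  obtain m :: nat and fs hs where m: "\<And>i. i < m \<Longrightarrow> fs i \<in> Cb T \<and> hs i \<in> C0 B"
    "\<And>y. y \<in> topspace T \<Longrightarrow> norm (u y - (\<Sum>i<m. fs i y * hs i (r y))) \<le> \<epsilon> / 2"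
    using u \<epsilon> unfolding HX_def by blast
  obtain n :: nat and fs' hs' where n: "\<And>i. i < n \<Longrightarrow> fs' i \<in> Cb T \<and> hs' i \<in> C0 B"
    "\<And>y. y \<in> topspace T \<Longrightarrow> norm (v y - (\<Sum>i<n. fs' i y * hs' i (r y))) \<le> \<epsilon> / 2"
    using v \<epsilon> unfolding HX_def by blast
  \<comment> \<open>The two approximating sums are concatenated; the second list is shifted by
    \<open>m\<close>.\<close>
  define f where "f i = (if i < m then fs i else fs' (i - m))" for i
  define h where "h i = (if i < m then hs i else hs' (i - m))" for i
  show "\<exists>(n::nat) fs hs. (\<forall>i<n. fs i \<in> Cb T \<and> hs i \<in> C0 B) \<and>
       (\<forall>y\<in>topspace T. norm (u y + v y - (\<Sum>i<n. fs i y * hs i (r y))) \<le> \<epsilon>)"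
  proof (intro exI conjI allI impI ballI)
    show "f i \<in> Cb T" "h i \<in> C0 B" if "i < m + n" for i
      using that m(1)[of i] n(1)[of "i - m"] by (auto simp: f_def h_def)
    fix y assume y: "y \<in> topspace T"
    have eq: "u y + v y - (\<Sum>i<m + n. f i y * h i (r y)) =
       (u y - (\<Sum>i<m. fs i y * hs i (r y))) + (v y - (\<Sum>i<n. fs' i y * hs' i (r y)))"
      unfolding sum_lessThan_add by (simp add: f_def h_def)
    show "norm (u y + v y - (\<Sum>i<m + n. f i y * h i (r y))) \<le> \<epsilon>"
      unfolding eq using norm_triangle_mono[OF m(2)[OF y] n(2)[OF y]] by simp
  qed
qed

lemma HX_mult: "u \<in> HX T B r \<Longrightarrow> v \<in> HX T B r \<Longrightarrow> (\<lambda>y. u y * v y) \<in> HX T B r"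
  by (intro HX_Cb_mult HX_subset_Cb)

lemma C0_bound:
  assumes "h \<in> C0 B" obtains M where "M > 0" "\<And>b. b \<in> topspace B \<Longrightarrow> norm (h b) \<le> M"
proof -
  have c: "compactin B {b \<in> topspace B. norm (h b) \<ge> 1}" and h: "continuous_map B euclidean h"
    using assms by (auto simp: C0_def)
  have "compact (h ` {b \<in> topspace B. norm (h b) \<ge> 1})"
    using image_compactin[OF c h] by simp
  then obtain M where "\<forall>x\<in>h ` {b \<in> topspace B. norm (h b) \<ge> 1}. norm x \<le> M"
    using compact_imp_bounded bounded_iff by metis
  then have "\<And>b. b \<in> topspace B \<Longrightarrow> norm (h b) \<ge> 1 \<Longrightarrow> norm (h b) \<le> M"
    by simp
  then have "norm (h b) \<le> max M 1" if "b \<in> topspace B" for b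
    using that by (cases "norm (h b) \<ge> 1") (auto simp: max.coboundedI1)
  then show ?thesis using that[of "max M 1"] by simp
qed

lemma HX_tensor:
  assumes r: "continuous_map T B r" and F: "F \<in> Cb T" and h: "h \<in> C0 B"
  shows "(\<lambda>y. F y * h (r y)) \<in> HX T B r"
proof -
  obtain M where M: "M > 0" "\<And>b. b \<in> topspace B \<Longrightarrow> norm (h b) \<le> M" using C0_bound[OF h] by metis
  have rB: "r y \<in> topspace B" if "y \<in> topspace T" for y
    using r that by (auto simp: continuous_map_def)
  have "continuous_map T euclidean (\<lambda>y. h (r y))"
    using continuous_map_compose[OF r, of euclidean h] h by (auto simp: C0_def o_def)
  then have g: "(\<lambda>y. if y \<in> topspace T then h (r y) else 0) \<in> Cb T"
    by (rule Cb_restrict[where M = M]) (use M rB in auto)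
  have eq: "(\<lambda>y. F y * h (r y)) = (\<lambda>y. F y * (if y \<in> topspace T then h (r y) else 0))"
    using Cb_outside[OF F] by auto
  have "(\<lambda>y. F y * h (r y)) \<in> Cb T"
    unfolding eq by (rule Cb_mult[OF F g])
  moreover have "\<exists>(n::nat) fs hs. (\<forall>i<n. fs i \<in> Cb T \<and> hs i \<in> C0 B) \<and>
       (\<forall>y\<in>topspace T. norm (F y * h (r y) - (\<Sum>i<n. fs i y * hs i (r y))) \<le> \<epsilon>)"
    if "\<epsilon> > 0" for \<epsilon> :: real
  proof (intro exI conjI allI impI ballI)
    show "(\<lambda>_. F) i \<in> Cb T" "(\<lambda>_. h) i \<in> C0 B" for i :: nat using F h by auto
    show "norm (F y * h (r y) - (\<Sum>i<(1::nat). (\<lambda>_. F) i y * (\<lambda>_. h) i (r y))) \<le> \<epsilon>" for y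
      using that by simp
  qed
  ultimately show ?thesis unfolding HX_def by blast
qed

text \<open>Needed for nonvanishing: pulled back along the anchor, such a function shows that
  evaluations, and later limits of evaluations with a known anchor, are not zero.\<close>

lemma C0_bump:
  assumes B: "locally_compact_space B" "Hausdorff_space B" and t: "t \<in> topspace B"
  obtains h where "h \<in> C0 B" "h t = 1"
proof -
  obtain U K where UK: "openin B U" "compactin B K" "t \<in> U" "U \<subseteq> K"
    using B t unfolding locally_compact_space_def by metis
  have "completely_regular_space B"
    using B locally_compact_regular_imp_completely_regular_space by blast
  then obtain k where k: "continuous_map B (top_of_set {0..1::real}) k" "k t = 0"
      "k ` (topspace B - U) \<subseteq> {1}"
    using UK t unfolding completely_regular_space_def
    by (metis DiffD2 DiffI closedin_diff closedin_topspace)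
  define h where "h b = complex_of_real (1 - k b)" for b
  have hc: "continuous_map B euclidean h"
    unfolding h_def using k(1)
    by (intro continuous_map_complex_of_real continuous_map_diff)
      (auto simp: continuous_map_in_subtopology)
  have "compactin B {b \<in> topspace B. norm (h b) \<ge> \<epsilon>}" if "\<epsilon> > 0" for \<epsilon>
  proof (rule closed_compactin[OF UK(2)])
    show "{b \<in> topspace B. \<epsilon> \<le> norm (h b)} \<subseteq> K"
    proof clarify
      fix b assume b: "b \<in> topspace B" "\<epsilon> \<le> norm (h b)"
      then have "k b \<noteq> 1" using that by (auto simp: h_def)
      then show "b \<in> K" using k(3) b(1) UK(4) by blast
    qed
    have "closedin B {b \<in> topspace B. norm (h b) \<in> {\<epsilon>..}}"
      by (rule closedin_continuous_map_preimage[OF continuous_map_norm[OF hc]]) simp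
    then show "closedin B {b \<in> topspace B. \<epsilon> \<le> norm (h b)}" by simp
  qed
  then have "h \<in> C0 B" using hc by (auto simp: C0_def)
  then show ?thesis using that[of h] k(2) by (simp add: h_def)
qed

section \<open>The relative Stone--Cech compactification\<close>

locale relative_beta =
  fixes T :: "'y topology" and B :: "'b topology" and r :: "'y \<Rightarrow> 'b"
  assumes r: "continuous_map T B r"
    and lcB: "locally_compact_space B" and hB: "Hausdorff_space B"
begin

abbreviation "H \<equiv> HX T B r"
abbreviation "\<beta> \<equiv> beta_top T B r"
abbreviation "\<iota> \<equiv> beta_i T B r"
abbreviation "\<X> \<equiv> chars T B r"

lemma topspace_beta: "topspace \<beta> = \<X>"
proof -
  have "\<X> \<subseteq> (\<Pi>\<^sub>E i\<in>H. UNIV)" by (auto simp: chars_def PiE_def)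
  then show ?thesis by (auto simp: beta_top_def)
qed

lemma Hausdorff_beta: "Hausdorff_space \<beta>"
  unfolding beta_top_def by (intro Hausdorff_space_subtopology) (simp add: Hausdorff_space_product_topology)

lemma completely_regular_beta: "completely_regular_space \<beta>"
  unfolding beta_top_def
  by (intro completely_regular_space_subtopology)
    (simp add: completely_regular_space_product_topology metrizable_imp_completely_regular_space
      metrizable_space_euclidean)

lemma continuous_map_coordinate: "u \<in> H \<Longrightarrow> continuous_map \<beta> euclidean (\<lambda>\<phi>. \<phi> u)"
  unfolding beta_top_def
  by (rule continuous_map_from_subtopology[OF continuous_map_product_projection])

lemma continuous_map_into_beta:
  assumes "\<And>z. z \<in> topspace Z \<Longrightarrow> \<Psi> z \<in> \<X>" "\<And>u. u \<in> H \<Longrightarrow> continuous_map Z euclidean (\<lambda>z. \<Psi> z u)"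
  shows "continuous_map Z \<beta> \<Psi>"
  unfolding beta_top_def continuous_map_in_subtopology continuous_map_componentwise
  using assms by (auto simp: chars_def)

lemma char_add: "\<phi> \<in> \<X> \<Longrightarrow> u \<in> H \<Longrightarrow> v \<in> H \<Longrightarrow> \<phi> (\<lambda>y. u y + v y) = \<phi> u + \<phi> v"
  and char_mult: "\<phi> \<in> \<X> \<Longrightarrow> u \<in> H \<Longrightarrow> v \<in> H \<Longrightarrow> \<phi> (\<lambda>y. u y * v y) = \<phi> u * \<phi> v"
  and char_scale: "\<phi> \<in> \<X> \<Longrightarrow> u \<in> H \<Longrightarrow> \<phi> (\<lambda>y. c * u y) = c * \<phi> u"
  by (auto simp: chars_def)

lemma char_nonzero: "\<phi> \<in> \<X> \<Longrightarrow> \<exists>u\<in>H. \<phi> u \<noteq> 0"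
  by (auto simp: chars_def)

text \<open>The extension of a character to the unital algebra of bounded functions, in which
  \<open>H\<close> is an ideal.\<close>
definition cext :: "(('y \<Rightarrow> complex) \<Rightarrow> complex) \<Rightarrow> ('y \<Rightarrow> complex) \<Rightarrow> complex" where
  "cext \<phi> F = (let u = SOME u. u \<in> H \<and> \<phi> u \<noteq> 0 in \<phi> (\<lambda>y. F y * u y) / \<phi> u)"

text \<open>Independence of the chosen \<open>u\<close>: applying \<phi> to the product
  \<open>F * v * u\<close> in two groupings gives
  \<open>\<phi> (F v) * \<phi> u = \<phi> (F u) * \<phi> v\<close>.\<close>

lemma cext_eq:
  assumes \<phi>: "\<phi> \<in> \<X>" and F: "F \<in> Cb T" and u: "u \<in> H" "\<phi> u \<noteq> 0"
  shows "cext \<phi> F = \<phi> (\<lambda>y. F y * u y) / \<phi> u"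
proof -
  define v where "v = (SOME u. u \<in> H \<and> \<phi> u \<noteq> 0)"
  have v: "v \<in> H" "\<phi> v \<noteq> 0"
    using someI_ex[of "\<lambda>u. u \<in> H \<and> \<phi> u \<noteq> 0"] char_nonzero[OF \<phi>] by (auto simp: v_def)
  have "\<phi> (\<lambda>y. F y * v y) * \<phi> u = \<phi> (\<lambda>y. F y * v y * u y)"
    using char_mult[OF \<phi> HX_Cb_mult[OF F v(1)] u(1)] by simp
  also have "(\<lambda>y. F y * v y * u y) = (\<lambda>y. F y * u y * v y)" by (simp add: mult_ac)
  also have "\<phi> (\<lambda>y. F y * u y * v y) = \<phi> (\<lambda>y. F y * u y) * \<phi> v"
    using char_mult[OF \<phi> HX_Cb_mult[OF F u(1)] v(1)] by simp
  finally show ?thesis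
    using u v by (simp add: cext_def flip: v_def) (simp add: field_simps)
qed

lemma cext_HX: "\<phi> \<in> \<X> \<Longrightarrow> f \<in> H \<Longrightarrow> cext \<phi> f = \<phi> f"
proof -
  assume \<phi>: "\<phi> \<in> \<X>" and f: "f \<in> H"
  obtain u where u: "u \<in> H" "\<phi> u \<noteq> 0" using char_nonzero[OF \<phi>] by blast
  then show ?thesis
    using cext_eq[OF \<phi> HX_subset_Cb[OF f] u] char_mult[OF \<phi> f u(1)] by simp
qed

lemma cext_const: "\<phi> \<in> \<X> \<Longrightarrow> cext \<phi> (\<lambda>y. if y \<in> topspace T then c else 0) = c"
proof -
  assume \<phi>: "\<phi> \<in> \<X>"
  then obtain u where u: "u \<in> H" "\<phi> u \<noteq> 0" using char_nonzero by blast
  have "(\<lambda>y. (if y \<in> topspace T then c else 0) * u y) = (\<lambda>y. c * u y)"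
    using Cb_outside[OF HX_subset_Cb[OF u(1)]] by auto
  then show ?thesis using cext_eq[OF \<phi> Cb_const u, of c] char_scale[OF \<phi> u(1)] u by simp
qed

lemma cext_add:
  assumes \<phi>: "\<phi> \<in> \<X>" and F: "F \<in> Cb T" and G: "G \<in> Cb T"
  shows "cext \<phi> (\<lambda>y. F y + G y) = cext \<phi> F + cext \<phi> G"
proof -
  obtain u where u: "u \<in> H" "\<phi> u \<noteq> 0" using \<phi> char_nonzero by blast
  show ?thesis
    using char_add[OF \<phi> HX_Cb_mult[OF F u(1)] HX_Cb_mult[OF G u(1)]]
    by (simp add: cext_eq[OF \<phi> _ u] F G Cb_add distrib_right add_divide_distrib)
qed

lemma cext_mult:
  assumes \<phi>: "\<phi> \<in> \<X>" and F: "F \<in> Cb T" and G: "G \<in> Cb T"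
  shows "cext \<phi> (\<lambda>y. F y * G y) = cext \<phi> F * cext \<phi> G"
proof -
  obtain u where u: "u \<in> H" "\<phi> u \<noteq> 0" using \<phi> char_nonzero by blast
  \<comment> \<open>The square of \<open>u\<close> is used as denominator so that each of
    \<open>F\<close> and \<open>G\<close> can take one factor \<open>u\<close> into
    \<open>H\<close>.\<close>
  have uu: "(\<lambda>y. u y * u y) \<in> H" "\<phi> (\<lambda>y. u y * u y) = \<phi> u * \<phi> u"
    using HX_mult char_mult \<phi> u(1) by auto
  have "cext \<phi> (\<lambda>y. F y * G y) = \<phi> (\<lambda>y. F y * G y * (u y * u y)) / (\<phi> u * \<phi> u)"
    using cext_eq[OF \<phi> Cb_mult[OF F G] uu(1)] uu(2) u(2) by simp
  also have "(\<lambda>y. F y * G y * (u y * u y)) = (\<lambda>y. (F y * u y) * (G y * u y))"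
    by (simp add: mult_ac)
  also have "\<phi> (\<lambda>y. (F y * u y) * (G y * u y)) = \<phi> (\<lambda>y. F y * u y) * \<phi> (\<lambda>y. G y * u y)"
    using char_mult[OF \<phi> HX_Cb_mult[OF F u(1)] HX_Cb_mult[OF G u(1)]] .
  finally show ?thesis by (simp add: cext_eq[OF \<phi> _ u] F G)
qed

text \<open>One \<open>u\<close> with \<open>\<phi> u \<noteq> 0\<close> serves for all characters
  near \<phi>, so locally this is a quotient of two coordinate functions.\<close>

lemma continuous_map_cext:
  assumes F: "F \<in> Cb T" shows "continuous_map \<beta> euclidean (\<lambda>\<phi>. cext \<phi> F)"
proof (rule continuous_map_locally)
  fix \<phi> assume "\<phi> \<in> topspace \<beta>"
  then have \<phi>: "\<phi> \<in> \<X>" by (simp add: topspace_beta)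
  then obtain u where u: "u \<in> H" "\<phi> u \<noteq> 0" using char_nonzero by blast
  define N where "N = {\<psi> \<in> topspace \<beta>. \<psi> u \<in> - {0}}"
  have "openin \<beta> N" unfolding N_def
    by (rule openin_continuous_map_preimage[OF continuous_map_coordinate[OF u(1)]]) auto
  moreover have "\<phi> \<in> N" using \<phi> u by (simp add: N_def topspace_beta)
  moreover have "continuous_map (subtopology \<beta> N) euclidean (\<lambda>\<phi>. cext \<phi> F)"
  proof (rule continuous_map_eq)
    show "continuous_map (subtopology \<beta> N) euclidean (\<lambda>\<phi>. \<phi> (\<lambda>y. F y * u y) / \<phi> u)"
      using HX_Cb_mult[OF F u(1)] u
      by (intro continuous_map_divide continuous_map_from_subtopology[OF continuous_map_coordinate])
        (auto simp: N_def)
    show "\<psi> (\<lambda>y. F y * u y) / \<psi> u = cext \<psi> F" if "\<psi> \<in> topspace (subtopology \<beta> N)" for \<psi>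
      using that cext_eq[OF _ F u(1)] by (simp add: N_def topspace_beta)
  qed
  ultimately show "\<exists>N. openin \<beta> N \<and> \<phi> \<in> N \<and> continuous_map (subtopology \<beta> N) euclidean (\<lambda>\<phi>. cext \<phi> F)"
    by blast
qed

lemma r_topspace: "y \<in> topspace T \<Longrightarrow> r y \<in> topspace B"
  using r by (auto simp: continuous_map_def)

lemma bump_HX:
  assumes "h \<in> C0 B"
  shows "(\<lambda>y. (if y \<in> topspace T then 1 else 0) * h (r y)) \<in> H"
  using HX_tensor[OF r Cb_const assms] .

lemma iota_apply: "u \<in> H \<Longrightarrow> \<iota> y u = u y"
  by (simp add: beta_i_def)

lemma iota_chars:
  assumes y: "y \<in> topspace T" shows "\<iota> y \<in> \<X>"
proof -
  obtain h where h: "h \<in> C0 B" "h (r y) = 1"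
    using C0_bump[OF lcB hB r_topspace[OF y]] by metis
  have "\<exists>f\<in>H. \<iota> y f \<noteq> 0"
    using bump_HX[OF h(1)] h(2) y by (intro bexI[OF _ bump_HX[OF h(1)]]) (simp add: iota_apply)
  moreover have "\<iota> y \<in> extensional H" by (simp add: beta_i_def)
  ultimately show ?thesis
    unfolding chars_def by (auto simp: iota_apply HX_add HX_mult HX_scale)
qed

lemma continuous_map_iota: "continuous_map T \<beta> \<iota>"
proof (rule continuous_map_into_beta)
  show "continuous_map T euclidean (\<lambda>y. \<iota> y u)" if "u \<in> H" for u
    using Cb_continuous[OF HX_subset_Cb[OF that]] by (simp add: iota_apply that)
qed (rule iota_chars)

lemma cext_iota:
  assumes y: "y \<in> topspace T" and F: "F \<in> Cb T" shows "cext (\<iota> y) F = F y"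
proof -
  obtain u where u: "u \<in> H" "\<iota> y u \<noteq> 0" using char_nonzero[OF iota_chars[OF y]] by blast
  then show ?thesis
    using cext_eq[OF iota_chars[OF y] F u] by (simp add: iota_apply HX_Cb_mult F)
qed

lemma cext_sum_zero:
  assumes "\<phi> \<in> \<X>" "finite J" "\<And>i. i \<in> J \<Longrightarrow> G i \<in> Cb T \<and> cext \<phi> (G i) = 0"
  shows "(\<lambda>y. \<Sum>i\<in>J. G i y) \<in> Cb T \<and> cext \<phi> (\<lambda>y. \<Sum>i\<in>J. G i y) = 0"
  using assms(2,3)
proof (induction J rule: finite_induct)
  case empty
  show ?case using Cb_const[of T 0] cext_const[OF assms(1), of 0] by simp
next
  case (insert i J)
  then show ?case using Cb_add[of "G i" T] cext_add[OF assms(1), of "G i"] by simp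
qed

text \<open>A character outside the closure of the evaluations would annihilate a function
  \<open>\<Sum>\<bar>u\<^sub>i - \<phi> u\<^sub>i\<bar>\<^sup>2\<close> that is bounded below and hence invertible.\<close>
lemma dense_iota: "dense_map T \<beta> \<iota>"
  unfolding dense_map_def
proof (intro conjI allI impI)
  fix W assume W: "openin \<beta> W" "W \<noteq> {}"
  then obtain \<phi> where \<phi>W: "\<phi> \<in> W" by blast
  then have \<phi>: "\<phi> \<in> \<X>" using openin_subset[OF W(1)] topspace_beta by auto
  obtain W' where W': "openin (product_topology (\<lambda>_. euclidean) H) W'" "W = W' \<inter> \<X>"
    using W(1) by (auto simp: beta_top_def openin_subtopology)
  obtain V where V: "\<phi> \<in> (\<Pi>\<^sub>E i\<in>H. V i)" "\<And>i. open (V i)" "finite {i. V i \<noteq> UNIV}"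
    "(\<Pi>\<^sub>E i\<in>H. V i) \<subseteq> W'"
    using product_topology_open_contains_basis[OF W'(1), of \<phi>] \<phi>W W'(2) by auto
  define J where "J = {i \<in> H. V i \<noteq> UNIV}"
  have J: "finite J" "J \<subseteq> H" using V(3) by (auto simp: J_def)
  show "\<exists>y\<in>topspace T. \<iota> y \<in> W"
  proof (rule ccontr)
    assume no: "\<not> ?thesis"
    have "\<exists>e>0. ball (\<phi> u) e \<subseteq> V u" if "u \<in> J" for u
      using V(1,2) that J(2) open_contains_ball by (metis PiE_mem subsetD)
    then obtain e where e: "\<And>u. u \<in> J \<Longrightarrow> e u > 0 \<and> ball (\<phi> u) (e u) \<subseteq> V u" by metis
    \<comment> \<open>The entry 1 keeps the minimum defined and positive when \<open>J\<close> is
      empty.\<close>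
    define c where "c = Min (insert 1 ((\<lambda>u. (e u)\<^sup>2) ` J))"
    have "(e u)\<^sup>2 > 0" if "u \<in> J" for u using e[OF that] by simp
    then have c: "c > 0" "\<And>u. u \<in> J \<Longrightarrow> c \<le> (e u)\<^sup>2"
      using J(1) by (auto simp: c_def)
    define g where "g u y = (if y \<in> topspace T then u y - \<phi> u else 0)" for u y
    have g: "g u = (\<lambda>y. u y + (if y \<in> topspace T then - \<phi> u else 0))" if "u \<in> J" for u
      using Cb_outside[OF HX_subset_Cb] J(2) that by (fastforce simp: g_def)
    have gCb: "g u \<in> Cb T" and g0: "cext \<phi> (g u) = 0" if "u \<in> J" for u
    proof -
      have u: "u \<in> H" using that J(2) by auto
      then show "g u \<in> Cb T"
        unfolding g[OF that] by (intro Cb_add Cb_const HX_subset_Cb)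
      show "cext \<phi> (g u) = 0"
        unfolding g[OF that] using u
        by (simp add: cext_add[OF \<phi> HX_subset_Cb Cb_const] cext_const[OF \<phi>] cext_HX[OF \<phi>])
    qed
    define G where "G u y = g u y * cnj (g u y)" for u y
    have G: "G u \<in> Cb T \<and> cext \<phi> (G u) = 0" if "u \<in> J" for u
      unfolding G_def
      using Cb_mult[OF gCb[OF that] Cb_cnj[OF gCb[OF that]]]
        cext_mult[OF \<phi> gCb[OF that] Cb_cnj[OF gCb[OF that]]] g0[OF that] by simp
    define \<kappa> where "\<kappa> y = (\<Sum>u\<in>J. G u y)" for y
    have \<kappa>: "\<kappa> \<in> Cb T" "cext \<phi> \<kappa> = 0"
      using cext_sum_zero[OF \<phi> J(1) G] by (auto simp: \<kappa>_def[abs_def])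
    have \<kappa>c: "c \<le> norm (\<kappa> y)" if y: "y \<in> topspace T" for y
    proof -
      \<comment> \<open>An evaluation outside the box violates some constrained coordinate
        \<open>u\<close>, and that single summand already bounds \<open>\<kappa> y\<close> from
        below.\<close>
      have "\<iota> y \<notin> (\<Pi>\<^sub>E i\<in>H. V i)"
        using no y V(4) iota_chars[OF y] W'(2) by blast
      then obtain u where u: "u \<in> H" "u y \<notin> V u"
        by (auto simp: PiE_def Pi_def beta_i_def)
      then have uJ: "u \<in> J" by (auto simp: J_def)
      have "u y \<notin> ball (\<phi> u) (e u)" using e[OF uJ] u(2) by blast
      then have "e u \<le> norm (g u y)"
        using y by (simp add: g_def dist_norm norm_minus_commute)
      then have "(e u)\<^sup>2 \<le> (norm (g u y))\<^sup>2" using e[OF uJ] by (intro power_mono) auto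
      also have "\<dots> \<le> (\<Sum>u\<in>J. (norm (g u y))\<^sup>2)"
        using J(1) uJ by (intro member_le_sum) auto
      also have "\<dots> = norm (complex_of_real (\<Sum>u\<in>J. (norm (g u y))\<^sup>2))"
        by (simp add: sum_nonneg del: of_real_sum)
      also have "complex_of_real (\<Sum>u\<in>J. (norm (g u y))\<^sup>2) = \<kappa> y"
        by (simp add: \<kappa>_def G_def complex_norm_square del: of_real_power)
      finally show ?thesis using c(2)[OF uJ] by linarith
    qed
    have inv: "(\<lambda>y. if y \<in> topspace T then 1 / \<kappa> y else 0) \<in> Cb T"
    proof (rule Cb_restrict)
      show "continuous_map T euclidean (\<lambda>y. 1 / \<kappa> y)"
      proof (rule continuous_map_divide)
        show "\<kappa> y \<noteq> 0" if "y \<in> topspace T" for y using \<kappa>c[OF that] c(1) by auto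
      qed (use Cb_continuous[OF \<kappa>(1)] in auto)
      show "norm (1 / \<kappa> y) \<le> 1 / c" if "y \<in> topspace T" for y
        using \<kappa>c[OF that] c(1) by (simp add: norm_divide frac_le)
    qed
    have "(\<lambda>y. \<kappa> y * (if y \<in> topspace T then 1 / \<kappa> y else 0)) = (\<lambda>y. if y \<in> topspace T then 1 else 0)"
      using \<kappa>c c(1) by fastforce
    then have "cext \<phi> \<kappa> * cext \<phi> (\<lambda>y. if y \<in> topspace T then 1 / \<kappa> y else 0) = 1"
      using cext_mult[OF \<phi> \<kappa>(1) inv] cext_const[OF \<phi>, of 1] by simp
    then show False using \<kappa>(2) by simp
  qed
qed (rule continuous_map_iota)

lemma extends_along_Cb: "F \<in> Cb T \<Longrightarrow> extends_along T \<beta> \<iota> euclidean F"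
  by (rule extends_alongI[OF continuous_map_cext]) (auto simp: cext_iota)

text \<open>Compactness comes from the definition of \<open>H\<close>. If
  \<open>\<phi> u \<noteq> 0\<close>, then \<open>u\<close> stays away from 0 at evaluations near
  \<phi>. As \<open>u\<close> is uniformly close to a finite sum of products
  \<open>fs i * (hs i \<circ> r)\<close>, some \<open>hs i\<close> cannot be small at
  \<open>r y\<close>, which confines \<open>r y\<close> to a finite union of compact sets.\<close>

lemma extends_along_anchor: "extends_along T \<beta> \<iota> B r"
proof (rule extends_along_completely_regular[OF dense_iota r _ hB])
  show "completely_regular_space B"
    using lcB hB locally_compact_regular_imp_completely_regular_space by blast
  fix k assume k: "continuous_map B (top_of_set {0..1::real}) k"
  have k01: "0 \<le> k (r y) \<and> k (r y) \<le> 1" if "y \<in> topspace T" for y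
    using k r_topspace[OF that] by (force simp: continuous_map_def)
  have "continuous_map T euclideanreal (\<lambda>y. k (r y))"
    using continuous_map_compose[OF r, of euclideanreal k] k
    by (auto simp: continuous_map_in_subtopology o_def)
  then have "(\<lambda>y. if y \<in> topspace T then complex_of_real (k (r y)) else 0) \<in> Cb T"
    by (intro Cb_restrict[where M = 1] continuous_map_complex_of_real) (auto dest: k01)
  from extends_along_Cb[OF this] obtain g where g: "continuous_map \<beta> euclidean g"
    "\<And>y. y \<in> topspace T \<Longrightarrow> g (\<iota> y) = complex_of_real (k (r y))"
    unfolding extends_along_def by auto
  then show "extends_along T \<beta> \<iota> euclideanreal (\<lambda>y. k (r y))"
    by (intro extends_alongI[where g = "\<lambda>b. Re (g b)"] continuous_map_Re) auto
next
  fix \<phi> assume "\<phi> \<in> topspace \<beta>"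
  then have \<phi>: "\<phi> \<in> \<X>" by (simp add: topspace_beta)
  then obtain u where u: "u \<in> H" "\<phi> u \<noteq> 0" using char_nonzero by blast
  \<comment> \<open>With a quarter, \<open>norm (\<phi> u)\<close> exceeds
    \<open>2 * \<epsilon>\<close>, whereas an approximation error \<epsilon> and an approximating
    sum of norm at most \<epsilon> would only allow \<open>2 * \<epsilon>\<close>.\<close>
  define \<epsilon> where "\<epsilon> = norm (\<phi> u) / 4"
  have \<epsilon>: "\<epsilon> > 0" using u by (simp add: \<epsilon>_def)
  obtain n :: nat and fs hs where fh: "\<And>i. i < n \<Longrightarrow> fs i \<in> Cb T \<and> hs i \<in> C0 B"
    "\<And>y. y \<in> topspace T \<Longrightarrow> norm (u y - (\<Sum>i<n. fs i y * hs i (r y))) \<le> \<epsilon>"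
    using u(1) \<epsilon> unfolding HX_def by blast
  have "\<exists>M. M > 0 \<and> (\<forall>y. norm (fs i y) \<le> M)" if "i < n" for i
    using Cb_bound fh(1)[OF that] by metis
  then obtain M where M: "\<And>i. i < n \<Longrightarrow> M i > 0 \<and> (\<forall>y. norm (fs i y) \<le> M i)" by metis
  define S where "S = (\<Sum>i<n. M i)"
  have S: "S \<ge> 0" unfolding S_def using M by (intro sum_nonneg) (simp add: less_imp_le)
  \<comment> \<open>Chosen so that values of all \<open>hs i\<close> of norm at most \<delta> give a
    sum of norm at most \<open>S * \<delta> \<le> \<epsilon>\<close>; the summand 1 avoids division
    by zero.\<close>
  define \<delta> where "\<delta> = \<epsilon> / (1 + S)"
  have \<delta>: "\<delta> > 0" "S * \<delta> \<le> \<epsilon>" using \<epsilon> S by (auto simp: \<delta>_def field_simps)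
  define K where "K = (\<Union>i<n. {b \<in> topspace B. norm (hs i b) \<ge> \<delta>})"
  define N where "N = {\<psi> \<in> topspace \<beta>. norm (\<psi> u) > 2 * \<epsilon>}"
  have "compactin B K"
    unfolding K_def using fh(1) \<delta>(1) by (intro compactin_Union) (auto simp: C0_def)
  moreover have "openin \<beta> N"
    unfolding N_def
    by (intro continuous_map_real_nbhd(3) continuous_map_norm continuous_map_coordinate u(1))
  moreover have "\<phi> \<in> N" using \<phi> \<epsilon> u(2) by (simp add: N_def topspace_beta \<epsilon>_def)
  moreover have "r y \<in> K" if y: "y \<in> topspace T" "\<iota> y \<in> N" for y
  proof (rule ccontr)
    assume "r y \<notin> K"
    then have small: "norm (hs i (r y)) \<le> \<delta>" if "i < n" for i
      using that r_topspace[OF y(1)] by (force simp: K_def)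
    have "norm (\<Sum>i<n. fs i y * hs i (r y)) \<le> (\<Sum>i<n. M i * \<delta>)"
    proof (rule sum_norm_le)
      show "norm (fs i y * hs i (r y)) \<le> M i * \<delta>" if "i \<in> {..<n}" for i
        unfolding norm_mult using M[of i] small[of i] that by (intro mult_mono) (auto simp: less_imp_le)
    qed
    also have "\<dots> \<le> \<epsilon>" using \<delta>(2) by (simp add: S_def sum_distrib_right)
    finally have "norm (u y) \<le> 2 * \<epsilon>"
      using fh(2)[OF y(1)] norm_triangle_sub[of "u y" "\<Sum>i<n. fs i y * hs i (r y)"] by linarith
    then show False using y(2) u(1) by (simp add: N_def iota_apply)
  qed
  ultimately show "\<exists>N K. openin \<beta> N \<and> \<phi> \<in> N \<and> compactin B K \<and> (\<forall>d\<in>topspace T. \<iota> d \<in> N \<longrightarrow> r d \<in> K)"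
    by blast
qed

text \<open>Additivity, multiplicativity and homogeneity are equations and pass to \<open>E\<close>
  by density. Being nonzero does not; this is what the extension \<rho> of the anchor is for. A
  function of the base equal to 1 at \<open>\<rho> e\<close> yields an element of \<open>H\<close>
  on which \<open>\<Psi> e\<close> takes the value 1.\<close>

lemma extends_along_into_beta:
  assumes j: "dense_map D E j" and f: "f \<in> topspace D \<rightarrow> topspace T"
    and ext: "\<And>u. u \<in> H \<Longrightarrow> extends_along D E j euclidean (\<lambda>d. u (f d))"
    and anc: "extends_along D E j B (\<lambda>d. r (f d))"
  shows "extends_along D E j \<beta> (\<lambda>d. \<iota> (f d))"
proof -
  obtain g where g: "\<And>u. u \<in> H \<Longrightarrow> continuous_map E euclidean (g u)"
    "\<And>u d. u \<in> H \<Longrightarrow> d \<in> topspace D \<Longrightarrow> g u (j d) = u (f d)"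
    using ext unfolding extends_along_def by metis
  obtain \<rho> where \<rho>: "continuous_map E B \<rho>" "\<And>d. d \<in> topspace D \<Longrightarrow> \<rho> (j d) = r (f d)"
    using anc unfolding extends_along_def by metis
  note agree = dense_map_agree[OF j Hausdorff_space_euclidean]
  define \<Psi> where "\<Psi> e = restrict (\<lambda>u. g u e) H" for e
  have "\<Psi> e \<in> \<X>" if e: "e \<in> topspace E" for e
  proof -
    have add: "g (\<lambda>y. u y + v y) e = g u e + g v e" if "u \<in> H" "v \<in> H" for u v
      by (rule agree[OF _ _ _ e]) (use that in \<open>auto intro!: g(1) HX_add continuous_map_add simp: g(2) HX_add\<close>)
    have mult: "g (\<lambda>y. u y * v y) e = g u e * g v e" if "u \<in> H" "v \<in> H" for u v
      by (rule agree[OF _ _ _ e]) (use that in \<open>auto intro!: g(1) HX_mult continuous_map_mult simp: g(2) HX_mult\<close>)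
    have scale: "g (\<lambda>y. c * u y) e = c * g u e" if "u \<in> H" for c u
      by (rule agree[OF _ _ _ e]) (use that in \<open>auto intro!: g(1) HX_scale continuous_map_mult simp: g(2) HX_scale\<close>)
    have "\<rho> e \<in> topspace B" using \<rho>(1) e by (auto simp: continuous_map_def)
    then obtain h where h: "h \<in> C0 B" "h (\<rho> e) = 1" using C0_bump[OF lcB hB] by metis
    let ?u = "\<lambda>y. (if y \<in> topspace T then 1 else 0) * h (r y)"
    have "g ?u e = h (\<rho> e)"
    proof (rule agree[OF _ _ _ e])
      show "continuous_map E euclidean (\<lambda>e. h (\<rho> e))"
        using continuous_map_compose[OF \<rho>(1), of euclidean h] h(1) by (simp add: C0_def o_def)
      show "g ?u (j d) = h (\<rho> (j d))" if "d \<in> topspace D" for d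
        using f that by (auto simp: g(2) bump_HX[OF h(1)] \<rho>(2))
    qed (rule g(1)[OF bump_HX[OF h(1)]])
    then have "\<exists>u\<in>H. \<Psi> e u \<noteq> 0"
      using h(2) bump_HX[OF h(1)] by (intro bexI[of _ ?u]) (simp_all add: \<Psi>_def)
    moreover have "\<Psi> e \<in> extensional H" by (simp add: \<Psi>_def)
    ultimately show ?thesis
      unfolding chars_def by (auto simp: \<Psi>_def add mult scale HX_add HX_mult HX_scale)
  qed
  then have "continuous_map E \<beta> \<Psi>"
    by (rule continuous_map_into_beta) (auto simp: \<Psi>_def g(1))
  moreover have "\<Psi> (j d) = \<iota> (f d)" if "d \<in> topspace D" for d
    using that by (auto simp: \<Psi>_def beta_i_def restrict_def g(2))
  ultimately show ?thesis by (rule extends_alongI)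
qed

text \<open>A function defined over \<open>N\<close> only is multiplied by a cut-off \<kappa> on the
  compactification, extended by zero to an element of \<open>Cb T\<close>, extended from there, and
  divided by \<kappa> again where \<kappa> is nonzero. This gives an extension near each
  \<open>e\<close>, and the local ones are glued.\<close>

lemma extends_along_open:
  fixes F :: "'y \<Rightarrow> complex"
  assumes N: "openin \<beta> N"
    and F: "continuous_map (subtopology T {y \<in> topspace T. \<iota> y \<in> N}) euclidean F"
    and M: "\<And>y. y \<in> topspace T \<Longrightarrow> \<iota> y \<in> N \<Longrightarrow> norm (F y) \<le> M"
  shows "extends_along (subtopology T {y \<in> topspace T. \<iota> y \<in> N}) (subtopology \<beta> N) \<iota> euclidean F"
proof (rule extends_along_local[OF dense_map_open_restrict[OF dense_iota N] Hausdorff_space_euclidean])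
  fix e assume "e \<in> topspace (subtopology \<beta> N)"
  then have e: "e \<in> topspace \<beta>" "e \<in> N" by auto
  obtain k where k: "continuous_map \<beta> (top_of_set {0..1::real}) k" "k e = 0"
      "k ` (topspace \<beta> - N) \<subseteq> {1}"
    using completely_regular_beta N e unfolding completely_regular_space_def
    by (metis DiffD2 DiffI closedin_diff closedin_topspace)
  have kc: "continuous_map \<beta> euclideanreal k"
    using k(1) by (simp add: continuous_map_in_subtopology)
  have kic: "continuous_map T euclideanreal (\<lambda>y. k (\<iota> y))"
    using continuous_map_compose[OF continuous_map_iota kc] by (simp add: o_def)
  have k0: "k b \<ge> 0" if "b \<in> topspace \<beta>" for b using k(1) that by (force simp: continuous_map_def)
  have iT: "\<iota> y \<in> topspace \<beta>" if "y \<in> topspace T" for y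
    using iota_chars[OF that] topspace_beta by auto
  define Y where "Y = {y \<in> topspace T. \<iota> y \<in> N}"
  have Y: "openin T Y"
    unfolding Y_def by (rule openin_continuous_map_preimage[OF continuous_map_iota N])
  \<comment> \<open>The cut-off vanishes wherever \<open>k \<ge> 1/2\<close>, hence on a whole
    neighbourhood of the complement of \<open>N\<close>; this makes the extension by zero
    continuous. It is positive where \<open>k < 1/2\<close>, in particular near
    \<open>e\<close>.\<close>
  define \<kappa> where "\<kappa> b = max 0 (1 - 2 * k b)" for b
  have \<kappa>c: "continuous_map \<beta> euclideanreal \<kappa>"
    unfolding \<kappa>_def by (intro continuous_map_real_max continuous_map_diff continuous_map_real_mult_left kc) auto
  have \<kappa>ic: "continuous_map T euclideanreal (\<lambda>y. \<kappa> (\<iota> y))"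
    using continuous_map_compose[OF continuous_map_iota \<kappa>c] by (simp add: o_def)
  have \<kappa>1: "0 \<le> \<kappa> b \<and> \<kappa> b \<le> 1" if "b \<in> topspace \<beta>" for b
    using k0[OF that] by (auto simp: \<kappa>_def)
  define G where "G y = (if y \<in> Y then complex_of_real (\<kappa> (\<iota> y)) * F y else 0)" for y
  have "G \<in> Cb T"
  proof (rule CbI)
    show "continuous_map T euclidean G"
    proof (rule continuous_map_locally)
      fix y assume y: "y \<in> topspace T"
      show "\<exists>N. openin T N \<and> y \<in> N \<and> continuous_map (subtopology T N) euclidean G"
      proof (cases "y \<in> Y")
        case True
        have "continuous_map (subtopology T Y) euclidean G"
        proof (rule continuous_map_eq)
          show "continuous_map (subtopology T Y) euclidean (\<lambda>y. complex_of_real (\<kappa> (\<iota> y)) * F y)"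
            using F unfolding Y_def[symmetric]
            by (intro continuous_map_mult continuous_map_complex_of_real
                continuous_map_from_subtopology[OF \<kappa>ic])
        qed (auto simp: G_def)
        then show ?thesis using Y True by blast
      next
        case False
        then have "k (\<iota> y) = 1" using k(3) y iT[OF y] by (auto simp: Y_def)
        moreover have "continuous_map (subtopology T {y \<in> topspace T. 1 / 2 < k (\<iota> y)}) euclidean G"
          by (rule continuous_map_eq[where f = "\<lambda>y. 0"]) (auto simp: G_def \<kappa>_def)
        ultimately show ?thesis
          using continuous_map_real_nbhd(3)[OF kic, of "1 / 2"] y
          by (intro exI[of _ "{y \<in> topspace T. 1 / 2 < k (\<iota> y)}"]) auto
      qed
    qed
    \<comment> \<open>The maximum covers points outside \<open>Y\<close>, where \<open>G\<close> is
      0; \<open>M\<close> could be negative if \<open>Y\<close> is empty.\<close>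
    show "norm (G y) \<le> max M 0" if "y \<in> topspace T" for y
    proof (cases "y \<in> Y")
      case True
      have "\<kappa> (\<iota> y) * norm (F y) \<le> 1 * norm (F y)"
        using \<kappa>1[OF iT[OF that]] by (intro mult_right_mono) auto
      then show ?thesis using True M[OF that] \<kappa>1[OF iT[OF that]] by (auto simp: G_def Y_def norm_mult)
    qed (simp add: G_def)
  qed (auto simp: G_def Y_def)
  then obtain g where g: "continuous_map \<beta> euclidean g" "\<And>y. y \<in> topspace T \<Longrightarrow> g (\<iota> y) = G y"
    using extends_along_Cb unfolding extends_along_def by metis
  define N' where "N' = N \<inter> {b \<in> topspace \<beta>. k b < 1 / 2}"
  have "openin \<beta> N'"
    unfolding N'_def by (rule openin_Int[OF N continuous_map_real_nbhd(2)[OF kc]])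
  then have N': "openin (subtopology \<beta> N) N'" "e \<in> N'"
    using N e k(2) by (auto simp: N'_def openin_open_subtopology)
  have \<kappa>0: "\<kappa> b \<noteq> 0" if "b \<in> N'" for b using that by (simp add: N'_def \<kappa>_def)
  have "extends_along (subtopology (subtopology T Y) {d \<in> topspace (subtopology T Y). \<iota> d \<in> N'})
      (subtopology (subtopology \<beta> N) N') \<iota> euclidean F"
  proof (rule extends_alongI)
    show "continuous_map (subtopology (subtopology \<beta> N) N') euclidean (\<lambda>b. g b / complex_of_real (\<kappa> b))"
    proof (intro continuous_map_divide continuous_map_complex_of_real continuous_map_from_subtopology g(1) \<kappa>c)
      show "complex_of_real (\<kappa> b) \<noteq> 0" if "b \<in> topspace (subtopology (subtopology \<beta> N) N')" for b
        using \<kappa>0 that by simp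
    qed
    show "g (\<iota> d) / complex_of_real (\<kappa> (\<iota> d)) = F d"
      if "d \<in> topspace (subtopology (subtopology T Y) {d \<in> topspace (subtopology T Y). \<iota> d \<in> N'})" for d
      using that g(2)[of d] \<kappa>0[of "\<iota> d"] by (simp add: G_def)
  qed
  then show "\<exists>N'. openin (subtopology \<beta> N) N' \<and> e \<in> N' \<and>
      extends_along (subtopology (subtopology T {y \<in> topspace T. \<iota> y \<in> N})
         {d \<in> topspace (subtopology T {y \<in> topspace T. \<iota> y \<in> N}). \<iota> d \<in> N'})
       (subtopology (subtopology \<beta> N) N') \<iota> euclidean F"
    using N' by (auto simp: Y_def)
qed

end

section \<open>Quotients, groupoids and basic actions\<close>

text \<open>The preimage of \<open>W\<close> under the inverse is the image of \<open>W\<close>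
  under \<open>f\<close>, which is open. All local sections below arise in this way: of
  \<open>s\<close>, of the range map, of the orbit map, and of the action map on a slice.\<close>

lemma continuous_map_inv_into:
  assumes f: "open_map X Y f" and U: "openin X U" and inj: "inj_on f U"
  shows "continuous_map (subtopology Y (f ` U)) (subtopology X U) (inv_into U f)"
proof -
  have fU: "openin Y (f ` U)" using f U by (simp add: open_map_def)
  have UX: "U \<subseteq> topspace X" using openin_subset[OF U] .
  show ?thesis
    unfolding continuous_map_def
  proof (intro conjI allI impI)
    show "inv_into U f \<in> topspace (subtopology Y (f ` U)) \<rightarrow> topspace (subtopology X U)"
    proof
      fix y assume "y \<in> topspace (subtopology Y (f ` U))"
      then have "inv_into U f y \<in> U" by (intro inv_into_into) simp
      then show "inv_into U f y \<in> topspace (subtopology X U)" using UX by auto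
    qed
    fix W assume "openin (subtopology X U) W"
    then have W: "openin X W" "W \<subseteq> U" using U by (auto simp: openin_open_subtopology)
    have "{y \<in> topspace (subtopology Y (f ` U)). inv_into U f y \<in> W} = f ` W"
    proof (intro set_eqI iffI)
      fix y assume "y \<in> {y \<in> topspace (subtopology Y (f ` U)). inv_into U f y \<in> W}"
      then show "y \<in> f ` W" using f_inv_into_f[of y f U] by (metis (no_types, lifting) CollectD IntD2 image_eqI topspace_subtopology)
    next
      fix y assume "y \<in> f ` W"
      then obtain w where w: "w \<in> W" "w \<in> U" "y = f w" using W(2) by blast
      then show "y \<in> {y \<in> topspace (subtopology Y (f ` U)). inv_into U f y \<in> W}"
        using openin_subset[OF fU] inj by auto
    qed
    then show "openin (subtopology Y (f ` U)) {y \<in> topspace (subtopology Y (f ` U)). inv_into U f y \<in> W}"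
      using f W fU by (auto simp: openin_open_subtopology open_map_def)
  qed
qed

lemma local_homeo_imp_continuous_map:
  assumes "local_homeo X Y f" shows "continuous_map X Y f"
proof (rule continuous_map_locally)
  fix x assume "x \<in> topspace X"
  then obtain U where U: "openin X U" "x \<in> U" "homeomorphic_map (subtopology X U) (subtopology Y (f ` U)) f"
    using assms unfolding local_homeo_def by blast
  then have "continuous_map (subtopology X U) Y f"
    using homeomorphic_imp_continuous_map continuous_map_into_fulltopology by blast
  then show "\<exists>N. openin X N \<and> x \<in> N \<and> continuous_map (subtopology X N) Y f" using U by blast
qed

lemma local_homeo_inj:
  assumes "local_homeo X Y f" "x \<in> topspace X"
  obtains U where "openin X U" "x \<in> U" "inj_on f U"
proof -
  obtain U where U: "openin X U" "x \<in> U" "homeomorphic_map (subtopology X U) (subtopology Y (f ` U)) f"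
    using assms unfolding local_homeo_def by blast
  then have "inj_on f U"
    using openin_subset[OF U(1)] by (auto simp: homeomorphic_eq_everything_map inf.absorb2)
  then show ?thesis using U that by blast
qed

lemma local_homeo_imp_open_map:
  assumes "local_homeo X Y f" shows "open_map X Y f"
  unfolding open_map_def
proof (intro allI impI)
  fix W assume W: "openin X W"
  show "openin Y (f ` W)"
  proof (subst openin_subopen, intro ballI)
    fix y assume "y \<in> f ` W"
    then obtain x where x: "x \<in> W" "y = f x" by blast
    then have "x \<in> topspace X" using openin_subset[OF W] by blast
    then obtain U where U: "openin X U" "x \<in> U" "openin Y (f ` U)"
        "homeomorphic_map (subtopology X U) (subtopology Y (f ` U)) f"
      using assms unfolding local_homeo_def by blast
    have "openin (subtopology X U) (W \<inter> U)" using W by (simp add: openin_subtopology_Int)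
    then have "openin (subtopology Y (f ` U)) (f ` (W \<inter> U))"
      using U(4) by (auto simp: homeomorphic_eq_everything_map open_map_def)
    then have "openin Y (f ` (W \<inter> U))" using U(3) by (simp add: openin_open_subtopology)
    then show "\<exists>V. openin Y V \<and> y \<in> V \<and> V \<subseteq> f ` W"
      using x U(2) by (intro exI[of _ "f ` (W \<inter> U)"]) auto
  qed
qed

text \<open>\<open>quot_top\<close> takes its open sets only as a generating family. They already
  form a topology: the classes partition \<open>X\<close>, so the union of \<open>U\<close> is the
  preimage of \<open>U\<close> under \<open>q\<close>, and preimages commute with intersections and
  unions.\<close>

lemma quotient_map_quot_top:
  assumes q: "\<And>z. z \<in> topspace X \<Longrightarrow> z \<in> q z \<and> q z \<subseteq> topspace X"
    and eq: "\<And>z w. z \<in> topspace X \<Longrightarrow> w \<in> q z \<Longrightarrow> q w = q z"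
  shows "quotient_map X (quot_top X (q ` topspace X)) q"
proof -
  let ?P = "q ` topspace X"
  have union: "\<Union>U = {z \<in> topspace X. q z \<in> U}" if U: "U \<subseteq> ?P" for U
  proof (intro set_eqI iffI)
    fix w assume "w \<in> \<Union>U"
    then obtain z where "z \<in> topspace X" "q z \<in> U" "w \<in> q z" using U by blast
    then show "w \<in> {z \<in> topspace X. q z \<in> U}" using q[of z] eq[of z w] by auto
  qed (use q in blast)
  have "U \<subseteq> ?P \<and> openin X {z \<in> topspace X. q z \<in> U}"
    if "generate_topology_on {U. U \<subseteq> ?P \<and> openin X (\<Union>U)} U" for U
    using that
  proof induction
    case (Int U V)
    moreover have "{z \<in> topspace X. q z \<in> U \<inter> V} =
        {z \<in> topspace X. q z \<in> U} \<inter> {z \<in> topspace X. q z \<in> V}" by blast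
    ultimately show ?case by auto
  next
    case (UN \<U>)
    have "{z \<in> topspace X. q z \<in> \<Union>\<U>} = (\<Union>U\<in>\<U>. {z \<in> topspace X. q z \<in> U})" by blast
    moreover have "openin X (\<Union>U\<in>\<U>. {z \<in> topspace X. q z \<in> U})"
      using UN by (intro openin_Union) blast
    moreover have "\<Union>\<U> \<subseteq> ?P" using UN by blast
    ultimately show ?case by simp
  next
    case (Basis U)
    then show ?case using union[of U] by auto
  qed simp
  moreover have "generate_topology_on {U. U \<subseteq> ?P \<and> openin X (\<Union>U)} U"
    if "U \<subseteq> ?P" "openin X {z \<in> topspace X. q z \<in> U}" for U
    using that union[OF that(1)] by (intro generate_topology_on.Basis) simp
  ultimately have op: "openin (quot_top X ?P) U \<longleftrightarrow> U \<subseteq> ?P \<and> openin X {z \<in> topspace X. q z \<in> U}" for U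
    unfolding quot_top_def openin_topology_generated_by_iff by blast
  have "topspace (quot_top X ?P) = ?P"
  proof
    show "topspace (quot_top X ?P) \<subseteq> ?P" using op by blast
    have "{z \<in> topspace X. q z \<in> ?P} = topspace X" by blast
    then have "openin (quot_top X ?P) ?P" unfolding op by simp
    then show "?P \<subseteq> topspace (quot_top X ?P)" by (rule openin_subset)
  qed
  then show ?thesis unfolding quotient_map_def op by auto
qed

section \<open>Etale groupoids: inverses and the open unit space\<close>

context
  fixes G :: "'a groupoid"
  assumes G: "etale_groupoid G"
begin

lemma units_arr: "u \<in> gunits G \<Longrightarrow> u \<in> garr G"
  and rng_unit: "g \<in> garr G \<Longrightarrow> grng G g \<in> gunits G"
  and unit_rng: "u \<in> gunits G \<Longrightarrow> grng G u = u"
  and unit_src: "u \<in> gunits G \<Longrightarrow> gsrc G u = u"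
  and mul_assoc: "(g, h) \<in> gcomp G \<Longrightarrow> (h, k) \<in> gcomp G \<Longrightarrow> gmul G (gmul G g h) k = gmul G g (gmul G h k)"
  and mul_unit_left: "g \<in> garr G \<Longrightarrow> gmul G (grng G g) g = g"
  and mul_unit_right: "g \<in> garr G \<Longrightarrow> gmul G g (gsrc G g) = g"
  and inv_arr: "g \<in> garr G \<Longrightarrow> ginv G g \<in> garr G"
  and inv_rng: "g \<in> garr G \<Longrightarrow> grng G (ginv G g) = gsrc G g"
  and inv_src: "g \<in> garr G \<Longrightarrow> gsrc G (ginv G g) = grng G g"
  and mul_inv_right: "g \<in> garr G \<Longrightarrow> gmul G g (ginv G g) = grng G g"
  and mul_inv_left: "g \<in> garr G \<Longrightarrow> gmul G (ginv G g) g = gsrc G g"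
  and rng_local_homeo: "local_homeo (gtop G) (unit_top G) (grng G)"
  using G unfolding etale_groupoid_def by (elim conjE; blast)+

lemma
  assumes "(g, h) \<in> gcomp G"
  shows mul_arr: "gmul G g h \<in> garr G" and mul_rng: "grng G (gmul G g h) = grng G g"
    and mul_src: "gsrc G (gmul G g h) = gsrc G h"
proof -
  have "\<forall>(g, h)\<in>gcomp G. gmul G g h \<in> garr G \<and> grng G (gmul G g h) = grng G g \<and>
                         gsrc G (gmul G g h) = gsrc G h"
    using G unfolding etale_groupoid_def by (elim conjE)
  from bspec[OF this assms]
  show "gmul G g h \<in> garr G" "grng G (gmul G g h) = grng G g" "gsrc G (gmul G g h) = gsrc G h"
    by auto
qed

lemma inv_unique:
  assumes "g \<in> garr G" "h \<in> garr G" "gsrc G g = grng G h" "gmul G g h = grng G g"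
  shows "h = ginv G g"
proof -
  have "h = gmul G (gmul G (ginv G g) g) h"
    using assms by (simp add: mul_inv_left mul_unit_left)
  also have "\<dots> = gmul G (ginv G g) (grng G g)"
    using assms by (simp add: mul_assoc gcomp_def inv_arr inv_src)
  also have "\<dots> = ginv G g"
    using mul_unit_right[OF inv_arr[OF assms(1)]] assms by (simp add: inv_src)
  finally show ?thesis .
qed

lemma inv_mul:
  assumes gh: "(g, h) \<in> gcomp G"
  shows "ginv G (gmul G g h) = gmul G (ginv G h) (ginv G g)"
proof (rule inv_unique[symmetric])
  have g: "g \<in> garr G" "h \<in> garr G" "gsrc G g = grng G h" using gh by (auto simp: gcomp_def)
  have c: "(ginv G h, ginv G g) \<in> gcomp G" "(h, ginv G h) \<in> gcomp G" "(g, ginv G g) \<in> gcomp G"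
    using g by (auto simp: gcomp_def inv_arr inv_rng inv_src)
  show "gmul G (ginv G h) (ginv G g) \<in> garr G" using mul_arr[OF c(1)] .
  show "gmul G g h \<in> garr G" using mul_arr[OF gh] .
  show "gsrc G (gmul G g h) = grng G (gmul G (ginv G h) (ginv G g))"
    using mul_src[OF gh] mul_rng[OF c(1)] g by (simp add: inv_rng)
  have "gmul G (gmul G g h) (gmul G (ginv G h) (ginv G g)) = gmul G g (gmul G h (gmul G (ginv G h) (ginv G g)))"
    using gh c mul_arr[OF c(1)] mul_rng[OF c(1)]
    by (intro mul_assoc) (auto simp: gcomp_def)
  also have "gmul G h (gmul G (ginv G h) (ginv G g)) = gmul G (gmul G h (ginv G h)) (ginv G g)"
    using mul_assoc[OF c(2,1)] by simp
  also have "\<dots> = ginv G g"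
    using mul_unit_left[OF inv_arr[OF g(1)]] g by (simp add: mul_inv_right inv_rng)
  finally show "gmul G (gmul G g h) (gmul G (ginv G h) (ginv G g)) = grng G (gmul G g h)"
    using g mul_rng[OF gh] by (simp add: mul_inv_right)
qed

text \<open>Near a unit the range map is injective on some open \<open>V\<close>. If both
  \<open>g\<close> and its range lie in \<open>V\<close>, they have the same range, so
  \<open>g\<close> equals its range and is a unit.\<close>

lemma openin_units: "openin (gtop G) (gunits G)"
proof (subst openin_subopen, intro ballI)
  fix u assume u: "u \<in> gunits G"
  obtain V where V: "openin (gtop G) V" "u \<in> V" "inj_on (grng G) V"
    using local_homeo_inj[OF rng_local_homeo units_arr[OF u]] by metis
  have c: "continuous_map (gtop G) (gtop G) (grng G)"
    using local_homeo_imp_continuous_map[OF rng_local_homeo] continuous_map_into_fulltopology by blast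
  have "openin (gtop G) (V \<inter> {g \<in> garr G. grng G g \<in> V})"
    using openin_Int[OF V(1) openin_continuous_map_preimage[OF c V(1)]] .
  moreover have "u \<in> V \<inter> {g \<in> garr G. grng G g \<in> V}"
    using u V(2) by (simp add: units_arr unit_rng)
  moreover have "V \<inter> {g \<in> garr G. grng G g \<in> V} \<subseteq> gunits G"
  proof clarify
    fix g assume g: "g \<in> V" "g \<in> garr G" "grng G g \<in> V"
    then have "grng G g = g"
      using V(3) unit_rng[OF rng_unit[OF g(2)]] by (auto dest: inj_onD)
    then show "g \<in> gunits G" using rng_unit[OF g(2)] by simp
  qed
  ultimately show "\<exists>W. openin (gtop G) W \<and> u \<in> W \<and> W \<subseteq> gunits G" by blast
qed

end


lemma
  assumes "right_action X G"
  shows csrc_continuous: "continuous_map (ctop X) (unit_top G) (csrc X)"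
    and ract_continuous: "continuous_map (subtopology (prod_topology (ctop X) (gtop G)) (rdom X G)) (ctop X)
        (\<lambda>(\<xi>, g). ract X \<xi> g)"
    and ract_mul: "(\<xi>, g) \<in> rdom X G \<Longrightarrow> (g, g') \<in> gcomp G \<Longrightarrow>
        ract X (ract X \<xi> g) g' = ract X \<xi> (gmul G g g')"
    and ract_unit: "\<xi> \<in> topspace (ctop X) \<Longrightarrow> ract X \<xi> (csrc X \<xi>) = \<xi>"
  using assms unfolding right_action_def by (elim conjE; blast)+

lemma
  assumes "left_action G X"
  shows crng_continuous: "continuous_map (ctop X) (unit_top G) (crng X)"
    and lact_continuous: "continuous_map (subtopology (prod_topology (gtop G) (ctop X)) (ldom G X)) (ctop X)
        (\<lambda>(h, \<xi>). lact X h \<xi>)"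
    and lact_mul: "(h, h') \<in> gcomp G \<Longrightarrow> (h', \<xi>) \<in> ldom G X \<Longrightarrow>
        lact X h (lact X h' \<xi>) = lact X (gmul G h h') \<xi>"
    and lact_unit: "\<xi> \<in> topspace (ctop X) \<Longrightarrow> lact X (crng X \<xi>) \<xi> = \<xi>"
  using assms unfolding left_action_def by (elim conjE; blast)+

lemma ract_src:
  assumes "right_action X G" "(\<xi>, g) \<in> rdom X G" shows "csrc X (ract X \<xi> g) = gsrc G g"
proof -
  have "\<forall>(\<xi>, g)\<in>rdom X G. csrc X (ract X \<xi> g) = gsrc G g"
    using assms(1) unfolding right_action_def by (elim conjE)
  from bspec[OF this assms(2)] show ?thesis by simp
qed

lemma lact_rng:
  assumes "left_action G X" "(h, \<xi>) \<in> ldom G X" shows "crng X (lact X h \<xi>) = grng G h"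
proof -
  have "\<forall>(h, \<xi>)\<in>ldom G X. crng X (lact X h \<xi>) = grng G h"
    using assms(1) unfolding left_action_def by (elim conjE)
  from bspec[OF this assms(2)] show ?thesis by simp
qed

lemma ract_topspace:
  assumes "right_action X G" "(\<xi>, g) \<in> rdom X G" shows "ract X \<xi> g \<in> topspace (ctop X)"
proof -
  have "(\<xi>, g) \<in> topspace (subtopology (prod_topology (ctop X) (gtop G)) (rdom X G))"
    using assms(2) by (auto simp: rdom_def)
  from funcset_mem[OF continuous_map_funspace[OF ract_continuous[OF assms(1)]] this]
  show ?thesis by simp
qed

lemma lact_topspace:
  assumes "left_action G X" "(h, \<xi>) \<in> ldom G X" shows "lact X h \<xi> \<in> topspace (ctop X)"
proof -
  have "(h, \<xi>) \<in> topspace (subtopology (prod_topology (gtop G) (ctop X)) (ldom G X))"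
    using assms(2) by (auto simp: ldom_def)
  from funcset_mem[OF continuous_map_funspace[OF lact_continuous[OF assms(1)]] this]
  show ?thesis by simp
qed

section \<open>Right actions: orbit space, freeness and slices\<close>

context
  fixes G :: "'a groupoid" and X :: "'a corr"
  assumes G: "etale_groupoid G" and R: "right_action X G"
begin

lemma csrc_unit: "\<xi> \<in> topspace (ctop X) \<Longrightarrow> csrc X \<xi> \<in> gunits G"
  using csrc_continuous[OF R] by (auto simp: continuous_map_def)

lemma rdom_unit: "\<xi> \<in> topspace (ctop X) \<Longrightarrow> (\<xi>, csrc X \<xi>) \<in> rdom X G"
  using csrc_unit by (simp add: rdom_def units_arr[OF G] unit_rng[OF G])

lemma rdom_ract: "(\<xi>, g) \<in> rdom X G \<Longrightarrow> (g, g') \<in> gcomp G \<Longrightarrow> (ract X \<xi> g, g') \<in> rdom X G"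
  using ract_topspace[OF R] ract_src[OF R] by (simp add: rdom_def gcomp_def)

lemma rdom_mul: "(\<xi>, g) \<in> rdom X G \<Longrightarrow> (g, g') \<in> gcomp G \<Longrightarrow> (\<xi>, gmul G g g') \<in> rdom X G"
  using mul_arr[OF G] mul_rng[OF G] by (simp add: rdom_def)

lemma ract_inv:
  assumes "(\<xi>, g) \<in> rdom X G"
  shows "(ract X \<xi> g, ginv G g) \<in> rdom X G" "ract X (ract X \<xi> g) (ginv G g) = \<xi>"
proof -
  have g: "g \<in> garr G" "csrc X \<xi> = grng G g" "\<xi> \<in> topspace (ctop X)" using assms by (auto simp: rdom_def)
  have c: "(g, ginv G g) \<in> gcomp G" using g by (simp add: gcomp_def inv_arr[OF G] inv_rng[OF G])
  show "(ract X \<xi> g, ginv G g) \<in> rdom X G" using rdom_ract[OF assms c] .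
  show "ract X (ract X \<xi> g) (ginv G g) = \<xi>"
    using ract_mul[OF R assms c] ract_unit[OF R g(3)] g by (simp add: mul_inv_right[OF G])
qed

lemma orbit_ract:
  assumes "(\<xi>, g) \<in> rdom X G" shows "orbit X G (ract X \<xi> g) = orbit X G \<xi>"
proof -
  have sub: "orbit X G (ract X \<xi> g) \<subseteq> orbit X G \<xi>" if d: "(\<xi>, g) \<in> rdom X G" for \<xi> g
  proof
    fix \<zeta> assume "\<zeta> \<in> orbit X G (ract X \<xi> g)"
    then obtain g' where g': "\<zeta> = ract X (ract X \<xi> g) g'" "(ract X \<xi> g, g') \<in> rdom X G"
      unfolding orbit_def by blast
    then have c: "(g, g') \<in> gcomp G"
      using d ract_src[OF R d] by (simp add: rdom_def gcomp_def)
    then show "\<zeta> \<in> orbit X G \<xi>"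
      unfolding orbit_def g'(1) ract_mul[OF R d c] using rdom_mul[OF d c] by blast
  qed
  show ?thesis
    using sub[OF assms] sub[OF ract_inv(1)[OF assms]] ract_inv(2)[OF assms] by simp
qed

lemma orbit_self: "\<xi> \<in> topspace (ctop X) \<Longrightarrow> \<xi> \<in> orbit X G \<xi>"
  unfolding orbit_def using rdom_unit[of \<xi>] ract_unit[OF R, of \<xi>] by force

lemma orbit_subset: "orbit X G \<xi> \<subseteq> topspace (ctop X)"
  unfolding orbit_def using ract_topspace[OF R] by auto

lemma orbit_eq_iff:
  assumes "\<xi> \<in> topspace (ctop X)" "\<zeta> \<in> topspace (ctop X)"
  shows "orbit X G \<xi> = orbit X G \<zeta> \<longleftrightarrow> (\<exists>g. (\<xi>, g) \<in> rdom X G \<and> \<zeta> = ract X \<xi> g)"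
proof
  assume "orbit X G \<xi> = orbit X G \<zeta>"
  then have "\<zeta> \<in> orbit X G \<xi>" using orbit_self[OF assms(2)] by simp
  then show "\<exists>g. (\<xi>, g) \<in> rdom X G \<and> \<zeta> = ract X \<xi> g" unfolding orbit_def by blast
qed (auto simp: orbit_ract)

lemma quotient_map_orbit: "quotient_map (ctop X) (orbit_top X G) (orbit X G)"
  unfolding orbit_top_def orbits_def
proof (rule quotient_map_quot_top)
  show "orbit X G w = orbit X G z" if "z \<in> topspace (ctop X)" "w \<in> orbit X G z" for z w
    using that orbit_ract by (auto simp: orbit_def[of X G z])
qed (use orbit_self orbit_subset in auto)

text \<open>The range map being a local homeomorphism is essential. An arrow \<open>k0\<close>
  moving \<open>\<zeta>0\<close> into \<open>W\<close> extends to a local section \<kappa> of the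
  range map, and \<open>\<zeta> \<mapsto> \<zeta> \<kappa>(s \<zeta>)\<close> moves a whole
  neighbourhood of \<open>\<zeta>0\<close> into \<open>W\<close>. Hence the saturation of
  \<open>W\<close> is open.\<close>

lemma open_map_orbit: "open_map (ctop X) (orbit_top X G) (orbit X G)"
  unfolding open_map_def
proof (intro allI impI)
  fix W assume W: "openin (ctop X) W"
  have "openin (ctop X) {\<zeta> \<in> topspace (ctop X). orbit X G \<zeta> \<in> orbit X G ` W}"
  proof (subst openin_subopen, intro ballI)
    fix \<zeta>0 assume "\<zeta>0 \<in> {\<zeta> \<in> topspace (ctop X). orbit X G \<zeta> \<in> orbit X G ` W}"
    then obtain \<xi>0 where \<xi>0: "\<zeta>0 \<in> topspace (ctop X)" "\<xi>0 \<in> W" "orbit X G \<zeta>0 = orbit X G \<xi>0" by blast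
    then have \<xi>0t: "\<xi>0 \<in> topspace (ctop X)" using openin_subset[OF W] by blast
    then obtain k0 where k0: "(\<zeta>0, k0) \<in> rdom X G" "\<xi>0 = ract X \<zeta>0 k0"
      using orbit_eq_iff[OF \<xi>0(1) \<xi>0t] \<xi>0(3) by blast
    have k0a: "k0 \<in> garr G" "csrc X \<zeta>0 = grng G k0" using k0(1) by (auto simp: rdom_def)
    obtain A where A: "openin (gtop G) A" "k0 \<in> A" "inj_on (grng G) A"
      using local_homeo_inj[OF rng_local_homeo[OF G] k0a(1)] by metis
    define \<kappa> where "\<kappa> = inv_into A (grng G)"
    have \<kappa>: "continuous_map (subtopology (unit_top G) (grng G ` A)) (gtop G) \<kappa>"
      using continuous_map_inv_into[OF local_homeo_imp_open_map[OF rng_local_homeo[OF G]] A(1,3)]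
      unfolding \<kappa>_def using continuous_map_into_fulltopology by blast
    have rA: "openin (unit_top G) (grng G ` A)"
      using local_homeo_imp_open_map[OF rng_local_homeo[OF G]] A(1) by (simp add: open_map_def)
    define Z where "Z = {\<zeta> \<in> topspace (ctop X). csrc X \<zeta> \<in> grng G ` A}"
    have Z: "openin (ctop X) Z"
      unfolding Z_def by (rule openin_continuous_map_preimage[OF csrc_continuous[OF R] rA])
    have cZ: "continuous_map (subtopology (ctop X) Z) (subtopology (unit_top G) (grng G ` A)) (csrc X)"
      unfolding continuous_map_in_subtopology[of _ "unit_top G"]
      using continuous_map_from_subtopology[OF csrc_continuous[OF R], of Z] by (auto simp: Z_def)
    have \<kappa>Z: "(\<zeta>, \<kappa> (csrc X \<zeta>)) \<in> rdom X G" if "\<zeta> \<in> Z" for \<zeta>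
    proof -
      have "\<kappa> (csrc X \<zeta>) \<in> A" "grng G (\<kappa> (csrc X \<zeta>)) = csrc X \<zeta>"
        using that unfolding \<kappa>_def Z_def by (auto intro: inv_into_into f_inv_into_f)
      then show ?thesis using that openin_subset[OF A(1)] by (auto simp: rdom_def Z_def)
    qed
    have "continuous_map (subtopology (ctop X) Z) (prod_topology (ctop X) (gtop G)) (\<lambda>\<zeta>. (\<zeta>, \<kappa> (csrc X \<zeta>)))"
      using continuous_map_compose[OF cZ \<kappa>]
      by (simp add: continuous_map_paired o_def continuous_map_from_subtopology)
    then have "continuous_map (subtopology (ctop X) Z)
        (subtopology (prod_topology (ctop X) (gtop G)) (rdom X G)) (\<lambda>\<zeta>. (\<zeta>, \<kappa> (csrc X \<zeta>)))"
      unfolding continuous_map_in_subtopology using \<kappa>Z by auto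
    from continuous_map_compose[OF this ract_continuous[OF R]]
    have c: "continuous_map (subtopology (ctop X) Z) (ctop X) (\<lambda>\<zeta>. ract X \<zeta> (\<kappa> (csrc X \<zeta>)))"
      by (simp add: o_def)
    define V where "V = {\<zeta> \<in> topspace (subtopology (ctop X) Z). ract X \<zeta> (\<kappa> (csrc X \<zeta>)) \<in> W}"
    have "openin (subtopology (ctop X) Z) V"
      unfolding V_def by (rule openin_continuous_map_preimage[OF c W])
    then have "openin (ctop X) V" using Z by (simp add: openin_open_subtopology)
    moreover have "\<kappa> (csrc X \<zeta>0) = k0"
      unfolding \<kappa>_def k0a(2) using A by simp
    then have "\<zeta>0 \<in> V" using k0 \<xi>0 A(2) by (auto simp: V_def Z_def k0a(2))
    moreover have "V \<subseteq> {\<zeta> \<in> topspace (ctop X). orbit X G \<zeta> \<in> orbit X G ` W}"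
    proof
      fix \<zeta> assume "\<zeta> \<in> V"
      then have \<zeta>: "\<zeta> \<in> topspace (ctop X)" "\<zeta> \<in> Z" "ract X \<zeta> (\<kappa> (csrc X \<zeta>)) \<in> W" by (auto simp: V_def)
      then show "\<zeta> \<in> {\<zeta> \<in> topspace (ctop X). orbit X G \<zeta> \<in> orbit X G ` W}"
        using orbit_ract[OF \<kappa>Z[OF \<zeta>(2)]] by (auto intro: image_eqI[where x = "ract X \<zeta> (\<kappa> (csrc X \<zeta>))"])
    qed
    ultimately show "\<exists>V. openin (ctop X) V \<and> \<zeta>0 \<in> V \<and>
        V \<subseteq> {\<zeta> \<in> topspace (ctop X). orbit X G \<zeta> \<in> orbit X G ` W}" by blast
  qed
  moreover have "orbit X G ` W \<subseteq> topspace (orbit_top X G)"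
    using quotient_imp_surjective_map[OF quotient_map_orbit] openin_subset[OF W] by blast
  ultimately show "openin (orbit_top X G) (orbit X G ` W)"
    using quotient_map_orbit unfolding quotient_map_def by blast
qed

text \<open>The pairs formed by \<xi> with \<open>g\<close> and with the unit
  \<open>csrc X \<xi>\<close> have the same image \<open>(\<xi>, \<xi>)\<close> under the injective
  map in \<open>basic_action\<close>.\<close>

lemma basic_free:
  assumes "basic_action X G" "(\<xi>, g) \<in> rdom X G" "ract X \<xi> g = \<xi>"
  shows "g = csrc X \<xi>"
proof -
  have \<xi>: "\<xi> \<in> topspace (ctop X)" using assms(2) by (simp add: rdom_def)
  have "inj_on (\<lambda>(\<xi>, g). (\<xi>, ract X \<xi> g)) (rdom X G)"
  proof -
    have "rdom X G \<subseteq> topspace (ctop X) \<times> garr G" by (auto simp: rdom_def)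
    then show ?thesis
      using assms(1) unfolding basic_action_def homeomorphic_eq_everything_map by (simp add: inf.absorb2)
  qed
  from inj_onD[OF this _ assms(2) rdom_unit[OF \<xi>]]
  show ?thesis using assms(3) ract_unit[OF R \<xi>] by simp
qed

text \<open>Since the units are open in an etale groupoid, the diagonal is open in
  \<open>X \<times>\<^bsub>X/G\<^esub> X\<close> for a basic action.\<close>
lemma slice_exists:
  assumes basic: "basic_action X G" and s: "local_homeo (ctop X) (unit_top G) (csrc X)"
    and \<xi>: "\<xi> \<in> topspace (ctop X)"
  obtains U where "openin (ctop X) U" "\<xi> \<in> U" "inj_on (csrc X) U" "inj_on (orbit X G) U"
proof -
  let ?D = "subtopology (prod_topology (ctop X) (gtop G)) (rdom X G)"
  let ?R = "{(\<xi>, \<xi>'). \<xi> \<in> topspace (ctop X) \<and> \<xi>' \<in> topspace (ctop X) \<and> orbit X G \<xi> = orbit X G \<xi>'}"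
  let ?E = "subtopology (prod_topology (ctop X) (ctop X)) ?R"
  let ?f = "\<lambda>(\<xi>, g). (\<xi>, ract X \<xi> g)"
  have f: "open_map ?D ?E ?f"
    using basic unfolding basic_action_def homeomorphic_eq_everything_map by blast
  have "openin (prod_topology (ctop X) (gtop G)) (topspace (ctop X) \<times> gunits G)"
    using openin_units[OF G] by (simp add: openin_prod_Times_iff)
  then have "openin ?D ((topspace (ctop X) \<times> gunits G) \<inter> rdom X G)"
    by (rule openin_subtopology_Int)
  then have "openin ?E (?f ` ((topspace (ctop X) \<times> gunits G) \<inter> rdom X G))"
    using f unfolding open_map_def by blast
  then obtain W where W: "openin (prod_topology (ctop X) (ctop X)) W"
    "?f ` ((topspace (ctop X) \<times> gunits G) \<inter> rdom X G) = W \<inter> ?R"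
    unfolding openin_subtopology by blast
  have "(\<xi>, \<xi>) \<in> ?f ` ((topspace (ctop X) \<times> gunits G) \<inter> rdom X G)"
    using \<xi> rdom_unit[OF \<xi>] csrc_unit[OF \<xi>] ract_unit[OF R \<xi>]
    by (intro image_eqI[of _ _ "(\<xi>, csrc X \<xi>)"]) auto
  then have "(\<xi>, \<xi>) \<in> W" unfolding W(2) by blast
  then obtain U1 U2 where U12: "openin (ctop X) U1" "openin (ctop X) U2" "\<xi> \<in> U1" "\<xi> \<in> U2" "U1 \<times> U2 \<subseteq> W"
    using W(1) unfolding openin_prod_topology_alt by meson
  obtain U3 where U3: "openin (ctop X) U3" "\<xi> \<in> U3" "inj_on (csrc X) U3"
    using local_homeo_inj[OF s \<xi>] by metis
  have "inj_on (orbit X G) (U1 \<inter> U2 \<inter> U3)"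
  proof (rule inj_onI)
    fix a b assume ab: "a \<in> U1 \<inter> U2 \<inter> U3" "b \<in> U1 \<inter> U2 \<inter> U3" "orbit X G a = orbit X G b"
    then have "(a, b) \<in> W \<inter> ?R" using U12 openin_subset[OF U12(1)] by auto
    then obtain g where g: "g \<in> gunits G" "(a, g) \<in> rdom X G" "b = ract X a g"
      unfolding W(2)[symmetric] by auto
    then have "g = csrc X a" by (simp add: rdom_def unit_rng[OF G])
    then show "a = b" using g ract_unit[OF R] by (simp add: rdom_def)
  qed
  moreover have "inj_on (csrc X) (U1 \<inter> U2 \<inter> U3)"
    using U3(3) by (rule inj_on_subset) blast
  ultimately show ?thesis
    using U12 U3 by (intro that[of "U1 \<inter> U2 \<inter> U3"]) (auto intro: openin_Int)
qed

end


section \<open>Composition of correspondences as a quotient\<close>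

context
  fixes G :: "'a groupoid" and X Y :: "'a corr"
  assumes G: "etale_groupoid G" and R: "right_action X G" and L: "left_action G Y"
begin

lemma cfib_translate:
  assumes "(\<xi>, \<eta>) \<in> cfib X Y" "g \<in> garr G" "grng G g = csrc X \<xi>"
  shows "(\<xi>, g) \<in> rdom X G" "(ginv G g, \<eta>) \<in> ldom G Y"
    "(ract X \<xi> g, lact Y (ginv G g) \<eta>) \<in> cfib X Y"
proof -
  show r: "(\<xi>, g) \<in> rdom X G" and l: "(ginv G g, \<eta>) \<in> ldom G Y"
    using assms by (auto simp: cfib_def rdom_def ldom_def inv_arr[OF G] inv_src[OF G])
  show "(ract X \<xi> g, lact Y (ginv G g) \<eta>) \<in> cfib X Y"
    using ract_topspace[OF R r] lact_topspace[OF L l] ract_src[OF R r] lact_rng[OF L l] assms(2)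
    by (simp add: cfib_def inv_rng[OF G])
qed

lemma cclass_translate_subset:
  assumes f: "(\<xi>, \<eta>) \<in> cfib X Y" and g: "g \<in> garr G" "grng G g = csrc X \<xi>"
  shows "cclass X G Y (ract X \<xi> g) (lact Y (ginv G g) \<eta>) \<subseteq> cclass X G Y \<xi> \<eta>"
proof
  note t = cfib_translate[OF assms]
  fix z assume "z \<in> cclass X G Y (ract X \<xi> g) (lact Y (ginv G g) \<eta>)"
  then obtain h where h: "h \<in> garr G" "grng G h = gsrc G g"
    "z = (ract X (ract X \<xi> g) h, lact Y (ginv G h) (lact Y (ginv G g) \<eta>))"
    unfolding cclass_def ract_src[OF R t(1)] by blast
  have c: "(g, h) \<in> gcomp G" "(ginv G h, ginv G g) \<in> gcomp G"
    using g h by (auto simp: gcomp_def inv_arr[OF G] inv_src[OF G] inv_rng[OF G])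
  have "z = (ract X \<xi> (gmul G g h), lact Y (ginv G (gmul G g h)) \<eta>)"
    using h(3) ract_mul[OF R t(1) c(1)] lact_mul[OF L c(2) t(2)] by (simp add: inv_mul[OF G c(1)])
  then show "z \<in> cclass X G Y \<xi> \<eta>"
    unfolding cclass_def using mul_arr[OF G c(1)] mul_rng[OF G c(1)] g by auto
qed

text \<open>The missing inclusion is the previous one applied to the translated pair and
  \<open>ginv G g\<close>, which undoes the translation.\<close>

lemma cclass_translate:
  assumes f: "(\<xi>, \<eta>) \<in> cfib X Y" and g: "g \<in> garr G" "grng G g = csrc X \<xi>"
  shows "cclass X G Y (ract X \<xi> g) (lact Y (ginv G g) \<eta>) = cclass X G Y \<xi> \<eta>"
proof
  note t = cfib_translate[OF assms]
  have gg: "ginv G (ginv G g) = g"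
    by (rule inv_unique[OF G, symmetric])
      (use g in \<open>simp_all add: inv_arr[OF G] inv_src[OF G] inv_rng[OF G] mul_inv_left[OF G]\<close>)
  have c: "(g, ginv G g) \<in> gcomp G" using g by (simp add: gcomp_def inv_arr[OF G] inv_rng[OF G])
  have "lact Y g (lact Y (ginv G g) \<eta>) = lact Y (crng Y \<eta>) \<eta>"
    using lact_mul[OF L c t(2)] g f by (simp add: mul_inv_right[OF G] cfib_def)
  also have "\<dots> = \<eta>" using lact_unit[OF L] f by (simp add: cfib_def)
  finally show "cclass X G Y \<xi> \<eta> \<subseteq> cclass X G Y (ract X \<xi> g) (lact Y (ginv G g) \<eta>)"
    using cclass_translate_subset[OF t(3) inv_arr[OF G g(1)]] ract_inv(2)[OF G R t(1)]
      ract_src[OF R t(1)] g by (simp add: gg inv_rng[OF G])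
qed (rule cclass_translate_subset[OF assms])

text \<open>The maps \<open>mu\<close> are continuous on spaces of classes; composing with this
  quotient map makes the product of a diagram jointly continuous in its two factors.\<close>

lemma quotient_map_cclass:
  "quotient_map (subtopology (prod_topology (ctop X) (ctop Y)) (cfib X Y)) (comp_top X G Y)
     (\<lambda>(\<xi>, \<eta>). cclass X G Y \<xi> \<eta>)"
proof -
  have top: "topspace (subtopology (prod_topology (ctop X) (ctop Y)) (cfib X Y)) = cfib X Y"
    by (auto simp: cfib_def)
  have "quotient_map (subtopology (prod_topology (ctop X) (ctop Y)) (cfib X Y))
     (quot_top (subtopology (prod_topology (ctop X) (ctop Y)) (cfib X Y))
       ((\<lambda>(\<xi>, \<eta>). cclass X G Y \<xi> \<eta>) ` topspace (subtopology (prod_topology (ctop X) (ctop Y)) (cfib X Y))))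
     (\<lambda>(\<xi>, \<eta>). cclass X G Y \<xi> \<eta>)"
  proof (rule quotient_map_quot_top; unfold top)
    fix z assume z: "z \<in> cfib X Y"
    obtain \<xi> \<eta> where z': "z = (\<xi>, \<eta>)" by (cases z)
    then have f: "(\<xi>, \<eta>) \<in> cfib X Y" using z by simp
    then have \<xi>: "\<xi> \<in> topspace (ctop X)" "\<eta> \<in> topspace (ctop Y)" "csrc X \<xi> = crng Y \<eta>"
      by (auto simp: cfib_def)
    have u: "csrc X \<xi> \<in> gunits G" by (rule csrc_unit[OF G R \<xi>(1)])
    \<comment> \<open>A unit is its own inverse, so translating by \<open>csrc X \<xi>\<close> fixes
      the pair and places it in its own class.\<close>
    have "ginv G (csrc X \<xi>) = csrc X \<xi>"
      by (rule inv_unique[OF G, symmetric])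
        (use u mul_unit_right[OF G units_arr[OF G u]] in
          \<open>simp_all add: units_arr[OF G] unit_rng[OF G] unit_src[OF G]\<close>)
    then have "z = (ract X \<xi> (csrc X \<xi>), lact Y (ginv G (csrc X \<xi>)) \<eta>)"
      using ract_unit[OF R \<xi>(1)] lact_unit[OF L \<xi>(2)] \<xi>(3) z' by simp
    then have "z \<in> cclass X G Y \<xi> \<eta>"
      unfolding cclass_def using u units_arr[OF G u] unit_rng[OF G u] by blast
    moreover have "cclass X G Y \<xi> \<eta> \<subseteq> cfib X Y"
      using cfib_translate(3)[OF f] by (auto simp: cclass_def)
    ultimately show "z \<in> (case z of (\<xi>, \<eta>) \<Rightarrow> cclass X G Y \<xi> \<eta>) \<and>
        (case z of (\<xi>, \<eta>) \<Rightarrow> cclass X G Y \<xi> \<eta>) \<subseteq> cfib X Y" by (simp add: z')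
    fix w assume "w \<in> (case z of (\<xi>, \<eta>) \<Rightarrow> cclass X G Y \<xi> \<eta>)"
    then obtain g where "g \<in> garr G" "grng G g = csrc X \<xi>" "w = (ract X \<xi> g, lact Y (ginv G g) \<eta>)"
      unfolding z' cclass_def by auto
    then show "(case w of (\<xi>, \<eta>) \<Rightarrow> cclass X G Y \<xi> \<eta>) = (case z of (\<xi>, \<eta>) \<Rightarrow> cclass X G Y \<xi> \<eta>)"
      using cclass_translate[OF f] by (simp add: z')
  qed
  then show ?thesis unfolding comp_top_def top .
qed

end

lemma Hausdorff_space_sum_topology:
  assumes "\<And>i. i \<in> I \<Longrightarrow> Hausdorff_space (X i)"
  shows "Hausdorff_space (sum_topology X I)"
  unfolding Hausdorff_space_def
proof (intro allI impI)
  fix p q assume pq: "p \<in> topspace (sum_topology X I) \<and> q \<in> topspace (sum_topology X I) \<and> p \<noteq> q"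
  obtain i a k b where p: "p = (i, a)" "q = (k, b)" by (cases p, cases q)
  then have t: "i \<in> I" "a \<in> topspace (X i)" "k \<in> I" "b \<in> topspace (X k)" using pq by auto
  have op: "openin (sum_topology X I) ({j} \<times> U)" if "j \<in> I" "openin (X j) U" for j U
  proof -
    have "{j} \<times> U = Pair j ` U" by auto
    then show ?thesis using open_map_component_injection[OF that(1), of X] that(2) by (simp add: open_map_def)
  qed
  show "\<exists>U V. openin (sum_topology X I) U \<and> openin (sum_topology X I) V \<and> p \<in> U \<and> q \<in> V \<and> disjnt U V"
  proof (cases "i = k")
    case True
    then obtain U V where "openin (X i) U" "openin (X i) V" "a \<in> U" "b \<in> V" "disjnt U V"
      using assms[OF t(1)] t pq p unfolding Hausdorff_space_def by metis
    then show ?thesis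
      using op[OF t(1)] True p by (intro exI[of _ "{i} \<times> U"] exI[of _ "{i} \<times> V"]) (auto simp: disjnt_iff)
  next
    case False
    then show ?thesis using op[OF t(1) openin_topspace] op[OF t(3) openin_topspace] t p
      by (intro exI[of _ "{i} \<times> topspace (X i)"] exI[of _ "{k} \<times> topspace (X k)"]) (auto simp: disjnt_iff)
  qed
qed

text \<open>Openness is stable under base change. It is used to see that the source anchor of a
  fibre product of two correspondences is open, so that density applies to triple products.\<close>

lemma open_map_fprod_snd:
  assumes s: "open_map A B s" and r: "continuous_map D B r"
  shows "open_map (fprod A s D (topspace D) r) D snd"
  unfolding open_map_def
proof (intro allI impI)
  fix W assume W: "openin (fprod A s D (topspace D) r) W"
  show "openin D (snd ` W)"
  proof (subst openin_subopen, intro ballI)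
    fix d assume "d \<in> snd ` W"
    then obtain a where ad: "(a, d) \<in> W" by force
    then have t: "a \<in> topspace A" "d \<in> topspace D" "s a = r d"
      using openin_subset[OF W] by (auto simp: topspace_fprod)
    obtain U V where UV: "openin A U" "openin D V" "a \<in> U" "d \<in> V"
      "\<And>a' d'. a' \<in> U \<Longrightarrow> d' \<in> V \<Longrightarrow> d' \<in> topspace D \<Longrightarrow> s a' = r d' \<Longrightarrow> (a', d') \<in> W"
      using openin_fprod_basis[OF W ad] by metis
    have "openin D {x \<in> topspace D. r x \<in> s ` U}"
      using s UV(1) by (intro openin_continuous_map_preimage[OF r]) (simp add: open_map_def)
    then have "openin D (V \<inter> {x \<in> topspace D. r x \<in> s ` U})" using UV(2) by blast
    moreover have "d \<in> V \<inter> {x \<in> topspace D. r x \<in> s ` U}"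
      using UV(3,4) t(2) by (auto simp flip: t(3))
    moreover have "V \<inter> {x \<in> topspace D. r x \<in> s ` U} \<subseteq> snd ` W"
    proof
      fix x assume "x \<in> V \<inter> {x \<in> topspace D. r x \<in> s ` U}"
      then obtain a' where "a' \<in> U" "s a' = r x" "x \<in> V" "x \<in> topspace D" by auto
      then have "(a', x) \<in> W" by (intro UV(5))
      then show "x \<in> snd ` W" by force
    qed
    ultimately show "\<exists>Z. openin D Z \<and> d \<in> Z \<and> Z \<subseteq> snd ` W" by blast
  qed
qed

text \<open>Where \<open>s\<close> is injective on \<open>U\<close>, a point of the fibre product
  over \<open>U\<close> is determined by its second component: the first is
  \<open>\<sigma> (q y)\<close>. There \<open>f\<close> becomes a bounded function of
  \<open>y\<close> on an open part of \<open>T\<close>, which extends by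
  \<open>extends_along_open\<close>; the result is pulled back along \<open>snd\<close>.\<close>

lemma (in relative_beta) extends_along_fprod:
  fixes f :: "'c \<times> 'y \<Rightarrow> complex"
  assumes s: "local_homeo A S0 s" and S': "openin \<beta> S'" and S: "S = {y \<in> topspace T. \<iota> y \<in> S'}"
    and \<rho>: "continuous_map (subtopology \<beta> S') S0 \<rho>" and q: "\<And>y. y \<in> S \<Longrightarrow> q y = \<rho> (\<iota> y)"
    and f: "continuous_map (fprod A s T S q) euclidean f"
    and M: "\<And>z. z \<in> topspace (fprod A s T S q) \<Longrightarrow> norm (f z) \<le> M"
  shows "extends_along (fprod A s T S q) (fprod A s \<beta> S' \<rho>) (\<lambda>(a, y). (a, \<iota> y)) euclidean f"
proof (rule extends_along_local)
  show "dense_map (fprod A s T S q) (fprod A s \<beta> S' \<rho>) (\<lambda>(a, y). (a, \<iota> y))"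
    using dense_map_fprod[OF dense_iota local_homeo_imp_open_map[OF s] S' S \<rho>] q by blast
  let ?D = "fprod A s T S q" and ?E = "fprod A s \<beta> S' \<rho>" and ?j = "\<lambda>(a, y). (a, \<iota> y)"
  fix e assume e: "e \<in> topspace ?E"
  obtain a b where ab: "e = (a, b)" by (cases e)
  then have a: "a \<in> topspace A" using e by (simp add: topspace_fprod)
  obtain U where U: "openin A U" "a \<in> U" "inj_on s U"
    using local_homeo_inj[OF s a] by metis
  have sU: "openin S0 (s ` U)"
    using local_homeo_imp_open_map[OF s] U(1) by (simp add: open_map_def)
  define N where "N = {z \<in> topspace ?E. fst z \<in> U}"
  have N: "openin ?E N"
    unfolding N_def by (rule openin_continuous_map_preimage[OF continuous_map_fprod_fst U(1)])
  have eN: "e \<in> N" using e U(2) by (simp add: N_def ab)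
  define \<sigma> where "\<sigma> = inv_into U s"
  have \<sigma>: "continuous_map (subtopology S0 (s ` U)) A \<sigma>"
    using continuous_map_inv_into[OF local_homeo_imp_open_map[OF s] U(1,3)]
      continuous_map_into_fulltopology unfolding \<sigma>_def by blast
  have \<sigma>s: "\<sigma> (s c) = c" if "c \<in> U" for c using that U(3) by (simp add: \<sigma>_def)
  define V where "V = {b \<in> topspace (subtopology \<beta> S'). \<rho> b \<in> s ` U}"
  have V: "openin \<beta> V"
    using openin_continuous_map_preimage[OF \<rho> sU] S' by (simp add: openin_open_subtopology V_def)
  define Y where "Y = {y \<in> topspace T. \<iota> y \<in> V}"
  have Y: "y \<in> topspace T \<and> y \<in> S \<and> q y \<in> s ` U" if "y \<in> Y" for y
    using that q[of y] by (auto simp: Y_def V_def S)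
  have cq: "continuous_map (subtopology T Y) (subtopology S0 (s ` U)) q"
  proof (rule continuous_map_eq)
    have "continuous_map (subtopology T Y) (subtopology \<beta> S') \<iota>"
      unfolding continuous_map_in_subtopology
      using continuous_map_from_subtopology[OF continuous_map_iota] by (auto simp: Y_def V_def)
    from continuous_map_compose[OF this \<rho>]
    show "continuous_map (subtopology T Y) (subtopology S0 (s ` U)) (\<lambda>y. \<rho> (\<iota> y))"
      unfolding continuous_map_in_subtopology by (auto simp: o_def Y_def V_def)
    show "\<rho> (\<iota> y) = q y" if "y \<in> topspace (subtopology T Y)" for y
      using that q[of y] Y[of y] by simp
  qed
  have sec: "s (\<sigma> (q y)) = q y" "\<sigma> (q y) \<in> U" if "y \<in> Y" for y
    using Y[OF that] unfolding \<sigma>_def by (auto intro: f_inv_into_f inv_into_into)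
  have c1: "continuous_map (subtopology T Y) ?D (\<lambda>y. (\<sigma> (q y), y))"
  proof (rule continuous_map_into_fprod)
    show "continuous_map (subtopology T Y) A (\<lambda>y. \<sigma> (q y))"
      using continuous_map_compose[OF cq \<sigma>] by (simp add: o_def)
    show "continuous_map (subtopology T Y) T (\<lambda>y. y)"
      by (simp add: continuous_map_from_subtopology)
  qed (use sec Y in auto)
  have c2: "continuous_map (subtopology T Y) euclidean (\<lambda>y. f (\<sigma> (q y), y))"
    using continuous_map_compose[OF c1 f] by (simp add: o_def)
  have "extends_along (subtopology T {y \<in> topspace T. \<iota> y \<in> V}) (subtopology \<beta> V) \<iota> euclidean
      (\<lambda>y. f (\<sigma> (q y), y))"
  proof (rule extends_along_open[OF V])
    show "norm (f (\<sigma> (q y), y)) \<le> M" if "y \<in> topspace T" "\<iota> y \<in> V" for y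
    proof (rule M)
      have "y \<in> Y" using that by (simp add: Y_def)
      then have "(\<sigma> (q y), y) \<in> topspace ?D"
        using funcset_mem[OF continuous_map_funspace[OF c1]] Y by auto
      then show "(\<sigma> (q y), y) \<in> topspace ?D" .
    qed
  qed (use c2 in \<open>simp add: Y_def\<close>)
  then obtain g where g: "continuous_map (subtopology \<beta> V) euclidean g"
    "\<And>y. y \<in> Y \<Longrightarrow> g (\<iota> y) = f (\<sigma> (q y), y)"
    unfolding extends_along_def Y_def by auto
  have "extends_along (subtopology ?D {d \<in> topspace ?D. ?j d \<in> N}) (subtopology ?E N) ?j euclidean f"
  proof (rule extends_alongI)
    have "continuous_map (subtopology ?E N) (subtopology \<beta> V) snd"
    proof -
      have "continuous_map (subtopology ?E N) \<beta> snd"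
        using continuous_map_from_subtopology[OF continuous_map_fprod_snd]
          continuous_map_into_fulltopology by blast
      moreover have "snd z \<in> V" if "z \<in> N" for z
        using that by (auto simp: N_def V_def topspace_fprod intro: image_eqI[where x = "fst z"])
      ultimately show ?thesis unfolding continuous_map_in_subtopology by auto
    qed
    from continuous_map_compose[OF this g(1)]
    show "continuous_map (subtopology ?E N) euclidean (\<lambda>z. g (snd z))" by (simp add: o_def)
    fix d assume "d \<in> topspace (subtopology ?D {d \<in> topspace ?D. ?j d \<in> N})"
    then obtain c y where d: "d = (c, y)" "d \<in> topspace ?D" "(c, \<iota> y) \<in> N" by (cases d) auto
    then have cy: "c \<in> U" "y \<in> topspace T" "y \<in> S" "s c = q y" "\<iota> y \<in> topspace \<beta>"
      by (auto simp: N_def topspace_fprod)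
    have "\<rho> (\<iota> y) \<in> s ` U" using cy(1) by (simp flip: q[OF cy(3)] cy(4))
    then have "y \<in> Y" using cy by (simp add: Y_def V_def S)
    then show "g (snd (?j d)) = f d"
      using g(2) \<sigma>s[OF cy(1)] by (simp add: d(1) cy(4)[symmetric])
  qed
  then show "\<exists>N. openin ?E N \<and> e \<in> N \<and>
      extends_along (subtopology ?D {d \<in> topspace ?D. ?j d \<in> N}) (subtopology ?E N) ?j euclidean f"
    using N eN by blast
qed (rule Hausdorff_space_euclidean)

section \<open>Diagrams and their actions\<close>

locale F_diagram =
  fixes C :: "('o, 'm) category"
    and Gs :: "'o \<Rightarrow> 'a groupoid"
    and Xs :: "'m \<Rightarrow> 'a corr"
    and mu :: "'m \<Rightarrow> 'm \<Rightarrow> ('a \<times> 'a) set \<Rightarrow> 'a"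
  assumes diag: "is_diagram C Gs Xs mu"
begin

abbreviation "dot \<equiv> dotp C Gs Xs mu"

lemma cat: "is_category C"
  using diag unfolding is_diagram_def by (elim conjE)

lemma dom_obj: "g \<in> carr C \<Longrightarrow> cdom C g \<in> cobj C"
  and cod_obj: "g \<in> carr C \<Longrightarrow> ccod C g \<in> cobj C"
  and id_arr: "x \<in> cobj C \<Longrightarrow> cid C x \<in> carr C"
  and id_dom: "x \<in> cobj C \<Longrightarrow> cdom C (cid C x) = x"
  and id_cod: "x \<in> cobj C \<Longrightarrow> ccod C (cid C x) = x"
  and cmp_arr: "g \<in> carr C \<Longrightarrow> h \<in> carr C \<Longrightarrow> cdom C g = ccod C h \<Longrightarrow> cmp C g h \<in> carr C"
  and cmp_dom: "g \<in> carr C \<Longrightarrow> h \<in> carr C \<Longrightarrow> cdom C g = ccod C h \<Longrightarrow> cdom C (cmp C g h) = cdom C h"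
  and cmp_id_right: "g \<in> carr C \<Longrightarrow> cmp C g (cid C (cdom C g)) = g"
  using cat unfolding is_category_def by (elim conjE; blast)+

lemma etale: "x \<in> cobj C \<Longrightarrow> etale_groupoid (Gs x)"
  using diag unfolding is_diagram_def by (elim conjE) blast

lemma corr: "g \<in> carr C \<Longrightarrow> is_corr (Gs (ccod C g)) (Gs (cdom C g)) (Xs g)"
  using diag unfolding is_diagram_def by (elim conjE) blast

lemma corr_left: "g \<in> carr C \<Longrightarrow> left_action (Gs (ccod C g)) (Xs g)"
  and corr_right: "g \<in> carr C \<Longrightarrow> right_action (Xs g) (Gs (cdom C g))"
  and corr_local_homeo: "g \<in> carr C \<Longrightarrow> local_homeo (ctop (Xs g)) (unit_top (Gs (cdom C g))) (csrc (Xs g))"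
  and corr_basic: "g \<in> carr C \<Longrightarrow> basic_action (Xs g) (Gs (cdom C g))"
  using corr unfolding is_corr_def by blast+

lemma id_corr_eq: "x \<in> cobj C \<Longrightarrow> Xs (cid C x) = id_corr (Gs x)"
  using diag unfolding is_diagram_def by (elim conjE) blast

lemma id_corr_simps:
  assumes "x \<in> cobj C"
  shows "ctop (Xs (cid C x)) = gtop (Gs x)" "crng (Xs (cid C x)) = grng (Gs x)"
    "csrc (Xs (cid C x)) = gsrc (Gs x)" "lact (Xs (cid C x)) = gmul (Gs x)"
  by (simp_all add: id_corr_eq[OF assms] id_corr_def)

lemma mu_homeo:
  assumes "g \<in> carr C" "h \<in> carr C" "cdom C g = ccod C h"
  shows "homeomorphic_map (comp_top (Xs g) (Gs (cdom C g)) (Xs h)) (ctop (Xs (cmp C g h))) (mu g h)"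
  using diag assms unfolding is_diagram_def by (elim conjE) blast

lemma continuous_map_dot:
  assumes "g \<in> carr C" "h \<in> carr C" "cdom C g = ccod C h"
  shows "continuous_map (subtopology (prod_topology (ctop (Xs g)) (ctop (Xs h))) (cfib (Xs g) (Xs h)))
     (ctop (Xs (cmp C g h))) (\<lambda>(\<xi>, \<eta>). dot g h \<xi> \<eta>)"
proof -
  have L: "left_action (Gs (cdom C g)) (Xs h)" using corr_left[OF assms(2)] assms(3) by simp
  have "continuous_map (subtopology (prod_topology (ctop (Xs g)) (ctop (Xs h))) (cfib (Xs g) (Xs h)))
     (comp_top (Xs g) (Gs (cdom C g)) (Xs h)) (\<lambda>(\<xi>, \<eta>). cclass (Xs g) (Gs (cdom C g)) (Xs h) \<xi> \<eta>)"
    by (rule quotient_imp_continuous_map[OF quotient_map_cclass[OF etale[OF dom_obj[OF assms(1)]]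
            corr_right[OF assms(1)] L]])
  from continuous_map_compose[OF this homeomorphic_imp_continuous_map[OF mu_homeo[OF assms]]]
  show ?thesis by (simp add: o_def dotp_def case_prod_unfold)
qed

lemma dot_topspace:
  assumes "g \<in> carr C" "h \<in> carr C" "cdom C g = ccod C h" "(\<xi>, \<eta>) \<in> cfib (Xs g) (Xs h)"
  shows "dot g h \<xi> \<eta> \<in> topspace (ctop (Xs (cmp C g h)))"
proof -
  have "(\<xi>, \<eta>) \<in> topspace (subtopology (prod_topology (ctop (Xs g)) (ctop (Xs h))) (cfib (Xs g) (Xs h)))"
    using assms(4) by (auto simp: cfib_def)
  from funcset_mem[OF continuous_map_funspace[OF continuous_map_dot[OF assms(1-3)]] this]
  show ?thesis by simp
qed

lemma dot_csrc:
  assumes "g \<in> carr C" "h \<in> carr C" "cdom C g = ccod C h" "(\<xi>, \<eta>) \<in> cfib (Xs g) (Xs h)"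
  shows "csrc (Xs (cmp C g h)) (dot g h \<xi> \<eta>) = csrc (Xs h) \<eta>"
proof -
  have "\<forall>(\<xi>, \<eta>)\<in>cfib (Xs g) (Xs h).
           crng (Xs (cmp C g h)) (dotp C Gs Xs mu g h \<xi> \<eta>) = crng (Xs g) \<xi> \<and>
           csrc (Xs (cmp C g h)) (dotp C Gs Xs mu g h \<xi> \<eta>) = csrc (Xs h) \<eta> \<and>
           (\<forall>k. (k, \<xi>) \<in> ldom (Gs (ccod C g)) (Xs g) \<longrightarrow>
                dotp C Gs Xs mu g h (lact (Xs g) k \<xi>) \<eta> =
                lact (Xs (cmp C g h)) k (dotp C Gs Xs mu g h \<xi> \<eta>)) \<and>
           (\<forall>k. (\<eta>, k) \<in> rdom (Xs h) (Gs (cdom C h)) \<longrightarrow>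
                dotp C Gs Xs mu g h \<xi> (ract (Xs h) \<eta> k) =
                ract (Xs (cmp C g h)) (dotp C Gs Xs mu g h \<xi> \<eta>) k)"
    using diag assms(1-3) unfolding is_diagram_def by (elim conjE) blast
  from bspec[OF this assms(4)]
  show ?thesis by auto
qed

lemma dot_id_left:
  assumes "g \<in> carr C" "(k, \<xi>) \<in> cfib (Xs (cid C (ccod C g))) (Xs g)"
  shows "dot (cid C (ccod C g)) g k \<xi> = lact (Xs g) k \<xi>"
proof -
  have "\<forall>(\<gamma>, \<xi>)\<in>cfib (Xs (cid C (ccod C g))) (Xs g).
        dotp C Gs Xs mu (cid C (ccod C g)) g \<gamma> \<xi> = lact (Xs g) \<gamma> \<xi>"
    using diag assms(1) unfolding is_diagram_def by (elim conjE) blast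
  from bspec[OF this assms(2)] show ?thesis by simp
qed

lemma dot_id_right:
  assumes "g \<in> carr C" "(\<xi>, k) \<in> cfib (Xs g) (Xs (cid C (cdom C g)))"
  shows "dot g (cid C (cdom C g)) \<xi> k = ract (Xs g) \<xi> k"
proof -
  have "\<forall>(\<xi>, \<gamma>)\<in>cfib (Xs g) (Xs (cid C (cdom C g))).
        dotp C Gs Xs mu g (cid C (cdom C g)) \<xi> \<gamma> = ract (Xs g) \<xi> \<gamma>"
    using diag assms(1) unfolding is_diagram_def by (elim conjE) blast
  from bspec[OF this assms(2)] show ?thesis by simp
qed

lemma csrc_unit_top: "g \<in> carr C \<Longrightarrow> continuous_map (ctop (Xs g)) (unit_top (Gs (cdom C g))) (csrc (Xs g))"
  by (rule csrc_continuous[OF corr_right])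

lemma crng_unit_top: "g \<in> carr C \<Longrightarrow> continuous_map (ctop (Xs g)) (unit_top (Gs (ccod C g))) (crng (Xs g))"
  by (rule crng_continuous[OF corr_left])

lemma csrc_open: "g \<in> carr C \<Longrightarrow> open_map (ctop (Xs g)) (unit_top (Gs (cdom C g))) (csrc (Xs g))"
  by (rule local_homeo_imp_open_map[OF corr_local_homeo])

end

abbreviation aprod ::
    "('o, 'm) category \<Rightarrow> ('m \<Rightarrow> 'a corr) \<Rightarrow> 'y topology \<Rightarrow> ('o \<Rightarrow> 'y set) \<Rightarrow> ('y \<Rightarrow> 'a) \<Rightarrow> 'm \<Rightarrow> ('a \<times> 'y) topology"
  where "aprod C Xs T P ra g \<equiv> fprod (ctop (Xs g)) (csrc (Xs g)) T (P (cdom C g)) ra"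

lemma aprod_eq_subtopology:
  "aprod C Xs T P ra g = subtopology (prod_topology (ctop (Xs g)) T) (adom C Xs P ra g)"
  by (simp add: fprod_def adom_def)

locale F_space = F_diagram C Gs Xs mu
  for C :: "('o, 'm) category" and Gs :: "'o \<Rightarrow> 'a groupoid" and Xs :: "'m \<Rightarrow> 'a corr"
    and mu :: "'m \<Rightarrow> 'm \<Rightarrow> ('a \<times> 'a) set \<Rightarrow> 'a" +
  fixes T :: "'y topology" and P :: "'o \<Rightarrow> 'y set" and ra :: "'y \<Rightarrow> 'a"
    and act :: "'m \<Rightarrow> 'a \<Rightarrow> 'y \<Rightarrow> 'y"
  assumes F: "F_action C Gs Xs mu T P ra act"
begin

lemmas F_parts = F[unfolded F_action_def]
lemmas F_act = F_parts[THEN conjunct2, THEN conjunct2, THEN conjunct2, THEN conjunct2, THEN conjunct1]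

lemma P_open: "x \<in> cobj C \<Longrightarrow> openin T (P x)"
  and P_closed: "x \<in> cobj C \<Longrightarrow> closedin T (P x)"
  using F_parts[THEN conjunct1] by blast+

lemma P_disjoint: "x \<in> cobj C \<Longrightarrow> x' \<in> cobj C \<Longrightarrow> x \<noteq> x' \<Longrightarrow> P x \<inter> P x' = {}"
  using F_parts[THEN conjunct2, THEN conjunct1] by blast

lemma P_union: "(\<Union>x\<in>cobj C. P x) = topspace T"
  using F_parts[THEN conjunct2, THEN conjunct2, THEN conjunct1] .

lemma ra_continuous: "x \<in> cobj C \<Longrightarrow> continuous_map (subtopology T (P x)) (unit_top (Gs x)) ra"
  using F_parts[THEN conjunct2, THEN conjunct2, THEN conjunct2, THEN conjunct1] by blast

lemmas act_assoc = F_parts[THEN conjunct2, THEN conjunct2, THEN conjunct2, THEN conjunct2, THEN conjunct2,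
    THEN conjunct1, rule_format]
lemmas act_eqD = F_parts[THEN conjunct2, THEN conjunct2, THEN conjunct2, THEN conjunct2, THEN conjunct2,
    THEN conjunct2, rule_format]

lemma
  assumes "g \<in> carr C"
  shows act_continuous: "continuous_map (aprod C Xs T P ra g) (subtopology T (P (ccod C g))) (\<lambda>(\<gamma>, y). act g \<gamma> y)"
    and act_open: "open_map (aprod C Xs T P ra g) (subtopology T (P (ccod C g))) (\<lambda>(\<gamma>, y). act g \<gamma> y)"
    and act_surj: "(\<lambda>(\<gamma>, y). act g \<gamma> y) ` adom C Xs P ra g = P (ccod C g)"
  using bspec[OF F_act assms] unfolding aprod_eq_subtopology by simp_all

lemma act_anchor:
  assumes "g \<in> carr C" "(\<gamma>, y) \<in> adom C Xs P ra g" shows "ra (act g \<gamma> y) = crng (Xs g) \<gamma>"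
  using bspec[OF bspec[OF F_act assms(1), THEN conjunct2, THEN conjunct2, THEN conjunct2] assms(2)] by simp

lemma P_subset: "x \<in> cobj C \<Longrightarrow> P x \<subseteq> topspace T"
  using P_union by blast

lemma P_unique: "x \<in> cobj C \<Longrightarrow> x' \<in> cobj C \<Longrightarrow> y \<in> P x \<Longrightarrow> y \<in> P x' \<Longrightarrow> x = x'"
  using P_disjoint by blast

lemma topspace_aprod: "g \<in> carr C \<Longrightarrow> topspace (aprod C Xs T P ra g) = adom C Xs P ra g"
  using P_subset[OF dom_obj] by (auto simp: topspace_fprod adom_def)

lemma act_in_P: "g \<in> carr C \<Longrightarrow> (\<gamma>, y) \<in> adom C Xs P ra g \<Longrightarrow> act g \<gamma> y \<in> P (ccod C g)"
  using act_surj by blast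

text \<open>The unit law is not an axiom of an action but follows from surjectivity of the action of
  the identity arrow: write \<open>y\<close> as \<open>\<eta> z\<close>, so that the anchor of
  \<open>y\<close> is the range of \<eta>, and absorb this unit into \<eta>.\<close>

lemma act_unit:
  assumes x: "x \<in> cobj C" and y: "y \<in> P x"
  shows "act (cid C x) (ra y) y = y"
proof -
  let ?e = "cid C x"
  note e = id_arr[OF x] id_dom[OF x] id_cod[OF x]
  note s = id_corr_simps[OF x]
  have "y \<in> (\<lambda>(\<gamma>, y). act ?e \<gamma> y) ` adom C Xs P ra ?e" using act_surj[OF e(1)] y e(3) by simp
  then obtain \<eta> z where \<eta>: "(\<eta>, z) \<in> adom C Xs P ra ?e" "y = act ?e \<eta> z" by auto
  then have \<eta>a: "\<eta> \<in> garr (Gs x)" by (simp add: adom_def s)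
  have r: "ra y = grng (Gs x) \<eta>" using act_anchor[OF e(1) \<eta>(1)] \<eta>(2) s by simp
  have f: "(ra y, \<eta>) \<in> cfib (Xs ?e) (Xs ?e)"
    using \<eta>a rng_unit[OF etale[OF x]] unit_src[OF etale[OF x]] units_arr[OF etale[OF x]]
    by (simp add: cfib_def s r)
  have "act ?e (ra y) y = act ?e (dot ?e ?e (ra y) \<eta>) z"
    using act_assoc[OF e(1) e(1) _ f \<eta>(1)] e cmp_id_right[OF e(1)] \<eta>(2) by simp
  also have "dot ?e ?e (ra y) \<eta> = \<eta>"
    using dot_id_left[OF e(1), of "ra y" \<eta>] f e(3) mul_unit_left[OF etale[OF x] \<eta>a] by (simp add: s r)
  finally show ?thesis using \<eta>(2) by simp
qed

text \<open>Cancellation gives \<open>\<gamma>' = \<gamma> \<eta>\<close>. Both lie in one orbit and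
  in \<open>U\<close>, hence coincide; freeness makes \<eta> a unit, and units act
  trivially.\<close>

lemma act_inj_slice:
  assumes g: "g \<in> carr C" and U: "inj_on (orbit (Xs g) (Gs (cdom C g))) U"
  shows "inj_on (\<lambda>(\<gamma>, y). act g \<gamma> y) {z \<in> adom C Xs P ra g. fst z \<in> U}"
proof (rule inj_onI, clarsimp)
  fix \<gamma> y \<gamma>' y'
  assume d: "(\<gamma>, y) \<in> adom C Xs P ra g" "(\<gamma>', y') \<in> adom C Xs P ra g" "\<gamma> \<in> U" "\<gamma>' \<in> U"
    and eq: "act g \<gamma> y = act g \<gamma>' y'"
  let ?x = "cdom C g"
  note G = etale[OF dom_obj[OF g]] and R = corr_right[OF g]
  obtain \<eta> where \<eta>: "\<eta> \<in> garr (Gs ?x)" "grng (Gs ?x) \<eta> = csrc (Xs g) \<gamma>" "gsrc (Gs ?x) \<eta> = ra y'"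
    "\<gamma>' = ract (Xs g) \<gamma> \<eta>" "y = act (cid C ?x) \<eta> y'"
    using act_eqD[OF g d(1,2) eq] by blast
  have r: "(\<gamma>, \<eta>) \<in> rdom (Xs g) (Gs ?x)" using d(1) \<eta> by (simp add: rdom_def adom_def)
  have "\<gamma>' = \<gamma>" using orbit_ract[OF G R r] \<eta>(4) inj_onD[OF U] d(3,4) by metis
  then have "\<eta> = csrc (Xs g) \<gamma>" using basic_free[OF G R corr_basic[OF g] r] \<eta>(4) by simp
  moreover have "csrc (Xs g) \<gamma> = ra y'" using d(2) \<open>\<gamma>' = \<gamma>\<close> by (simp add: adom_def)
  moreover have "y' \<in> P ?x" using d(2) by (simp add: adom_def)
  ultimately have "y = y'" using \<eta>(5) act_unit[OF dom_obj[OF g]] by simp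
  then show "\<gamma> = \<gamma>' \<and> y = y'" using \<open>\<gamma>' = \<gamma>\<close> by simp
qed

lemma anchor_sum_eq: "x \<in> cobj C \<Longrightarrow> y \<in> P x \<Longrightarrow> anchor_sum C P ra y = (x, ra y)"
  unfolding anchor_sum_def using P_unique by (auto intro: the_equality)

lemma continuous_map_anchor_sum: "continuous_map T (unit_sum C Gs) (anchor_sum C P ra)"
proof (rule continuous_map_locally)
  fix y assume "y \<in> topspace T"
  then obtain x where x: "x \<in> cobj C" "y \<in> P x" using P_union by blast
  have "continuous_map (subtopology T (P x)) (unit_sum C Gs) (\<lambda>y. (x, ra y))"
    unfolding unit_sum_def
    using continuous_map_compose[OF ra_continuous[OF x(1)] continuous_map_component_injection[OF x(1), of "\<lambda>x. unit_top (Gs x)"]]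
    by (simp add: o_def)
  then have "continuous_map (subtopology T (P x)) (unit_sum C Gs) (anchor_sum C P ra)"
    by (rule continuous_map_eq) (use anchor_sum_eq[OF x(1)] in auto)
  then show "\<exists>N. openin T N \<and> y \<in> N \<and> continuous_map (subtopology T N) (unit_sum C Gs) (anchor_sum C P ra)"
    using P_open x by blast
qed

end

section \<open>Extending the action\<close>

text \<open>A compact neighbourhood of \<open>crng X \<xi>\<close> in the unit space of
  \<open>H\<close> is pulled back along the induced anchor on \<open>X/G\<close>. Properness keeps
  it compact, and openness of the orbit map keeps it a neighbourhood.\<close>

lemma locally_compact_orbit_top:
  assumes X: "is_corr H G X" and G: "etale_groupoid G" and proper: "proper_corr H G X" and H: "lc_groupoid H"
  shows "locally_compact_space (orbit_top X G)"
  unfolding locally_compact_space_def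
proof
  have R: "right_action X G" and L: "left_action H X" using X by (auto simp: is_corr_def)
  fix t assume "t \<in> topspace (orbit_top X G)"
  then obtain \<xi> where \<xi>: "\<xi> \<in> topspace (ctop X)" "t = orbit X G \<xi>"
    using quotient_imp_surjective_map[OF quotient_map_orbit[OF G R]] by blast
  have "crng X \<xi> \<in> topspace (unit_top H)"
    using funcset_mem[OF continuous_map_funspace[OF crng_continuous[OF L]] \<xi>(1)] .
  then obtain U K where UK: "openin (unit_top H) U" "compactin (unit_top H) K" "crng X \<xi> \<in> U" "U \<subseteq> K"
    using H unfolding lc_groupoid_def locally_compact_space_def by meson
  let ?V = "{\<zeta> \<in> topspace (ctop X). crng X \<zeta> \<in> U}"
  have "openin (orbit_top X G) (orbit X G ` ?V)"
    using open_map_orbit[OF G R] openin_continuous_map_preimage[OF crng_continuous[OF L] UK(1)]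
    by (simp add: open_map_def)
  moreover have "compactin (orbit_top X G) {orbit X G \<xi> | \<xi>. \<xi> \<in> topspace (ctop X) \<and> crng X \<xi> \<in> K}"
    using proper UK(2) unfolding proper_corr_def by blast
  moreover have "t \<in> orbit X G ` ?V" using \<xi> UK(3) by blast
  moreover have "orbit X G ` ?V \<subseteq> {orbit X G \<xi> | \<xi>. \<xi> \<in> topspace (ctop X) \<and> crng X \<xi> \<in> K}"
    using UK(4) by blast
  ultimately show "\<exists>U K. openin (orbit_top X G) U \<and> compactin (orbit_top X G) K \<and> t \<in> U \<and> U \<subseteq> K"
    by blast
qed

locale F_beta = F_space C Gs Xs mu T P ra act
  for C :: "('o, 'm) category" and Gs :: "'o \<Rightarrow> 'a groupoid" and Xs :: "'m \<Rightarrow> 'a corr"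
    and mu :: "'m \<Rightarrow> 'm \<Rightarrow> ('a \<times> 'a) set \<Rightarrow> 'a"
    and T :: "'y topology" and P :: "'o \<Rightarrow> 'y set" and ra :: "'y \<Rightarrow> 'a"
    and act :: "'m \<Rightarrow> 'a \<Rightarrow> 'y \<Rightarrow> 'y" +
  assumes lc_groupoids: "x \<in> cobj C \<Longrightarrow> lc_groupoid (Gs x)"
    and proper: "g \<in> carr C \<Longrightarrow> proper_corr (Gs (ccod C g)) (Gs (cdom C g)) (Xs g)"
    and lc_corrs: "g \<in> carr C \<Longrightarrow> lc_corr (Gs (ccod C g)) (Gs (cdom C g)) (Xs g)"
begin

sublocale relative_beta T "unit_sum C Gs" "anchor_sum C P ra"
proof
  show "continuous_map T (unit_sum C Gs) (anchor_sum C P ra)" by (rule continuous_map_anchor_sum)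
  show "locally_compact_space (unit_sum C Gs)"
    unfolding unit_sum_def locally_compact_space_sum_topology
    using lc_groupoids by (auto simp: lc_groupoid_def)
  show "Hausdorff_space (unit_sum C Gs)"
    unfolding unit_sum_def using lc_groupoids by (intro Hausdorff_space_sum_topology) (auto simp: lc_groupoid_def)
qed

lemma continuous_map_unit_injection:
  "x \<in> cobj C \<Longrightarrow> continuous_map (unit_top (Gs x)) (unit_sum C Gs) (Pair x)"
  unfolding unit_sum_def
  using continuous_map_component_injection[of x "cobj C" "\<lambda>x. unit_top (Gs x)"] by simp

text \<open>The extended anchor map. It takes values in a disjoint union, so its first component
  yields the partition \<open>P'\<close> and its second the anchor \<open>ra'\<close>;
  \<open>someI_ex\<close> applies because \<open>extends_along_anchor\<close> provides an
  extension.\<close>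

definition \<rho> :: "(('y \<Rightarrow> complex) \<Rightarrow> complex) \<Rightarrow> 'o \<times> 'a" where
  "\<rho> = (SOME g. continuous_map \<beta> (unit_sum C Gs) g \<and> (\<forall>y\<in>topspace T. g (\<iota> y) = anchor_sum C P ra y))"

lemma rho_continuous: "continuous_map \<beta> (unit_sum C Gs) \<rho>"
  and rho_iota: "y \<in> topspace T \<Longrightarrow> \<rho> (\<iota> y) = anchor_sum C P ra y"
  using someI_ex[OF extends_along_anchor[unfolded extends_along_def]] unfolding \<rho>_def by auto

definition P' :: "'o \<Rightarrow> (('y \<Rightarrow> complex) \<Rightarrow> complex) set" where
  "P' x = {b \<in> topspace \<beta>. fst (\<rho> b) = x}"

definition ra' :: "(('y \<Rightarrow> complex) \<Rightarrow> complex) \<Rightarrow> 'a" where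
  "ra' b = snd (\<rho> b)"

lemma P'_subset: "P' x \<subseteq> topspace \<beta>"
  by (auto simp: P'_def)

lemma rho_topspace: "b \<in> topspace \<beta> \<Longrightarrow> fst (\<rho> b) \<in> cobj C \<and> snd (\<rho> b) \<in> topspace (unit_top (Gs (fst (\<rho> b))))"
  using funcset_mem[OF continuous_map_funspace[OF rho_continuous], of b] by (auto simp: unit_sum_def)

lemma P'_union: "(\<Union>x\<in>cobj C. P' x) = topspace \<beta>"
  using rho_topspace by (auto simp: P'_def)

lemma P'_preimage:
  assumes x: "x \<in> cobj C" and V: "V \<subseteq> topspace (unit_top (Gs x))"
  shows "{b \<in> topspace \<beta>. \<rho> b \<in> Pair x ` V} = {b \<in> P' x. ra' b \<in> V}"
  by (auto simp: P'_def ra'_def prod_eq_iff image_iff)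

text \<open>An open subset of one summand is open in the disjoint union. Openness of the pieces and
  continuity of \<open>ra'\<close> on each piece are both read off from this.\<close>

lemma P'_open_preimage:
  assumes x: "x \<in> cobj C" and V: "openin (unit_top (Gs x)) V"
  shows "openin \<beta> {b \<in> P' x. ra' b \<in> V}"
proof -
  have "openin (unit_sum C Gs) (Pair x ` V)"
    using open_map_component_injection[OF x, of "\<lambda>x. unit_top (Gs x)"] V by (simp add: open_map_def unit_sum_def)
  from openin_continuous_map_preimage[OF rho_continuous this]
  show ?thesis unfolding P'_preimage[OF x openin_subset[OF V]] .
qed

lemma P'_eq: "x \<in> cobj C \<Longrightarrow> P' x = {b \<in> P' x. ra' b \<in> topspace (unit_top (Gs x))}"
  using rho_topspace by (auto simp: P'_def ra'_def)

lemma P'_open: "x \<in> cobj C \<Longrightarrow> openin \<beta> (P' x)"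
  using P'_open_preimage[of x "topspace (unit_top (Gs x))"] P'_eq[of x] openin_topspace by metis

lemma P'_closed:
  assumes x: "x \<in> cobj C" shows "closedin \<beta> (P' x)"
proof -
  have "closedin (unit_sum C Gs) (Pair x ` topspace (unit_top (Gs x)))"
    using closed_map_component_injection[OF x, of "\<lambda>x. unit_top (Gs x)"] closedin_topspace
    unfolding closed_map_def unit_sum_def by blast
  from closedin_continuous_map_preimage[OF rho_continuous this]
  show ?thesis unfolding P'_preimage[OF x order_refl] using P'_eq[OF x] by simp
qed

lemma ra'_continuous:
  assumes x: "x \<in> cobj C"
  shows "continuous_map (subtopology \<beta> (P' x)) (unit_top (Gs x)) ra'"
  unfolding continuous_map_def
proof (intro conjI allI impI)
  show "ra' \<in> topspace (subtopology \<beta> (P' x)) \<rightarrow> topspace (unit_top (Gs x))"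
    using P'_eq[OF x] by auto
  fix V assume "openin (unit_top (Gs x)) V"
  from P'_open_preimage[OF x this]
  show "openin (subtopology \<beta> (P' x)) {b \<in> topspace (subtopology \<beta> (P' x)). ra' b \<in> V}"
    using P'_subset[of x] P'_open[OF x] by (auto simp: openin_open_subtopology inf.absorb2)
qed

lemma iota_topspace: "y \<in> topspace T \<Longrightarrow> \<iota> y \<in> topspace \<beta>"
  using iota_chars topspace_beta by simp

lemma iota_P':
  assumes "x \<in> cobj C" "y \<in> topspace T" shows "\<iota> y \<in> P' x \<longleftrightarrow> y \<in> P x"
proof -
  obtain z where z: "z \<in> cobj C" "y \<in> P z" using P_union assms(2) by blast
  then have "\<rho> (\<iota> y) = (z, ra y)" using rho_iota[OF assms(2)] anchor_sum_eq by simp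
  then show ?thesis
    using P_unique[OF z(1) assms(1) z(2)] z(2) iota_topspace[OF assms(2)] by (auto simp: P'_def)
qed

lemma ra'_iota:
  assumes "y \<in> topspace T" shows "ra' (\<iota> y) = ra y"
proof -
  obtain z where "z \<in> cobj C" "y \<in> P z" using P_union assms by blast
  then show ?thesis using rho_iota[OF assms] anchor_sum_eq by (simp add: ra'_def)
qed

lemma P_preimage: "x \<in> cobj C \<Longrightarrow> P x = {y \<in> topspace T. \<iota> y \<in> P' x}"
  using iota_P' P_subset by blast

abbreviation "EY g \<equiv> aprod C Xs T P ra g"
abbreviation "E\<beta> g \<equiv> aprod C Xs \<beta> P' ra' g"
abbreviation "fib_iota \<equiv> \<lambda>(\<gamma>::'a, y). (\<gamma>, \<iota> y)"
abbreviation "Q g \<equiv> orbit_top (Xs g) (Gs (cdom C g))"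
abbreviation "orb g \<equiv> orbit (Xs g) (Gs (cdom C g))"

lemma dense_jE:
  assumes g: "g \<in> carr C" shows "dense_map (EY g) (E\<beta> g) fib_iota"
proof (rule dense_map_fprod[OF dense_iota csrc_open[OF g] P'_open[OF dom_obj[OF g]] P_preimage[OF dom_obj[OF g]]
      ra'_continuous[OF dom_obj[OF g]]])
  show "ra y = ra' (\<iota> y)" if "y \<in> P (cdom C g)" for y
    using ra'_iota that P_subset[OF dom_obj[OF g]] by auto
qed

lemma topspace_E\<beta>: "topspace (E\<beta> g) = adom C Xs P' ra' g"
  using P'_subset by (auto simp: topspace_fprod adom_def)

lemma continuous_map_crng_fst:
  assumes g: "g \<in> carr C"
  shows "continuous_map (fprod (ctop (Xs g)) s D S r) (unit_sum C Gs) (\<lambda>z. (ccod C g, crng (Xs g) (fst z)))"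
  using continuous_map_compose[OF continuous_map_compose[OF continuous_map_fprod_fst crng_unit_top[OF g]]
      continuous_map_unit_injection[OF cod_obj[OF g]]]
  by (simp add: o_def)

lemma act_topspace: "g \<in> carr C \<Longrightarrow> (\<gamma>, y) \<in> adom C Xs P ra g \<Longrightarrow> act g \<gamma> y \<in> topspace T"
  using act_in_P P_subset[OF cod_obj] by blast

text \<open>The anchor of \<open>\<gamma> y\<close> is \<open>crng (Xs g) \<gamma>\<close>, which
  depends on \<gamma> alone and so is already defined on \<open>E\<beta> g\<close>. Only the
  functions in \<open>H\<close> need a genuine extension, and the source map being a local
  homeomorphism supplies it.\<close>

lemma act_extends:
  assumes g: "g \<in> carr C"
  shows "extends_along (EY g) (E\<beta> g) fib_iota \<beta> (\<lambda>d. \<iota> (case d of (\<gamma>, y) \<Rightarrow> act g \<gamma> y))"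
proof (rule extends_along_into_beta[OF dense_jE[OF g]])
  let ?m = "\<lambda>(\<gamma>, y). act g \<gamma> y"
  have cT: "continuous_map (EY g) T ?m"
    using act_continuous[OF g] continuous_map_into_fulltopology by blast
  then show "?m \<in> topspace (EY g) \<rightarrow> topspace T" by (rule continuous_map_funspace)
  show "extends_along (EY g) (E\<beta> g) fib_iota euclidean (\<lambda>d. u (?m d))" if u: "u \<in> H" for u
  proof -
    obtain M where M: "\<And>y. norm (u y) \<le> M" using Cb_bound[OF HX_subset_Cb[OF u]] by metis
    show ?thesis
    proof (rule extends_along_fprod[OF corr_local_homeo[OF g] P'_open[OF dom_obj[OF g]] P_preimage[OF dom_obj[OF g]]
          ra'_continuous[OF dom_obj[OF g]], where M = M])
      show "ra y = ra' (\<iota> y)" if "y \<in> P (cdom C g)" for y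
        using ra'_iota that P_subset[OF dom_obj[OF g]] by auto
      show "continuous_map (EY g) euclidean (\<lambda>d. u (?m d))"
        using continuous_map_compose[OF cT Cb_continuous[OF HX_subset_Cb[OF u]]] by (simp add: o_def)
    qed (use M in auto)
  qed
  show "extends_along (EY g) (E\<beta> g) fib_iota (unit_sum C Gs) (\<lambda>d. anchor_sum C P ra (?m d))"
  proof (rule extends_alongI[OF continuous_map_crng_fst[OF g]])
    fix d assume "d \<in> topspace (EY g)"
    then show "(ccod C g, crng (Xs g) (fst (fib_iota d))) = anchor_sum C P ra (?m d)"
      using anchor_sum_eq[OF cod_obj[OF g] act_in_P[OF g]] act_anchor[OF g]
      by (cases d) (simp add: topspace_aprod[OF g])
  qed
qed

definition act_beta :: "'m \<Rightarrow> 'a \<times> (('y \<Rightarrow> complex) \<Rightarrow> complex) \<Rightarrow> (('y \<Rightarrow> complex) \<Rightarrow> complex)" where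
  "act_beta g = (SOME m. continuous_map (E\<beta> g) \<beta> m \<and>
      (\<forall>d\<in>topspace (EY g). m (fib_iota d) = \<iota> (case d of (\<gamma>, y) \<Rightarrow> act g \<gamma> y)))"

lemma
  assumes g: "g \<in> carr C"
  shows act_beta_continuous: "continuous_map (E\<beta> g) \<beta> (act_beta g)"
    and act_beta_iota: "(\<gamma>, y) \<in> adom C Xs P ra g \<Longrightarrow> act_beta g (\<gamma>, \<iota> y) = \<iota> (act g \<gamma> y)"
  using someI_ex[OF act_extends[OF g, unfolded extends_along_def]] topspace_aprod[OF g]
  unfolding act_beta_def by fastforce+

text \<open>Both sides are continuous into a Hausdorff space and agree on the dense part. The one
  equation gives the piece and the anchor of the product at once.\<close>

lemma act_beta_rho:
  assumes g: "g \<in> carr C" and e: "e \<in> topspace (E\<beta> g)"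
  shows "\<rho> (act_beta g e) = (ccod C g, crng (Xs g) (fst e))"
proof (rule dense_map_agree[OF dense_jE[OF g] hB _ continuous_map_crng_fst[OF g] _ e])
  show "continuous_map (E\<beta> g) (unit_sum C Gs) (\<lambda>e. \<rho> (act_beta g e))"
    using continuous_map_compose[OF act_beta_continuous[OF g] rho_continuous] by (simp add: o_def)
  fix d assume "d \<in> topspace (EY g)"
  then obtain \<gamma> y where d: "d = (\<gamma>, y)" "(\<gamma>, y) \<in> adom C Xs P ra g"
    by (cases d) (simp add: topspace_aprod[OF g])
  then show "\<rho> (act_beta g (fib_iota d)) = (ccod C g, crng (Xs g) (fst (fib_iota d)))"
    using act_beta_iota[OF g d(2)] rho_iota[OF act_topspace[OF g d(2)]]
      anchor_sum_eq[OF cod_obj[OF g] act_in_P[OF g d(2)]] act_anchor[OF g d(2)] by simp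
qed

lemma act_beta_topspace: "g \<in> carr C \<Longrightarrow> e \<in> topspace (E\<beta> g) \<Longrightarrow> act_beta g e \<in> topspace \<beta>"
  using funcset_mem[OF continuous_map_funspace[OF act_beta_continuous]] .

lemma act_beta_P': "g \<in> carr C \<Longrightarrow> e \<in> topspace (E\<beta> g) \<Longrightarrow> act_beta g e \<in> P' (ccod C g)"
  and act_beta_ra': "g \<in> carr C \<Longrightarrow> e \<in> topspace (E\<beta> g) \<Longrightarrow> ra' (act_beta g e) = crng (Xs g) (fst e)"
  using act_beta_rho act_beta_topspace by (auto simp: P'_def ra'_def)

section \<open>The extended orbit map and local inverses of the action\<close>

definition orbit_of :: "'m \<Rightarrow> 'y \<Rightarrow> 'a set" where
  "orbit_of g z = orb g (fst (SOME e. e \<in> adom C Xs P ra g \<and> act g (fst e) (snd e) = z))"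

text \<open>Independence of the chosen decomposition: two decompositions of the same point have
  first factors differing by some \<open>\<eta>\<close>, hence in the same orbit.\<close>

lemma orbit_of_act:
  assumes g: "g \<in> carr C" and d: "(\<gamma>, y) \<in> adom C Xs P ra g"
  shows "orbit_of g (act g \<gamma> y) = orb g \<gamma>"
proof -
  define e where "e = (SOME e. e \<in> adom C Xs P ra g \<and> act g (fst e) (snd e) = act g \<gamma> y)"
  have e: "e \<in> adom C Xs P ra g \<and> act g (fst e) (snd e) = act g \<gamma> y"
    unfolding e_def by (rule someI[of _ "(\<gamma>, y)"]) (use d in auto)
  then obtain \<eta> where "\<eta> \<in> garr (Gs (cdom C g))" "grng (Gs (cdom C g)) \<eta> = csrc (Xs g) \<gamma>"
     "fst e = ract (Xs g) \<gamma> \<eta>"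
    using act_eqD[OF g d, of "fst e" "snd e"] by auto
  moreover from this have "(\<gamma>, \<eta>) \<in> rdom (Xs g) (Gs (cdom C g))" using d by (simp add: rdom_def adom_def)
  ultimately have "orb g (fst e) = orb g \<gamma>"
    using orbit_ract[OF etale[OF dom_obj[OF g]] corr_right[OF g]] by simp
  then show ?thesis unfolding orbit_of_def e_def by simp
qed

lemma continuous_map_orb:
  "g \<in> carr C \<Longrightarrow> continuous_map (ctop (Xs g)) (Q g) (orb g)"
  by (rule quotient_imp_continuous_map[OF quotient_map_orbit[OF etale[OF dom_obj] corr_right]])

lemma open_map_orb:
  "g \<in> carr C \<Longrightarrow> open_map (ctop (Xs g)) (Q g) (orb g)"
  by (rule open_map_orbit[OF etale[OF dom_obj] corr_right])

text \<open>The action map is an open continuous surjection and therefore a quotient map; composed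
  with it, \<open>orbit_of g\<close> becomes the orbit map of the first factor.\<close>

lemma orbit_of_continuous:
  assumes g: "g \<in> carr C"
  shows "continuous_map (subtopology T (P (ccod C g))) (Q g) (orbit_of g)"
proof (rule continuous_compose_quotient_map)
  show "quotient_map (EY g) (subtopology T (P (ccod C g))) (\<lambda>(\<gamma>, y). act g \<gamma> y)"
    using act_continuous[OF g] act_open[OF g] act_surj[OF g] P_subset[OF cod_obj[OF g]]
    by (intro continuous_open_imp_quotient_map) (auto simp: topspace_aprod[OF g] inf.absorb2)
  have "continuous_map (EY g) (Q g) (\<lambda>d. orb g (fst d))"
    using continuous_map_compose[OF continuous_map_fprod_fst continuous_map_orb[OF g]] by (simp add: o_def)
  then show "continuous_map (EY g) (Q g) (orbit_of g \<circ> (\<lambda>(\<gamma>, y). act g \<gamma> y))"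
    by (rule continuous_map_eq) (auto simp: topspace_aprod[OF g] orbit_of_act[OF g])
qed

lemma Hausdorff_Q: "g \<in> carr C \<Longrightarrow> Hausdorff_space (Q g)"
  using lc_corrs by (simp add: lc_corr_def)

text \<open>Properness of the correspondence makes \<open>X/G\<close> locally compact and keeps the orbit map
  of \<open>Y\<close> locally relatively compact over the base, so that it extends.\<close>
lemma orbit_of_extends:
  assumes g: "g \<in> carr C"
  shows "extends_along (subtopology T (P (ccod C g))) (subtopology \<beta> (P' (ccod C g))) \<iota> (Q g) (orbit_of g)"
proof -
  let ?x = "ccod C g"
  note x = cod_obj[OF g]
  have dense: "dense_map (subtopology T (P ?x)) (subtopology \<beta> (P' ?x)) \<iota>"
    using dense_map_open_restrict[OF dense_iota P'_open[OF x]] P_preimage[OF x] by simp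
  show ?thesis
  proof (rule extends_along_completely_regular[OF dense orbit_of_continuous[OF g] _ Hausdorff_Q[OF g]])
    show "completely_regular_space (Q g)"
      using locally_compact_orbit_top[OF corr[OF g] etale[OF dom_obj[OF g]] proper[OF g] lc_groupoids[OF x]]
        Hausdorff_Q[OF g] locally_compact_regular_imp_completely_regular_space by blast
    fix k assume k: "continuous_map (Q g) (top_of_set {0..1::real}) k"
    have k': "continuous_map (Q g) euclideanreal k" using k by (simp add: continuous_map_in_subtopology)
    have "continuous_map (subtopology T (P ?x)) euclidean (\<lambda>y. complex_of_real (k (orbit_of g y)))"
      using continuous_map_compose[OF orbit_of_continuous[OF g] k']
      by (intro continuous_map_complex_of_real) (simp add: o_def)
    then have c: "continuous_map (subtopology T {y \<in> topspace T. \<iota> y \<in> P' ?x}) euclidean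
        (\<lambda>y. complex_of_real (k (orbit_of g y)))"
      unfolding P_preimage[OF x, symmetric] .
    have b: "norm (complex_of_real (k (orbit_of g y))) \<le> 1" if "y \<in> topspace T" "\<iota> y \<in> P' ?x" for y
    proof -
      have "y \<in> topspace (subtopology T (P ?x))" using that iota_P'[OF x that(1)] by simp
      then have "orbit_of g y \<in> topspace (Q g)"
        using funcset_mem[OF continuous_map_funspace[OF orbit_of_continuous[OF g]]] by blast
      then have "k (orbit_of g y) \<in> {0..1}"
        using funcset_mem[OF continuous_map_funspace[OF k]] by simp
      then show ?thesis by simp
    qed
    from extends_along_open[OF P'_open[OF x] c b]
    obtain h where h: "continuous_map (subtopology \<beta> (P' ?x)) euclidean h"
      "\<And>y. y \<in> topspace (subtopology T (P ?x)) \<Longrightarrow> h (\<iota> y) = complex_of_real (k (orbit_of g y))"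
      unfolding extends_along_def P_preimage[OF x, symmetric] by auto
    show "extends_along (subtopology T (P ?x)) (subtopology \<beta> (P' ?x)) \<iota> euclideanreal (\<lambda>d. k (orbit_of g d))"
      by (rule extends_alongI[OF continuous_map_Re[OF h(1)]]) (simp add: h(2))
  next
    fix e assume "e \<in> topspace (subtopology \<beta> (P' ?x))"
    then have e: "e \<in> P' ?x" by simp
    then have "ra' e \<in> topspace (unit_top (Gs ?x))" using P'_eq[OF x] by blast
    then obtain U K where UK: "openin (unit_top (Gs ?x)) U" "compactin (unit_top (Gs ?x)) K" "ra' e \<in> U" "U \<subseteq> K"
      using lc_groupoids[OF x] unfolding lc_groupoid_def locally_compact_space_def by meson
    \<comment> \<open>If \<open>d = \<gamma> y\<close> maps into this set, then
      \<open>crng (Xs g) \<gamma>\<close> is the anchor of \<open>d\<close> and lies in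
      \<open>K\<close>, so the orbit of \<gamma> lies in the compact set given by
      properness.\<close>
    let ?N = "{b \<in> P' ?x. ra' b \<in> U}"
    let ?K = "{orb g \<xi> | \<xi>. \<xi> \<in> topspace (ctop (Xs g)) \<and> crng (Xs g) \<xi> \<in> K}"
    have "openin (subtopology \<beta> (P' ?x)) ?N"
      using P'_open_preimage[OF x UK(1)] P'_open[OF x] by (auto simp: openin_open_subtopology)
    moreover have "compactin (Q g) ?K" using proper[OF g] UK(2) unfolding proper_corr_def by blast
    moreover have "orbit_of g d \<in> ?K" if d: "d \<in> topspace (subtopology T (P ?x))" "\<iota> d \<in> ?N" for d
    proof -
      have "d \<in> P ?x" using d(1) by simp
      then obtain \<gamma> y where gy: "(\<gamma>, y) \<in> adom C Xs P ra g" "d = act g \<gamma> y"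
        unfolding act_surj[OF g, symmetric] by auto
      have "crng (Xs g) \<gamma> = ra' (\<iota> d)"
        using act_anchor[OF g gy(1)] gy(2) ra'_iota[of d] d(1) by simp
      then have "crng (Xs g) \<gamma> \<in> K" using d(2) UK(4) by auto
      then show ?thesis using orbit_of_act[OF g gy(1)] gy by (auto simp: adom_def)
    qed
    ultimately show "\<exists>N K. openin (subtopology \<beta> (P' ?x)) N \<and> e \<in> N \<and> compactin (Q g) K \<and>
        (\<forall>d\<in>topspace (subtopology T (P ?x)). \<iota> d \<in> N \<longrightarrow> orbit_of g d \<in> K)"
      using e UK(3) by (intro exI[of _ ?N] exI[of _ ?K]) simp
  qed
qed

definition orbit_beta :: "'m \<Rightarrow> (('y \<Rightarrow> complex) \<Rightarrow> complex) \<Rightarrow> 'a set" where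
  "orbit_beta g = (SOME p. continuous_map (subtopology \<beta> (P' (ccod C g))) (Q g) p \<and>
      (\<forall>y\<in>topspace (subtopology T (P (ccod C g))). p (\<iota> y) = orbit_of g y))"

lemma
  assumes g: "g \<in> carr C"
  shows orbit_beta_continuous: "continuous_map (subtopology \<beta> (P' (ccod C g))) (Q g) (orbit_beta g)"
    and orbit_beta_iota: "y \<in> P (ccod C g) \<Longrightarrow> orbit_beta g (\<iota> y) = orbit_of g y"
  using someI_ex[OF orbit_of_extends[OF g, unfolded extends_along_def]] P_subset[OF cod_obj[OF g]]
  unfolding orbit_beta_def by auto

text \<open>Recovers the orbit of the first factor from a product in the compactification. This is
  the part of cancellation that density can provide.\<close>

lemma orbit_beta_mb:
  assumes g: "g \<in> carr C" and e: "e \<in> topspace (E\<beta> g)"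
  shows "orbit_beta g (act_beta g e) = orb g (fst e)"
proof (rule dense_map_agree[OF dense_jE[OF g] Hausdorff_Q[OF g] _ _ _ e])
  have "continuous_map (E\<beta> g) (subtopology \<beta> (P' (ccod C g))) (act_beta g)"
    unfolding continuous_map_in_subtopology using act_beta_continuous[OF g] act_beta_P'[OF g] by auto
  from continuous_map_compose[OF this orbit_beta_continuous[OF g]]
  show "continuous_map (E\<beta> g) (Q g) (\<lambda>e. orbit_beta g (act_beta g e))" by (simp add: o_def)
  show "continuous_map (E\<beta> g) (Q g) (\<lambda>e. orb g (fst e))"
    using continuous_map_compose[OF continuous_map_fprod_fst continuous_map_orb[OF g]] by (simp add: o_def)
  fix d assume "d \<in> topspace (EY g)"
  then obtain \<gamma> y where d: "d = (\<gamma>, y)" "(\<gamma>, y) \<in> adom C Xs P ra g"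
    by (cases d) (simp add: topspace_aprod[OF g])
  then show "orbit_beta g (act_beta g (fib_iota d)) = orb g (fst (fib_iota d))"
    using act_beta_iota[OF g d(2)] orbit_beta_iota[OF g act_in_P[OF g d(2)]] orbit_of_act[OF g d(2)] by simp
qed

text \<open>Over the image of the slice, \<open>z\<close> in \<open>Y\<close> decomposes uniquely as
  \<open>\<gamma> y\<close> with \<gamma> in \<open>U\<close>. Here \<gamma> is
  \<open>\<tau> (orbit_of g z)\<close>, which extends through \<open>orbit_beta\<close>, and
  \<open>y\<close> is \<open>\<theta> z\<close>, which extends by
  \<open>extends_along_into_beta\<close>. Both identities of an inverse then follow by
  density.\<close>

lemma local_inverse:
  assumes g: "g \<in> carr C" and U: "openin (ctop (Xs g)) U" and inj: "inj_on (orb g) U"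
  obtains N \<nu> where "openin \<beta> N" "N \<subseteq> P' (ccod C g)" "continuous_map (subtopology \<beta> N) (E\<beta> g) \<nu>"
    "\<And>c. c \<in> N \<Longrightarrow> act_beta g (\<nu> c) = c"
    "\<And>e. e \<in> topspace (E\<beta> g) \<Longrightarrow> fst e \<in> U \<Longrightarrow> act_beta g e \<in> N \<and> \<nu> (act_beta g e) = e"
    "\<And>c. c \<in> P' (ccod C g) \<Longrightarrow> orbit_beta g c \<in> orb g ` U \<Longrightarrow> c \<in> N"
proof -
  let ?x = "cdom C g" and ?x' = "ccod C g"
  let ?m = "\<lambda>(\<gamma>, y). act g \<gamma> y"
  note x = dom_obj[OF g] and x' = cod_obj[OF g]
  have OU: "openin (Q g) (orb g ` U)" using open_map_orb[OF g] U by (simp add: open_map_def)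
  define \<tau> where "\<tau> = inv_into U (orb g)"
  have \<tau>: "continuous_map (subtopology (Q g) (orb g ` U)) (ctop (Xs g)) \<tau>"
    using continuous_map_inv_into[OF open_map_orb[OF g] U inj] continuous_map_into_fulltopology
    unfolding \<tau>_def by blast
  have \<tau>_orb: "\<tau> (orb g \<gamma>) = \<gamma>" if "\<gamma> \<in> U" for \<gamma> using that inj by (simp add: \<tau>_def)
  define N where "N = {c \<in> P' ?x'. orbit_beta g c \<in> orb g ` U}"
  have N_eq: "N = {c \<in> topspace (subtopology \<beta> (P' ?x')). orbit_beta g c \<in> orb g ` U}"
    using P'_subset by (auto simp: N_def)
  have N: "openin \<beta> N"
    using openin_continuous_map_preimage[OF orbit_beta_continuous[OF g] OU] P'_open[OF x']
    by (simp add: N_eq openin_open_subtopology)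
  define YU where "YU = {z \<in> topspace T. \<iota> z \<in> N}"
  have YU: "z \<in> YU \<longleftrightarrow> z \<in> P ?x' \<and> orbit_of g z \<in> orb g ` U" for z
  proof (cases "z \<in> P ?x'")
    case True
    then show ?thesis
      using iota_P'[OF x', of z] P_subset[OF x'] orbit_beta_iota[OF g True] by (simp add: YU_def N_def subset_iff)
  next
    case False
    then show ?thesis using iota_P'[OF x', of z] by (auto simp: YU_def N_def)
  qed
  define MU where "MU = {d \<in> topspace (EY g). fst d \<in> U}"
  have MU: "openin (EY g) MU"
    unfolding MU_def by (rule openin_continuous_map_preimage[OF continuous_map_fprod_fst U])
  have MU_eq: "MU = {d \<in> adom C Xs P ra g. fst d \<in> U}"
    by (simp add: MU_def topspace_aprod[OF g])
  have injm: "inj_on ?m MU" unfolding MU_eq by (rule act_inj_slice[OF g inj])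
  have image: "?m ` MU = YU"
  proof (intro set_eqI iffI)
    fix z assume "z \<in> ?m ` MU"
    then obtain \<gamma> y where gy: "(\<gamma>, y) \<in> adom C Xs P ra g" "\<gamma> \<in> U" "z = act g \<gamma> y" by (auto simp: MU_eq)
    then show "z \<in> YU" using orbit_of_act[OF g gy(1)] act_in_P[OF g gy(1)] by (simp add: YU)
  next
    fix z assume z: "z \<in> YU"
    then have "z \<in> P ?x'" by (simp add: YU)
    then obtain \<gamma> y where gy: "(\<gamma>, y) \<in> adom C Xs P ra g" "z = act g \<gamma> y"
      unfolding act_surj[OF g, symmetric] by auto
    then obtain \<gamma>' where \<gamma>': "\<gamma>' \<in> U" "orb g \<gamma> = orb g \<gamma>'" using z orbit_of_act[OF g gy(1)] by (auto simp: YU)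
    note G = etale[OF x] and R = corr_right[OF g]
    have t: "\<gamma> \<in> topspace (ctop (Xs g))" "\<gamma>' \<in> topspace (ctop (Xs g))"
      using gy(1) \<gamma>'(1) openin_subset[OF U] by (auto simp: adom_def)
    obtain k where k: "(\<gamma>', k) \<in> rdom (Xs g) (Gs ?x)" "\<gamma> = ract (Xs g) \<gamma>' k"
      using orbit_eq_iff[OF G R t(2,1)] \<gamma>'(2) by metis
    let ?i = "cid C ?x"
    note i = id_arr[OF x] id_dom[OF x] id_cod[OF x]
    have ka: "k \<in> garr (Gs ?x)" "csrc (Xs g) \<gamma>' = grng (Gs ?x) k" using k(1) by (auto simp: rdom_def)
    have ky: "(k, y) \<in> adom C Xs P ra ?i"
      using gy(1) ka ract_src[OF R k(1)] k(2) by (simp add: adom_def i id_corr_simps[OF x])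
    have f: "(\<gamma>', k) \<in> cfib (Xs g) (Xs ?i)" using ka t by (simp add: cfib_def id_corr_simps[OF x])
    \<comment> \<open>With \<open>\<gamma> = \<gamma>' k\<close> the arrow \<open>k\<close> is moved
      across to \<open>y\<close>, which replaces the first factor by one in
      \<open>U\<close>.\<close>
    have "act g \<gamma>' (act ?i k y) = z"
      using act_assoc[OF g i(1) _ f ky] i cmp_id_right[OF g] dot_id_right[OF g f] k(2) gy(2) by simp
    moreover have "(\<gamma>', act ?i k y) \<in> adom C Xs P ra g"
      using act_in_P[OF i(1) ky] act_anchor[OF i(1) ky] ka t(2) by (simp add: adom_def i id_corr_simps[OF x])
    ultimately show "z \<in> ?m ` MU"
      using \<gamma>'(1) by (intro image_eqI[of _ _ "(\<gamma>', act ?i k y)"]) (auto simp: MU_eq)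
  qed
  define e where "e = inv_into MU ?m"
  have YU_sub: "YU \<subseteq> P ?x'" using YU by blast
  have e_cont: "continuous_map (subtopology T YU) (EY g) e"
  proof -
    have "continuous_map (subtopology (subtopology T (P ?x')) YU) (subtopology (EY g) MU) e"
      using continuous_map_inv_into[OF act_open[OF g] MU injm] unfolding image e_def .
    then show ?thesis
      using YU_sub continuous_map_into_fulltopology by (fastforce simp: subtopology_subtopology inf.absorb2)
  qed
  have e_MU: "e z \<in> MU" "?m (e z) = z" if "z \<in> YU" for z
    using that unfolding image[symmetric] e_def by (auto intro: inv_into_into f_inv_into_f)
  have e_m: "e (?m d) = d" if "d \<in> MU" for d using that injm by (simp add: e_def)
  define \<theta> where "\<theta> z = snd (e z)" for z
  have \<theta>: "(\<tau> (orbit_of g z), \<theta> z) \<in> adom C Xs P ra g" "act g (\<tau> (orbit_of g z)) (\<theta> z) = z" if z: "z \<in> YU" for z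
  proof -
    obtain \<gamma> y where gy: "e z = (\<gamma>, y)" by (cases "e z")
    then have "(\<gamma>, y) \<in> adom C Xs P ra g" "\<gamma> \<in> U" "act g \<gamma> y = z" using e_MU[OF z] by (auto simp: MU_eq)
    moreover from this have "\<tau> (orbit_of g z) = \<gamma>" using orbit_of_act[OF g] \<tau>_orb by auto
    ultimately show "(\<tau> (orbit_of g z), \<theta> z) \<in> adom C Xs P ra g" "act g (\<tau> (orbit_of g z)) (\<theta> z) = z"
      by (auto simp: \<theta>_def gy)
  qed
  have \<theta>P: "\<theta> z \<in> P ?x" "\<theta> z \<in> topspace T" "ra (\<theta> z) = csrc (Xs g) (\<tau> (orbit_of g z))" if "z \<in> YU" for z
    using \<theta>(1)[OF that] P_subset[OF x] by (auto simp: adom_def)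
  have \<theta>_cont: "continuous_map (subtopology T YU) T \<theta>"
    using continuous_map_compose[OF e_cont continuous_map_into_fulltopology[OF continuous_map_fprod_snd]]
    by (simp add: o_def \<theta>_def[abs_def])
  have orbit_beta_N: "continuous_map (subtopology \<beta> N) (subtopology (Q g) (orb g ` U)) (orbit_beta g)"
  proof -
    have "continuous_map (subtopology \<beta> N) (Q g) (orbit_beta g)"
      using orbit_beta_continuous[OF g] by (rule continuous_map_from_subtopology_mono) (auto simp: N_def)
    then show ?thesis unfolding continuous_map_in_subtopology by (auto simp: N_def)
  qed
  have \<tau>orbit_beta: "continuous_map (subtopology \<beta> N) (ctop (Xs g)) (\<lambda>c. \<tau> (orbit_beta g c))"
    using continuous_map_compose[OF orbit_beta_N \<tau>] by (simp add: o_def)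
  \<comment> \<open>The anchor of \<open>\<theta> z\<close> equals the source of its partner
    \<open>\<tau> (orbit_of g z)\<close>, so this is the extended anchor required for extending
    \<theta>.\<close>
  have s\<tau>orbit_beta: "continuous_map (subtopology \<beta> N) (unit_sum C Gs) (\<lambda>c. (?x, csrc (Xs g) (\<tau> (orbit_beta g c))))"
    using continuous_map_compose[OF continuous_map_compose[OF \<tau>orbit_beta csrc_unit_top[OF g]]
        continuous_map_unit_injection[OF x]] by (simp add: o_def)
  have dense: "dense_map (subtopology T YU) (subtopology \<beta> N) \<iota>"
    unfolding YU_def by (rule dense_map_open_restrict[OF dense_iota N])
  have pbY: "orbit_beta g (\<iota> z) = orbit_of g z" if "z \<in> YU" for z using orbit_beta_iota[OF g] that by (simp add: YU)
  have "extends_along (subtopology T YU) (subtopology \<beta> N) \<iota> \<beta> (\<lambda>z. \<iota> (\<theta> z))"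
  proof (rule extends_along_into_beta[OF dense])
    show "\<theta> \<in> topspace (subtopology T YU) \<rightarrow> topspace T" by (rule continuous_map_funspace[OF \<theta>_cont])
    show "extends_along (subtopology T YU) (subtopology \<beta> N) \<iota> euclidean (\<lambda>z. u (\<theta> z))" if u: "u \<in> H" for u
    proof -
      obtain M where M: "\<And>y. norm (u y) \<le> M" using Cb_bound[OF HX_subset_Cb[OF u]] by metis
      have "continuous_map (subtopology T YU) euclidean (\<lambda>z. u (\<theta> z))"
        using continuous_map_compose[OF \<theta>_cont Cb_continuous[OF HX_subset_Cb[OF u]]] by (simp add: o_def)
      then show ?thesis
        using extends_along_open[OF N, of "\<lambda>z. u (\<theta> z)" M] M unfolding YU_def by blast
    qed
    show "extends_along (subtopology T YU) (subtopology \<beta> N) \<iota> (unit_sum C Gs) (\<lambda>z. anchor_sum C P ra (\<theta> z))"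
      by (rule extends_alongI[OF s\<tau>orbit_beta]) (simp add: pbY anchor_sum_eq[OF x] \<theta>P)
  qed
  then obtain \<theta>b where \<theta>b: "continuous_map (subtopology \<beta> N) \<beta> \<theta>b" "\<And>z. z \<in> YU \<Longrightarrow> \<theta>b (\<iota> z) = \<iota> (\<theta> z)"
    unfolding extends_along_def YU_def by auto
  have \<theta>b_top: "\<theta>b c \<in> topspace \<beta>" if "c \<in> N" for c
    using funcset_mem[OF continuous_map_funspace[OF \<theta>b(1)], of c] that openin_subset[OF N] by auto
  have \<theta>b_rho: "\<rho> (\<theta>b c) = (?x, csrc (Xs g) (\<tau> (orbit_beta g c)))" if c: "c \<in> N" for c
  proof (rule dense_map_agree[OF dense hB _ s\<tau>orbit_beta])
    show "continuous_map (subtopology \<beta> N) (unit_sum C Gs) (\<lambda>c. \<rho> (\<theta>b c))"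
      using continuous_map_compose[OF \<theta>b(1) rho_continuous] by (simp add: o_def)
    show "\<rho> (\<theta>b (\<iota> d)) = (?x, csrc (Xs g) (\<tau> (orbit_beta g (\<iota> d))))" if "d \<in> topspace (subtopology T YU)" for d
      using that \<theta>b(2)[of d] rho_iota[of "\<theta> d"] anchor_sum_eq[OF x, of "\<theta> d"] \<theta>P[of d] pbY[of d] by simp
    show "c \<in> topspace (subtopology \<beta> N)" using c openin_subset[OF N] by auto
  qed
  define \<nu> where "\<nu> c = (\<tau> (orbit_beta g c), \<theta>b c)" for c
  have \<nu>: "continuous_map (subtopology \<beta> N) (E\<beta> g) \<nu>"
    unfolding \<nu>_def[abs_def]
  proof (rule continuous_map_into_fprod[OF \<tau>orbit_beta \<theta>b(1)])
    fix c assume "c \<in> topspace (subtopology \<beta> N)"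
    then have "c \<in> N" by simp
    then show "\<theta>b c \<in> P' ?x \<and> csrc (Xs g) (\<tau> (orbit_beta g c)) = ra' (\<theta>b c)"
      using \<theta>b_rho \<theta>b_top by (simp add: P'_def ra'_def)
  qed
  have right: "act_beta g (\<nu> c) = c" if c: "c \<in> N" for c
  proof (rule dense_map_agree[OF dense Hausdorff_beta, where g' = "\<lambda>c. c"])
    show "continuous_map (subtopology \<beta> N) \<beta> (\<lambda>c. act_beta g (\<nu> c))"
      using continuous_map_compose[OF \<nu> act_beta_continuous[OF g]] by (simp add: o_def)
    show "continuous_map (subtopology \<beta> N) \<beta> (\<lambda>c. c)" by (simp add: continuous_map_from_subtopology)
    show "act_beta g (\<nu> (\<iota> d)) = \<iota> d" if "d \<in> topspace (subtopology T YU)" for d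
      using that \<theta>b(2)[of d] \<theta>[of d] act_beta_iota[OF g] pbY[of d] by (simp add: \<nu>_def)
    show "c \<in> topspace (subtopology \<beta> N)" using c openin_subset[OF N] by auto
  qed
  define M\<beta> where "M\<beta> = {e \<in> topspace (E\<beta> g). fst e \<in> U}"
  have M\<beta>: "openin (E\<beta> g) M\<beta>"
    unfolding M\<beta>_def by (rule openin_continuous_map_preimage[OF continuous_map_fprod_fst U])
  have mN: "act_beta g a \<in> N" "\<tau> (orbit_beta g (act_beta g a)) = fst a" if "a \<in> M\<beta>" for a
    using that act_beta_P'[OF g] orbit_beta_mb[OF g] \<tau>_orb by (auto simp: M\<beta>_def N_def)
  \<comment> \<open>Only the second component is at issue; the first one is
    \<open>mN\<close>.\<close>
  have left: "\<theta>b (act_beta g a) = snd a" if a: "a \<in> M\<beta>" for a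
  proof (rule dense_map_agree[OF dense_map_open_restrict[OF dense_jE[OF g] M\<beta>] Hausdorff_beta])
    have "continuous_map (subtopology (E\<beta> g) M\<beta>) (subtopology \<beta> N) (act_beta g)"
      unfolding continuous_map_in_subtopology
      using continuous_map_from_subtopology[OF act_beta_continuous[OF g]] mN(1) by auto
    from continuous_map_compose[OF this \<theta>b(1)]
    show "continuous_map (subtopology (E\<beta> g) M\<beta>) \<beta> (\<lambda>a. \<theta>b (act_beta g a))" by (simp add: o_def)
    show "continuous_map (subtopology (E\<beta> g) M\<beta>) \<beta> snd"
      by (rule continuous_map_from_subtopology[OF continuous_map_into_fulltopology[OF continuous_map_fprod_snd]])
    show "a \<in> topspace (subtopology (E\<beta> g) M\<beta>)" using a openin_subset[OF M\<beta>] by auto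
    fix d assume d: "d \<in> topspace (subtopology (EY g) {d \<in> topspace (EY g). fib_iota d \<in> M\<beta>})"
    obtain \<gamma> y where gy: "d = (\<gamma>, y)" by (cases d)
    then have dm: "(\<gamma>, y) \<in> adom C Xs P ra g" "(\<gamma>, y) \<in> MU"
      using d by (auto simp: topspace_aprod[OF g] M\<beta>_def MU_eq)
    then have z: "act g \<gamma> y \<in> YU" using image by force
    have "\<theta> (act g \<gamma> y) = y" using e_m[OF dm(2)] by (simp add: \<theta>_def)
    then show "\<theta>b (act_beta g (fib_iota d)) = snd (fib_iota d)"
      using act_beta_iota[OF g dm(1)] \<theta>b(2)[OF z] by (simp add: gy)
  qed
  show ?thesis
  proof (rule that[OF N _ \<nu> right])
    show "act_beta g a \<in> N \<and> \<nu> (act_beta g a) = a" if "a \<in> topspace (E\<beta> g)" "fst a \<in> U" for a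
      using mN[of a] left[of a] that by (simp add: \<nu>_def M\<beta>_def)
  qed (auto simp: N_def)
qed

lemma slice:
  assumes g: "g \<in> carr C" and \<gamma>: "\<gamma> \<in> topspace (ctop (Xs g))"
  obtains U where "openin (ctop (Xs g)) U" "\<gamma> \<in> U" "inj_on (orb g) U"
  using slice_exists[OF etale[OF dom_obj[OF g]] corr_right[OF g] corr_basic[OF g] corr_local_homeo[OF g] \<gamma>]
  by metis

text \<open>The extended orbit of \<open>c\<close> is the orbit of some \<gamma>; a slice through
  \<gamma> has \<open>c\<close> in the domain of its local inverse.\<close>

lemma act_beta_surj:
  assumes g: "g \<in> carr C" and c: "c \<in> P' (ccod C g)"
  obtains e where "e \<in> topspace (E\<beta> g)" "act_beta g e = c"
proof -
  have "orbit_beta g c \<in> topspace (Q g)"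
    using funcset_mem[OF continuous_map_funspace[OF orbit_beta_continuous[OF g]], of c] c P'_subset by auto
  then obtain \<gamma> where \<gamma>: "\<gamma> \<in> topspace (ctop (Xs g))" "orbit_beta g c = orb g \<gamma>"
    using quotient_imp_surjective_map[OF quotient_map_orbit[OF etale[OF dom_obj[OF g]] corr_right[OF g]]] by blast
  obtain U where U: "openin (ctop (Xs g)) U" "\<gamma> \<in> U" "inj_on (orb g) U"
    using slice[OF g \<gamma>(1)] by metis
  obtain N \<nu> where N: "openin \<beta> N" "continuous_map (subtopology \<beta> N) (E\<beta> g) \<nu>"
    "\<And>c. c \<in> N \<Longrightarrow> act_beta g (\<nu> c) = c" "\<And>c. c \<in> P' (ccod C g) \<Longrightarrow> orbit_beta g c \<in> orb g ` U \<Longrightarrow> c \<in> N"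
    using local_inverse[OF g U(1,3)] by metis
  have "c \<in> N" using N(4)[OF c] \<gamma>(2) U(2) by blast
  then show ?thesis
    using that[of "\<nu> c"] N(3) funcset_mem[OF continuous_map_funspace[OF N(2)], of c] openin_subset[OF N(1)]
    by auto
qed

text \<open>Both points have the same first component, so one slice and one local inverse recover
  both. Combined with the extended orbit map it yields cancellation.\<close>

lemma act_beta_inj:
  assumes g: "g \<in> carr C" and e: "(\<gamma>, b) \<in> topspace (E\<beta> g)" "(\<gamma>, b') \<in> topspace (E\<beta> g)"
    and eq: "act_beta g (\<gamma>, b) = act_beta g (\<gamma>, b')"
  shows "b = b'"
proof -
  have \<gamma>: "\<gamma> \<in> topspace (ctop (Xs g))" using e(1) by (simp add: topspace_fprod)
  obtain U where U: "openin (ctop (Xs g)) U" "\<gamma> \<in> U" "inj_on (orb g) U"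
    using slice[OF g \<gamma>] by metis
  obtain \<nu> where "\<And>e. e \<in> topspace (E\<beta> g) \<Longrightarrow> fst e \<in> U \<Longrightarrow> \<nu> (act_beta g e) = e"
    using local_inverse[OF g U(1,3)] by metis
  from this[OF e(1)] this[OF e(2)] U(2) have "\<nu> (act_beta g (\<gamma>, b)) = (\<gamma>, b)" "\<nu> (act_beta g (\<gamma>, b')) = (\<gamma>, b')"
    by simp_all
  then show ?thesis using eq by (metis Pair_inject)
qed

text \<open>Around \<open>act_beta g e\<close> the set of points that \<nu> sends into
  \<open>W\<close> is open, and it lies in the image of \<open>W\<close> because the action inverts
  \<nu>.\<close>

lemma act_beta_open:
  assumes g: "g \<in> carr C"
  shows "open_map (E\<beta> g) (subtopology \<beta> (P' (ccod C g))) (act_beta g)"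
  unfolding open_map_def
proof (intro allI impI)
  fix W assume W: "openin (E\<beta> g) W"
  have "openin \<beta> (act_beta g ` W)"
  proof (subst openin_subopen, intro ballI)
    fix c assume "c \<in> act_beta g ` W"
    then obtain e where e: "e \<in> W" "c = act_beta g e" by blast
    then have et: "e \<in> topspace (E\<beta> g)" using openin_subset[OF W] by blast
    have "fst e \<in> topspace (ctop (Xs g))" using et by (auto simp: topspace_fprod)
    then obtain U where U: "openin (ctop (Xs g)) U" "fst e \<in> U" "inj_on (orb g) U"
      using slice[OF g] by metis
    obtain N \<nu> where N: "openin \<beta> N" "continuous_map (subtopology \<beta> N) (E\<beta> g) \<nu>"
      "\<And>c. c \<in> N \<Longrightarrow> act_beta g (\<nu> c) = c"
      "\<And>e. e \<in> topspace (E\<beta> g) \<Longrightarrow> fst e \<in> U \<Longrightarrow> act_beta g e \<in> N \<and> \<nu> (act_beta g e) = e"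
      using local_inverse[OF g U(1,3)] by metis
    let ?V = "{c \<in> topspace (subtopology \<beta> N). \<nu> c \<in> W}"
    have "openin \<beta> ?V"
      using openin_continuous_map_preimage[OF N(2) W] N(1) by (simp add: openin_open_subtopology)
    moreover have "c \<in> ?V" using N(4)[OF et U(2)] e openin_subset[OF N(1)] by auto
    moreover have "?V \<subseteq> act_beta g ` W" using N(3) by force
    ultimately show "\<exists>V. openin \<beta> V \<and> c \<in> V \<and> V \<subseteq> act_beta g ` W" by blast
  qed
  moreover have "act_beta g ` W \<subseteq> P' (ccod C g)" using act_beta_P'[OF g] openin_subset[OF W] by blast
  ultimately show "openin (subtopology \<beta> (P' (ccod C g))) (act_beta g ` W)"
    using P'_open[OF cod_obj[OF g]] by (simp add: openin_open_subtopology)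
qed

text \<open>The two correspondences are fused into one space \<open>?A\<close> with the open anchor
  \<open>?s\<close>, the source of the second factor. The triple product is then an ordinary fibre
  product over this anchor, so it contains the triples coming from \<open>Y\<close> densely.\<close>

lemma act_beta_assoc:
  assumes g: "g1 \<in> carr C" "g2 \<in> carr C" "cdom C g1 = ccod C g2"
    and f: "(\<gamma>1, \<gamma>2) \<in> cfib (Xs g1) (Xs g2)" and d: "(\<gamma>2, b) \<in> adom C Xs P' ra' g2"
  shows "act_beta g1 (\<gamma>1, act_beta g2 (\<gamma>2, b)) = act_beta (cmp C g1 g2) (dot g1 g2 \<gamma>1 \<gamma>2, b)"
proof -
  let ?z = "cdom C g2" and ?h = "cmp C g1 g2"
  note z = dom_obj[OF g(2)] and h = cmp_arr[OF g] and hd = cmp_dom[OF g]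
  let ?A = "subtopology (prod_topology (ctop (Xs g1)) (ctop (Xs g2))) (cfib (Xs g1) (Xs g2))"
  let ?s = "\<lambda>a. csrc (Xs g2) (snd a)"
  have A: "?A = fprod (ctop (Xs g1)) (csrc (Xs g1)) (ctop (Xs g2)) (topspace (ctop (Xs g2))) (crng (Xs g2))"
    by (simp add: fprod_def cfib_def)
  have tA: "topspace ?A = cfib (Xs g1) (Xs g2)" by (auto simp: cfib_def)
  have "open_map ?A (ctop (Xs g2)) snd"
    unfolding A using open_map_fprod_snd[OF csrc_open[OF g(1)]] crng_unit_top[OF g(2)] g(3) by simp
  from open_map_compose[OF this csrc_open[OF g(2)]]
  have s: "open_map ?A (unit_top (Gs ?z)) ?s" by (simp add: o_def)
  let ?D = "fprod ?A ?s T (P ?z) ra" and ?E = "fprod ?A ?s \<beta> (P' ?z) ra'"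
  have dense: "dense_map ?D ?E (\<lambda>(a, y). (a, \<iota> y))"
    using dense_map_fprod[OF dense_iota s P'_open[OF z] P_preimage[OF z] ra'_continuous[OF z], of ra]
      ra'_iota P_subset[OF z] by (metis (no_types, lifting) subsetD)
  have tE: "topspace ?E = {(a, b). a \<in> cfib (Xs g1) (Xs g2) \<and> (snd a, b) \<in> adom C Xs P' ra' g2}"
    unfolding topspace_fprod tA using P'_subset[of ?z] by (auto simp: adom_def cfib_def)
  have tD: "topspace ?D = {(a, b). a \<in> cfib (Xs g1) (Xs g2) \<and> (snd a, b) \<in> adom C Xs P ra g2}"
    unfolding topspace_fprod tA using P_subset[OF z] by (auto simp: adom_def cfib_def)
  have fE: "continuous_map ?E ?A fst" and sE: "continuous_map ?E \<beta> snd"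
    using continuous_map_fprod_fst continuous_map_into_fulltopology[OF continuous_map_fprod_snd] by blast+
  have f1: "continuous_map ?E (ctop (Xs g1)) (\<lambda>e. fst (fst e))"
    and f2: "continuous_map ?E (ctop (Xs g2)) (\<lambda>e. snd (fst e))"
    using continuous_map_compose[OF fE continuous_map_from_subtopology[OF continuous_map_fst]]
      continuous_map_compose[OF fE continuous_map_from_subtopology[OF continuous_map_snd]]
    by (simp_all add: o_def)
  have c2: "continuous_map ?E (E\<beta> g2) (\<lambda>e. (snd (fst e), snd e))"
    by (rule continuous_map_into_fprod[OF f2 sE]) (auto simp: tE adom_def)
  have m2: "continuous_map ?E \<beta> (\<lambda>e. act_beta g2 (snd (fst e), snd e))"
    using continuous_map_compose[OF c2 act_beta_continuous[OF g(2)]] by (simp add: o_def)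
  have c1: "continuous_map ?E (E\<beta> g1) (\<lambda>e. (fst (fst e), act_beta g2 (snd (fst e), snd e)))"
  proof (rule continuous_map_into_fprod[OF f1 m2])
    fix e assume e: "e \<in> topspace ?E"
    then have e2: "(snd (fst e), snd e) \<in> topspace (E\<beta> g2)" unfolding topspace_E\<beta> tE by auto
    have "csrc (Xs g1) (fst (fst e)) = crng (Xs g2) (snd (fst e))" using e unfolding tE by (auto simp: cfib_def)
    then show "act_beta g2 (snd (fst e), snd e) \<in> P' (cdom C g1) \<and>
        csrc (Xs g1) (fst (fst e)) = ra' (act_beta g2 (snd (fst e), snd e))"
      using act_beta_P'[OF g(2) e2] act_beta_ra'[OF g(2) e2] g(3) by simp
  qed
  have m1: "continuous_map ?E \<beta> (\<lambda>e. act_beta g1 (fst (fst e), act_beta g2 (snd (fst e), snd e)))"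
    using continuous_map_compose[OF c1 act_beta_continuous[OF g(1)]] by (simp add: o_def)
  have dc: "continuous_map ?E (ctop (Xs ?h)) (\<lambda>e. dot g1 g2 (fst (fst e)) (snd (fst e)))"
    using continuous_map_compose[OF fE continuous_map_dot[OF g]] by (simp add: o_def case_prod_unfold)
  have "continuous_map ?E (E\<beta> ?h) (\<lambda>e. (dot g1 g2 (fst (fst e)) (snd (fst e)), snd e))"
  proof (rule continuous_map_into_fprod[OF dc sE])
    fix e assume "e \<in> topspace ?E"
    then have "(fst (fst e), snd (fst e)) \<in> cfib (Xs g1) (Xs g2)" "(snd (fst e), snd e) \<in> adom C Xs P' ra' g2"
      unfolding tE by auto
    then show "snd e \<in> P' (cdom C ?h) \<and> csrc (Xs ?h) (dot g1 g2 (fst (fst e)) (snd (fst e))) = ra' (snd e)"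
      using dot_csrc[OF g] hd by (simp add: adom_def)
  qed
  from continuous_map_compose[OF this act_beta_continuous[OF h]]
  have mh: "continuous_map ?E \<beta> (\<lambda>e. act_beta ?h (dot g1 g2 (fst (fst e)) (snd (fst e)), snd e))"
    by (simp add: o_def)
  have "act_beta g1 (fst (fst e), act_beta g2 (snd (fst e), snd e)) = act_beta ?h (dot g1 g2 (fst (fst e)) (snd (fst e)), snd e)"
    if e: "e \<in> topspace ?E" for e
  proof (rule dense_map_agree[OF dense Hausdorff_beta m1 mh _ e])
    fix d assume "d \<in> topspace ?D"
    then obtain c1 c2 y where d: "d = ((c1, c2), y)" "(c1, c2) \<in> cfib (Xs g1) (Xs g2)" "(c2, y) \<in> adom C Xs P ra g2"
      unfolding tD by auto
    have d1: "(c1, act g2 c2 y) \<in> adom C Xs P ra g1"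
      using act_in_P[OF g(2) d(3)] act_anchor[OF g(2) d(3)] d(2) g(3) by (simp add: adom_def cfib_def)
    have dh: "(dot g1 g2 c1 c2, y) \<in> adom C Xs P ra ?h"
      using dot_topspace[OF g d(2)] dot_csrc[OF g d(2)] d(3) hd by (simp add: adom_def)
    show "act_beta g1 (fst (fst (case d of (a, y) \<Rightarrow> (a, \<iota> y))),
            act_beta g2 (snd (fst (case d of (a, y) \<Rightarrow> (a, \<iota> y))), snd (case d of (a, y) \<Rightarrow> (a, \<iota> y)))) =
         act_beta ?h (dot g1 g2 (fst (fst (case d of (a, y) \<Rightarrow> (a, \<iota> y)))) (snd (fst (case d of (a, y) \<Rightarrow> (a, \<iota> y)))),
            snd (case d of (a, y) \<Rightarrow> (a, \<iota> y)))"
      using act_beta_iota[OF g(2) d(3)] act_beta_iota[OF g(1) d1] act_beta_iota[OF h dh] act_assoc[OF g d(2,3)]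
      by (simp add: d(1))
  qed
  from this[of "((\<gamma>1, \<gamma>2), b)"] show ?thesis using f d unfolding tE by simp
qed

lemma beta_F_action: "F_action C Gs Xs mu \<beta> P' ra' (\<lambda>g \<gamma> b. act_beta g (\<gamma>, b))"
proof -
  have m: "(\<lambda>(\<gamma>, b). act_beta g (\<gamma>, b)) = act_beta g" for g by auto
  have 1: "\<forall>x\<in>cobj C. openin \<beta> (P' x) \<and> closedin \<beta> (P' x)"
    using P'_open P'_closed by blast
  have 2: "\<forall>x\<in>cobj C. \<forall>x'\<in>cobj C. x \<noteq> x' \<longrightarrow> P' x \<inter> P' x' = {}"
    by (auto simp: P'_def)
  have 3: "\<forall>x\<in>cobj C. continuous_map (subtopology \<beta> (P' x)) (unit_top (Gs x)) ra'"
    using ra'_continuous by blast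
  have 4: "continuous_map (E\<beta> g) (subtopology \<beta> (P' (ccod C g))) (act_beta g) \<and>
        open_map (E\<beta> g) (subtopology \<beta> (P' (ccod C g))) (act_beta g) \<and>
        act_beta g ` adom C Xs P' ra' g = P' (ccod C g) \<and>
        (\<forall>(\<gamma>, b)\<in>adom C Xs P' ra' g. ra' (act_beta g (\<gamma>, b)) = crng (Xs g) \<gamma>)" if g: "g \<in> carr C" for g
  proof (intro conjI)
    show "continuous_map (E\<beta> g) (subtopology \<beta> (P' (ccod C g))) (act_beta g)"
      unfolding continuous_map_in_subtopology using act_beta_continuous[OF g] act_beta_P'[OF g] by auto
    show "open_map (E\<beta> g) (subtopology \<beta> (P' (ccod C g))) (act_beta g)" by (rule act_beta_open[OF g])
    show "act_beta g ` adom C Xs P' ra' g = P' (ccod C g)"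
      using act_beta_P'[OF g] act_beta_surj[OF g] unfolding topspace_E\<beta> by blast
    show "\<forall>(\<gamma>, b)\<in>adom C Xs P' ra' g. ra' (act_beta g (\<gamma>, b)) = crng (Xs g) \<gamma>"
      using act_beta_ra'[OF g] unfolding topspace_E\<beta> by fastforce
  qed
  have 5: "\<exists>\<eta>\<in>garr (Gs (cdom C g)).
           grng (Gs (cdom C g)) \<eta> = csrc (Xs g) \<gamma> \<and> gsrc (Gs (cdom C g)) \<eta> = ra' b' \<and>
           \<gamma>' = ract (Xs g) \<gamma> \<eta> \<and> b = act_beta (cid C (cdom C g)) (\<eta>, b')"
    if g: "g \<in> carr C" and d: "(\<gamma>, b) \<in> adom C Xs P' ra' g" "(\<gamma>', b') \<in> adom C Xs P' ra' g"
      and eq: "act_beta g (\<gamma>, b) = act_beta g (\<gamma>', b')" for g \<gamma> b \<gamma>' b'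
  proof -
    let ?x = "cdom C g" let ?i = "cid C ?x"
    note x = dom_obj[OF g] note i = id_arr[OF x] id_dom[OF x] id_cod[OF x]
    note G = etale[OF x] and R = corr_right[OF g]
    have t: "\<gamma> \<in> topspace (ctop (Xs g))" "\<gamma>' \<in> topspace (ctop (Xs g))" using d by (auto simp: adom_def)
    have "orb g \<gamma> = orb g \<gamma>'"
      using orbit_beta_mb[OF g, of "(\<gamma>, b)"] orbit_beta_mb[OF g, of "(\<gamma>', b')"] d eq by (simp add: topspace_E\<beta>)
    then obtain k where k: "(\<gamma>, k) \<in> rdom (Xs g) (Gs ?x)" "\<gamma>' = ract (Xs g) \<gamma> k"
      using orbit_eq_iff[OF G R t] by blast
    have ka: "k \<in> garr (Gs ?x)" "csrc (Xs g) \<gamma> = grng (Gs ?x) k" using k(1) by (auto simp: rdom_def)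
    have src: "gsrc (Gs ?x) k = ra' b'" using ract_src[OF R k(1)] k(2) d(2) by (simp add: adom_def)
    have kb: "(k, b') \<in> adom C Xs P' ra' ?i"
      using d(2) ka src by (simp add: adom_def i id_corr_simps[OF x])
    have f: "(\<gamma>, k) \<in> cfib (Xs g) (Xs ?i)" using ka t by (simp add: cfib_def id_corr_simps[OF x])
    \<comment> \<open>By associativity this is \<open>\<gamma> k\<close> applied to
      \<open>b'\<close>, that is \<open>\<gamma>'\<close> applied to \<open>b'\<close>. With equal
      first factors \<open>act_beta_inj\<close> then cancels \<gamma>.\<close>
    have m: "act_beta g (\<gamma>, act_beta ?i (k, b')) = act_beta g (\<gamma>, b)"
      using act_beta_assoc[OF g i(1) _ f kb] i cmp_id_right[OF g] dot_id_right[OF g f] k(2) eq by simp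
    have e: "(k, b') \<in> topspace (E\<beta> ?i)" using kb unfolding topspace_E\<beta> .
    have "(\<gamma>, act_beta ?i (k, b')) \<in> topspace (E\<beta> g)"
      unfolding topspace_E\<beta> using act_beta_P'[OF i(1) e] act_beta_ra'[OF i(1) e] ka t(1)
      by (simp add: adom_def i id_corr_simps[OF x])
    from act_beta_inj[OF g this _ m] have "act_beta ?i (k, b') = b" using d(1) by (simp add: topspace_E\<beta>)
    then show ?thesis using ka src k(2) by (intro bexI[of _ k]) auto
  qed
  have 4: "\<forall>g\<in>carr C. continuous_map (E\<beta> g) (subtopology \<beta> (P' (ccod C g))) (act_beta g) \<and>
        open_map (E\<beta> g) (subtopology \<beta> (P' (ccod C g))) (act_beta g) \<and>
        act_beta g ` adom C Xs P' ra' g = P' (ccod C g) \<and>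
        (\<forall>(\<gamma>, b)\<in>adom C Xs P' ra' g. ra' (act_beta g (\<gamma>, b)) = crng (Xs g) \<gamma>)"
    using 4 by (rule ballI)
  have 6: "\<forall>g1\<in>carr C. \<forall>g2\<in>carr C. \<forall>\<gamma>1 \<gamma>2 b. cdom C g1 = ccod C g2 \<longrightarrow>
        (\<gamma>1, \<gamma>2) \<in> cfib (Xs g1) (Xs g2) \<longrightarrow> (\<gamma>2, b) \<in> adom C Xs P' ra' g2 \<longrightarrow>
        act_beta g1 (\<gamma>1, act_beta g2 (\<gamma>2, b)) = act_beta (cmp C g1 g2) (dot g1 g2 \<gamma>1 \<gamma>2, b)"
    by (intro ballI allI impI) (rule act_beta_assoc)
  have 7: "\<forall>g\<in>carr C. \<forall>\<gamma> b \<gamma>' b'. (\<gamma>, b) \<in> adom C Xs P' ra' g \<longrightarrow> (\<gamma>', b') \<in> adom C Xs P' ra' g \<longrightarrow>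
        act_beta g (\<gamma>, b) = act_beta g (\<gamma>', b') \<longrightarrow>
        (\<exists>\<eta>\<in>garr (Gs (cdom C g)).
           grng (Gs (cdom C g)) \<eta> = csrc (Xs g) \<gamma> \<and> gsrc (Gs (cdom C g)) \<eta> = ra' b' \<and>
           \<gamma>' = ract (Xs g) \<gamma> \<eta> \<and> b = act_beta (cid C (cdom C g)) (\<eta>, b'))"
    by (intro ballI allI impI) (rule 5)
  show ?thesis
    unfolding F_action_def m aprod_eq_subtopology[symmetric]
    by (rule conjI[OF 1 conjI[OF 2 conjI[OF P'_union conjI[OF 3 conjI[OF 4 conjI[OF 6 7]]]]]])
qed

lemma beta_F_equivariant:
  "F_equivariant C Xs T P ra act \<beta> P' ra' (\<lambda>g \<gamma> b. act_beta g (\<gamma>, b)) \<iota>"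
proof -
  have "\<forall>(\<gamma>, y)\<in>adom C Xs P ra g. \<iota> (act g \<gamma> y) = act_beta g (\<gamma>, \<iota> y)" if "g \<in> carr C" for g
    using act_beta_iota[OF that] by fastforce
  moreover have "\<forall>x\<in>cobj C. \<iota> ` P x \<subseteq> P' x" using P_preimage by blast
  ultimately show ?thesis
    unfolding F_equivariant_def using continuous_map_iota ra'_iota by blast
qed

section \<open>Uniqueness of the extended action\<close>

lemma equivariant_partition_subset:
  assumes 1: "F_action C Gs Xs mu \<beta> P1 ra1 act1" "F_equivariant C Xs T P ra act \<beta> P1 ra1 act1 \<iota>"
    and 2: "F_action C Gs Xs mu \<beta> P2 ra2 act2" "F_equivariant C Xs T P ra act \<beta> P2 ra2 act2 \<iota>"
    and x: "x \<in> cobj C"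
  shows "P1 x \<subseteq> P2 x"
proof
  interpret A1: F_space C Gs Xs mu \<beta> P1 ra1 act1 by unfold_locales (rule 1)
  interpret A2: F_space C Gs Xs mu \<beta> P2 ra2 act2 by unfold_locales (rule 2)
  fix b assume b: "b \<in> P1 x"
  show "b \<in> P2 x"
  proof (rule ccontr)
    assume "b \<notin> P2 x"
    \<comment> \<open>This difference is open because \<open>P2 x\<close> is closed, so it contains
      an evaluation \<open>\<iota> y\<close>. If \<open>y\<close> lies in \<open>P z\<close>,
      equivariance puts \<open>\<iota> y\<close> into both \<open>P1 z\<close> and
      \<open>P2 z\<close>, and disjointness forces \<open>z = x\<close>.\<close>
    then have "b \<in> P1 x - P2 x" using b by blast
    moreover have "openin \<beta> (P1 x - P2 x)" using A1.P_open[OF x] A2.P_closed[OF x] by blast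
    ultimately obtain y where y: "y \<in> topspace T" "\<iota> y \<in> P1 x - P2 x"
      using dense_map_meets[OF dense_iota] by blast
    then obtain z where z: "z \<in> cobj C" "y \<in> P z" using P_union by blast
    have "\<iota> ` P z \<subseteq> P1 z" "\<iota> ` P z \<subseteq> P2 z"
      using 1(2) 2(2) z(1) by (simp_all add: F_equivariant_def)
    then have "\<iota> y \<in> P1 z" "\<iota> y \<in> P2 z" using z(2) by blast+
    moreover from this have "z = x" using A1.P_unique[OF z(1) x] y(2) by blast
    ultimately show False using y(2) by blast
  qed
qed

text \<open>The order matters: equal partitions let the anchors be compared piece by piece in a
  Hausdorff unit space, and equal anchors give the two actions a common domain in which the products
  coming from \<open>Y\<close> are dense.\<close>

lemma equivariant_unique:
  assumes 1: "F_action C Gs Xs mu \<beta> P1 ra1 act1" "F_equivariant C Xs T P ra act \<beta> P1 ra1 act1 \<iota>"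
    and 2: "F_action C Gs Xs mu \<beta> P2 ra2 act2" "F_equivariant C Xs T P ra act \<beta> P2 ra2 act2 \<iota>"
  shows "same_F_action C Xs \<beta> P1 ra1 act1 P2 ra2 act2"
proof -
  interpret A1: F_space C Gs Xs mu \<beta> P1 ra1 act1 by unfold_locales (rule 1)
  interpret A2: F_space C Gs Xs mu \<beta> P2 ra2 act2 by unfold_locales (rule 2)
  have P: "P1 x = P2 x" if "x \<in> cobj C" for x
    using equivariant_partition_subset[OF 1 2 that] equivariant_partition_subset[OF 2 1 that] by blast
  have sub: "\<iota> ` P x \<subseteq> P1 x" if "x \<in> cobj C" for x
    using 1(2) that by (simp add: F_equivariant_def)
  \<comment> \<open>Equality, and not only inclusion, is what density of the restricted maps
    requires; it holds because the pieces \<open>P1\<close> are disjoint while the pieces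
    \<open>P\<close> cover \<open>Y\<close>.\<close>
  have pre: "P x = {y \<in> topspace T. \<iota> y \<in> P1 x}" if x: "x \<in> cobj C" for x
  proof (intro set_eqI iffI)
    fix y assume "y \<in> {y \<in> topspace T. \<iota> y \<in> P1 x}"
    then have y: "y \<in> topspace T" "\<iota> y \<in> P1 x" by auto
    then obtain z where z: "z \<in> cobj C" "y \<in> P z" using P_union by blast
    then have "\<iota> y \<in> P1 z" using sub by blast
    then show "y \<in> P x" using A1.P_unique[OF z(1) x] y(2) z(2) by blast
  qed (use sub[OF x] P_subset[OF x] in auto)
  have ra1: "ra1 (\<iota> y) = ra y" and ra2: "ra2 (\<iota> y) = ra y" if "y \<in> topspace T" for y
    using 1(2) 2(2) that by (auto simp: F_equivariant_def)
  have ra: "ra1 b = ra2 b" if x: "x \<in> cobj C" and b: "b \<in> P1 x" for x b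
  proof (rule dense_map_agree[where g = ra1 and g' = ra2 and e = b])
    show "dense_map (subtopology T (P x)) (subtopology \<beta> (P1 x)) \<iota>"
      unfolding pre[OF x] by (rule dense_map_open_restrict[OF dense_iota A1.P_open[OF x]])
    show "Hausdorff_space (unit_top (Gs x))" using lc_groupoids[OF x] by (simp add: lc_groupoid_def)
    show "continuous_map (subtopology \<beta> (P1 x)) (unit_top (Gs x)) ra2"
      using A2.ra_continuous[OF x] P[OF x] by simp
  qed (use A1.ra_continuous[OF x] ra1 ra2 b A1.P_subset[OF x] in auto)
  have "act1 g \<gamma> b = act2 g \<gamma> b" if g: "g \<in> carr C" and d: "(\<gamma>, b) \<in> adom C Xs P1 ra1 g" for g \<gamma> b
  proof -
    note x = dom_obj[OF g]
    have ad: "adom C Xs P2 ra2 g = adom C Xs P1 ra1 g"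
      using P[OF x] ra[OF x] by (auto simp: adom_def)
    have dense: "dense_map (EY g) (aprod C Xs \<beta> P1 ra1 g) fib_iota"
    proof (rule dense_map_fprod[OF dense_iota csrc_open[OF g] A1.P_open[OF x] pre[OF x] A1.ra_continuous[OF x]])
      show "ra y = ra1 (\<iota> y)" if "y \<in> P (cdom C g)" for y using ra1 that P_subset[OF x] by auto
    qed
    have c1: "continuous_map (aprod C Xs \<beta> P1 ra1 g) \<beta> (\<lambda>(\<gamma>, b). act1 g \<gamma> b)"
      using A1.act_continuous[OF g] continuous_map_into_fulltopology by blast
    have c2: "continuous_map (aprod C Xs \<beta> P1 ra1 g) \<beta> (\<lambda>(\<gamma>, b). act2 g \<gamma> b)"
      using continuous_map_into_fulltopology[OF A2.act_continuous[OF g]]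
      unfolding aprod_eq_subtopology ad .
    have e: "(\<gamma>, b) \<in> topspace (aprod C Xs \<beta> P1 ra1 g)" using d A1.topspace_aprod[OF g] by simp
    have "(\<lambda>(\<gamma>, b). act1 g \<gamma> b) (\<gamma>, b) = (\<lambda>(\<gamma>, b). act2 g \<gamma> b) (\<gamma>, b)"
    proof (rule dense_map_agree[OF dense Hausdorff_beta c1 c2 _ e])
      fix d assume "d \<in> topspace (EY g)"
      then obtain c y where d: "d = (c, y)" "(c, y) \<in> adom C Xs P ra g"
        by (cases d) (simp add: topspace_aprod[OF g])
      have "\<iota> (act g c y) = act1 g c (\<iota> y)" "\<iota> (act g c y) = act2 g c (\<iota> y)"
        using 1(2) 2(2) g d(2) unfolding F_equivariant_def by blast+
      then show "(\<lambda>(\<gamma>, b). act1 g \<gamma> b) (fib_iota d) = (\<lambda>(\<gamma>, b). act2 g \<gamma> b) (fib_iota d)" by (simp add: d(1))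
    qed
    then show ?thesis by simp
  qed
  moreover have "ra1 b = ra2 b" if "b \<in> topspace \<beta>" for b
    using that ra unfolding A1.P_union[symmetric] by blast
  ultimately show ?thesis unfolding same_F_action_def using P by blast
qed

end

theorem theorem5p3:
  fixes C :: "('o, 'm) category"
    and Gs :: "'o \<Rightarrow> 'a groupoid"
    and Xs :: "'m \<Rightarrow> 'a corr"
    and mu :: "'m \<Rightarrow> 'm \<Rightarrow> ('a \<times> 'a) set \<Rightarrow> 'a"
    and T :: "'y topology"
    and P :: "'o \<Rightarrow> 'y set"
    and ra :: "'y \<Rightarrow> 'a"
    and act :: "'m \<Rightarrow> 'a \<Rightarrow> 'y \<Rightarrow> 'y"
  assumes diag: "is_diagram C Gs Xs mu"
    and lc_groupoids: "\<forall>x\<in>cobj C. lc_groupoid (Gs x)"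
    and proper: "\<forall>g\<in>carr C. proper_corr (Gs (ccod C g)) (Gs (cdom C g)) (Xs g)"
    and lc_corrs: "\<forall>g\<in>carr C. lc_corr (Gs (ccod C g)) (Gs (cdom C g)) (Xs g)"
    and Yact: "F_action C Gs Xs mu T P ra act"
  shows "(\<exists>P' ra' act'.
            F_action C Gs Xs mu (beta_top T (unit_sum C Gs) (anchor_sum C P ra)) P' ra' act' \<and>
            F_equivariant C Xs T P ra act
              (beta_top T (unit_sum C Gs) (anchor_sum C P ra)) P' ra' act'
              (beta_i T (unit_sum C Gs) (anchor_sum C P ra))) \<and>
         (\<forall>P1 ra1 act1 P2 ra2 act2.
            F_action C Gs Xs mu (beta_top T (unit_sum C Gs) (anchor_sum C P ra)) P1 ra1 act1 \<and>
            F_equivariant C Xs T P ra act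
              (beta_top T (unit_sum C Gs) (anchor_sum C P ra)) P1 ra1 act1
              (beta_i T (unit_sum C Gs) (anchor_sum C P ra)) \<and>
            F_action C Gs Xs mu (beta_top T (unit_sum C Gs) (anchor_sum C P ra)) P2 ra2 act2 \<and>
            F_equivariant C Xs T P ra act
              (beta_top T (unit_sum C Gs) (anchor_sum C P ra)) P2 ra2 act2
              (beta_i T (unit_sum C Gs) (anchor_sum C P ra)) \<longrightarrow>
            same_F_action C Xs (beta_top T (unit_sum C Gs) (anchor_sum C P ra))
              P1 ra1 act1 P2 ra2 act2)"
proof -
  interpret F_beta C Gs Xs mu T P ra act
    by unfold_locales (use assms in auto)
  show ?thesis
    using beta_F_action beta_F_equivariant equivariant_unique by blast
qed

end
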